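(* There is a polynomial-time algorithm which, given a connected cubic bipartite graph $G$ with $n>6$ vertices, computes a $2$-factor of $G$ with at most $\frac{n}{7}$ cycles.
   Context: A graph is cubic if every vertex has degree $3$. A $2$-factor of $G$ is a spanning subgraph in which every vertex has degree exactly $2$, i.e. a collection of vertex-disjoint cycles covering all vertices of $G$. *)

theory Defs
  imports
    Complex_Main
    "HOL-Computational_Algebra.Polynomial"
    "Graph_Theory.Digraph_Component"
    "Graph_Theory.Pair_Digraph"
begin

section \<open>Finite simple graphs\<close>

text \<open>
  A finite simple undirected graph is a \<^locale>\<open>pair_graph\<close>: the edge \<open>{u, v}\<close> is the pair of
  arcs \<open>(u, v)\<close>, \<open>(v, u)\<close>, so the degree of a vertex is its out-degree.
\<close>

definition regular :: "nat \<Rightarrow> 'a pair_pre_digraph \<Rightarrow> bool" where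
  "regular d G \<longleftrightarrow> (\<forall>v \<in> pverts G. out_degree (with_proj G) v = d)"

definition bipartite :: "'a pair_pre_digraph \<Rightarrow> bool" where
  "bipartite G \<longleftrightarrow>
     (\<exists>A B. pverts G = A \<union> B \<and> A \<inter> B = {} \<and> parcs G \<subseteq> A \<times> B \<union> B \<times> A)"

definition two_factor :: "'a pair_pre_digraph \<Rightarrow> 'a pair_pre_digraph \<Rightarrow> bool" where
  "two_factor H G \<longleftrightarrow> pair_graph H \<and> spanning (with_proj H) (with_proj G) \<and> regular 2 H"

text \<open>
  A cycle is identified with its edge set, which forgets the starting vertex and the direction of
  traversal. The length condition excludes walking back and forth along a single edge.
\<close>

definition cycles :: "'a pair_pre_digraph \<Rightarrow> 'a rel set" where
  "cycles H = {set p \<union> (set p)\<inverse> | p. pre_digraph.cycle (with_proj H) p \<and> 3 \<le> length p}"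


section \<open>Random access machine programs\<close>

text \<open>
  Structured programs for a random access machine whose memory consists of arrays of natural
  numbers; a scalar is cell 0 of an array. Every assignment and every test costs one step.
  Since addition and truncated subtraction are the only arithmetic operations, a number computed
  in \<open>t\<close> steps has \<open>O(t)\<close> more bits than the input, and therefore polynomial time in this unit-cost
  measure is the same as polynomial time on Turing machines. (With multiplication at unit cost
  this would fail.)
\<close>

type_synonym state = "string \<Rightarrow> nat \<Rightarrow> nat"

datatype aexp =
    Const nat
  | Cell string aexp
  | Plus aexp aexp
  | Minus aexp aexp

datatype bexp =
    Less aexp aexp
  | Eq aexp aexp
  | Not bexp
  | And bexp bexp

datatype com =
    Skip
  | Assign string aexp aexp
  | Seq com com
  | If bexp com com
  | While bexp com

fun aval :: "aexp \<Rightarrow> state \<Rightarrow> nat" where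
  "aval (Const k) s = k"
| "aval (Cell x a) s = s x (aval a s)"
| "aval (Plus a b) s = aval a s + aval b s"
| "aval (Minus a b) s = aval a s - aval b s"

fun bval :: "bexp \<Rightarrow> state \<Rightarrow> bool" where
  "bval (Less a b) s \<longleftrightarrow> aval a s < aval b s"
| "bval (Eq a b) s \<longleftrightarrow> aval a s = aval b s"
| "bval (Not b) s \<longleftrightarrow> \<not> bval b s"
| "bval (And b c) s \<longleftrightarrow> bval b s \<and> bval c s"

text \<open>\<open>exec c s t s'\<close>: started in \<open>s\<close>, program \<open>c\<close> halts in state \<open>s'\<close> after exactly \<open>t\<close> steps.\<close>

inductive exec :: "com \<Rightarrow> state \<Rightarrow> nat \<Rightarrow> state \<Rightarrow> bool" where
  exec_Skip: "exec Skip s 1 s"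
| exec_Assign: "exec (Assign x i a) s 1 (s(x := (s x)(aval i s := aval a s)))"
| exec_Seq: "exec c s t1 s' \<Longrightarrow> exec d s' t2 s'' \<Longrightarrow> exec (Seq c d) s (t1 + t2) s''"
| exec_IfTrue: "bval b s \<Longrightarrow> exec c s t s' \<Longrightarrow> exec (If b c d) s (Suc t) s'"
| exec_IfFalse: "\<not> bval b s \<Longrightarrow> exec d s t s' \<Longrightarrow> exec (If b c d) s (Suc t) s'"
| exec_WhileFalse: "\<not> bval b s \<Longrightarrow> exec (While b c) s 1 s"
| exec_WhileTrue: "bval b s \<Longrightarrow> exec c s t1 s' \<Longrightarrow> exec (While b c) s' t2 s'' \<Longrightarrow>
    exec (While b c) s (Suc (t1 + t2)) s''"

inductive_cases exec_SkipE: "exec Skip s t s'"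
inductive_cases exec_AssignE: "exec (Assign x i a) s t s'"
inductive_cases exec_SeqE: "exec (Seq c d) s t s'"
inductive_cases exec_IfE: "exec (If b c d) s t s'"
inductive_cases exec_WhileE: "exec (While b c) s t s'"

lemma exec_deterministic:
  "exec c s t s' \<Longrightarrow> exec c s u s'' \<Longrightarrow> u = t \<and> s'' = s'"
proof (induction arbitrary: u s'' rule: exec.induct)
  case exec_Skip
  then show ?case by (rule exec_SkipE) simp
next
  case exec_Assign
  then show ?case by (rule exec_AssignE) simp
next
  case exec_Seq
  from exec_Seq.prems show ?case by (rule exec_SeqE) (metis exec_Seq.IH)
next
  case exec_IfTrue
  from exec_IfTrue.prems show ?case
    by (rule exec_IfE) (use exec_IfTrue.hyps exec_IfTrue.IH in metis)+
next
  case exec_IfFalse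
  from exec_IfFalse.prems show ?case
    by (rule exec_IfE) (use exec_IfFalse.hyps exec_IfFalse.IH in metis)+
next
  case exec_WhileFalse
  from exec_WhileFalse.prems show ?case
    by (rule exec_WhileE) (use exec_WhileFalse.hyps in simp_all)
next
  case exec_WhileTrue
  from exec_WhileTrue.prems show ?case
    by (rule exec_WhileE) (use exec_WhileTrue.hyps exec_WhileTrue.IH in metis)+
qed


section \<open>Polynomial-time graph algorithms\<close>

text \<open>
  A graph on the vertices \<open>0, \<dots>, n - 1\<close> is presented by \<open>n\<close> and a list containing each edge
  exactly once, in either orientation and in any order.
\<close>

type_synonym edge_list = "nat \<times> (nat \<times> nat) list"

definition represents :: "edge_list \<Rightarrow> nat pair_pre_digraph \<Rightarrow> bool" where
  "represents L G \<longleftrightarrow> (case L of (n, es) \<Rightarrow>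
     pverts G = {..<n} \<and> parcs G = set es \<union> (set es)\<inverse> \<and>
     distinct (map (\<lambda>(u, v). {u, v}) es))"

definition input_state :: "edge_list \<Rightarrow> state" where
  "input_state L = (case L of (n, es) \<Rightarrow> (\<lambda>_ _. 0)
     (''n'' := (\<lambda>i. if i = 0 then n else 0),
      ''m'' := (\<lambda>i. if i = 0 then length es else 0),
      ''u'' := (\<lambda>i. if i < length es then fst (es ! i) else 0),
      ''v'' := (\<lambda>i. if i < length es then snd (es ! i) else 0)))"

definition output_of :: "state \<Rightarrow> edge_list" where
  "output_of s = (s ''n'' 0, map (\<lambda>i. (s ''u'' i, s ''v'' i)) [0..<s ''m'' 0])"

text \<open>
  On every graph \<open>G\<close> satisfying \<open>P\<close>, in every presentation, the program \<open>c\<close> halts within a number of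
  steps polynomial in the number of vertices and outputs a graph \<open>H\<close> with \<open>R G H\<close>.
\<close>

definition poly_time_computes ::
    "com \<Rightarrow> (nat pair_pre_digraph \<Rightarrow> bool) \<Rightarrow>
     (nat pair_pre_digraph \<Rightarrow> nat pair_pre_digraph \<Rightarrow> bool) \<Rightarrow> bool" where
  "poly_time_computes c P R \<longleftrightarrow>
     (\<exists>p :: nat poly. \<forall>G L. P G \<and> represents L G \<longrightarrow>
        (\<exists>t s H. exec c (input_state L) t s \<and> t \<le> poly p (card (pverts G)) \<and>
           represents (output_of s) H \<and> R G H))"

end

theory Submission
  imports Defs
begin

text \<open>
  A proper 3-edge-colouring of a cubic bipartite graph gives three 2-factors, whose cycles are the
  bicoloured cycles. Exchanging the two colours on one bicoloured cycle (a Kempe swap) changes only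
  the bicoloured cycles meeting it, so local search for a colouring with few bicoloured cycles ends
  after polynomially many swaps. At a local optimum the bicoloured cycles have average length at
  least 7, and hence one of the three 2-factors has at most \<open>n/7\<close> cycles. This is shown by
  discharging: only hexagons are too short, and if the swap of a hexagon does not pay off, then
  long bicoloured cycles pass through it several times.

  For this, no square may be bicoloured. Every square that is not contained in a \<open>K\<^sub>2\<^sub>,\<^sub>3\<close> is therefore
  contracted first: its opposite vertices \<open>x1\<close>, \<open>x3\<close> are identified, and so are \<open>x2\<close>, \<open>x4\<close>. The result
  is again a simple cubic bipartite graph, and a 2-factor of it extends to the original graph without
  an additional cycle. Squares in a \<open>K\<^sub>2\<^sub>,\<^sub>3\<close> are never bicoloured.
\<close>

section \<open>Connected components of symmetric relations\<close>

text \<open>The weights come from counting by vertices: a vertex on a bicoloured cycle of length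
  \<open>L\<close> contributes \<open>1 - 7/L\<close>, and over one colour pair this sums to
  \<open>n\<close> minus 7 times the number of cycles. Bipartiteness makes lengths even, so a
  hexagon falls short by exactly 1 and cycles of length at least 8 have a surplus. Every surplus may
  be claimed on behalf of both other colour pairs and hence counts half, so a hexagon must see a
  surplus of 2 at its six vertices. The search minimises the sum over all three pairs because a swap
  on an \<open>ab\<close>-cycle preserves the \<open>ab\<close>-cycles and trades
  \<open>ac\<close>-cycles against \<open>bc\<close>-cycles. The bipartition is never computed; it
  occurs in the proofs only. The program stores a graph solely as three involutions, the classes of
  a proper colouring. Contracting and expanding squares therefore means deleting and inserting
  coloured edges, where a Kempe swap provides a colour that is free at both ends.\<close>

definition comps :: "'a set \<Rightarrow> 'a rel \<Rightarrow> 'a set set" where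
  "comps V R = (\<lambda>v. R\<^sup>* `` {v}) ` V"

lemma finite_comps [simp]: "finite V \<Longrightarrow> finite (comps V R)"
  by (simp add: comps_def)

lemma comp_eq_iff:
  assumes "sym R"
  shows "R\<^sup>* `` {u} = R\<^sup>* `` {v} \<longleftrightarrow> (u, v) \<in> R\<^sup>*"
proof
  assume "R\<^sup>* `` {u} = R\<^sup>* `` {v}"
  then show "(u, v) \<in> R\<^sup>*" by blast
next
  assume uv: "(u, v) \<in> R\<^sup>*"
  then have "(v, u) \<in> R\<^sup>*" using assms by (meson sym_rtrancl symD)
  with uv show "R\<^sup>* `` {u} = R\<^sup>* `` {v}" by (auto intro: rtrancl_trans)
qed

lemma rtrancl_sym: "sym R \<Longrightarrow> (u, v) \<in> R\<^sup>* \<Longrightarrow> (v, u) \<in> R\<^sup>*"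
  by (meson sym_rtrancl symD)

lemma rtrancl_closed:
  assumes "(u, v) \<in> R\<^sup>*" "u \<in> S" "\<And>x y. x \<in> S \<Longrightarrow> (x, y) \<in> R \<Longrightarrow> y \<in> S"
  shows "v \<in> S"
  using assms(1,2) by (induction rule: rtrancl_induct) (auto intro: assms(3))

text \<open>A map that respects connectivity and meets every class induces a surjection on classes.
  It bounds the cycles of an expanded 2-factor by those of the contracted one; there \<phi> is the
  identity, because the contracted graph lives on a subset of the vertices.\<close>

lemma card_comps_map_le:
  assumes "finite V'" and R: "sym R"
    and edge: "\<And>x y. (x, y) \<in> R' \<Longrightarrow> (\<phi> x, \<phi> y) \<in> R\<^sup>*"
    and surj: "\<And>v. v \<in> V \<Longrightarrow> \<exists>x\<in>V'. (\<phi> x, v) \<in> R\<^sup>*"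
  shows "card (comps V R) \<le> card (comps V' R')"
proof -
  have path: "(\<phi> x, \<phi> y) \<in> R\<^sup>*" if "(x, y) \<in> R'\<^sup>*" for x y
    using that by (induction rule: rtrancl_induct) (auto intro: rtrancl_trans edge)
  \<comment> \<open>Acting on whole classes makes the induced map well defined without choosing
    representatives.\<close>
  define g where "g K = R\<^sup>* `` (\<phi> ` K)" for K
  have g: "g (R'\<^sup>* `` {x}) = R\<^sup>* `` {\<phi> x}" for x
    unfolding g_def by (auto intro: rtrancl_trans path)
  have "comps V R \<subseteq> g ` comps V' R'"
  proof
    fix K assume "K \<in> comps V R"
    then obtain v where v: "v \<in> V" "K = R\<^sup>* `` {v}" by (auto simp: comps_def)
    obtain x where x: "x \<in> V'" "(\<phi> x, v) \<in> R\<^sup>*" using surj v by blast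
    then have "K = g (R'\<^sup>* `` {x})" using v g comp_eq_iff[OF R] by metis
    then show "K \<in> g ` comps V' R'" using x by (auto simp: comps_def)
  qed
  then show ?thesis using surj_card_le[of "comps V' R'" "comps V R" g] assms(1) by simp
qed

text \<open>Each class of size \<open>s\<close> receives \<open>s\<close> shares \<open>1/s\<close>.
  This turns the number of cycles into a sum over vertices, the form on which discharging
  operates.\<close>

lemma card_comps_eq_sum:
  assumes fin: "finite V" and R: "sym R" "R \<subseteq> V \<times> V"
  shows "real (card (comps V R)) = (\<Sum>v\<in>V. 1 / real (card (R\<^sup>* `` {v})))"
proof -
  let ?g = "\<lambda>v. R\<^sup>* `` {v}"
  have inV: "?g v \<subseteq> V" if "v \<in> V" for v
    using R(2) that by (auto elim: rtranclE)
  have "(\<Sum>v\<in>V. 1 / real (card (?g v))) = (\<Sum>K\<in>?g ` V. \<Sum>v | v \<in> V \<and> ?g v = K. 1 / real (card (?g v)))"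
    by (rule sum.image_gen[OF fin])
  also have "\<dots> = (\<Sum>K\<in>?g ` V. 1)"
  proof (rule sum.cong[OF refl])
    fix K assume "K \<in> ?g ` V"
    then obtain w where w: "w \<in> V" "K = ?g w" by auto
    have eq: "{v \<in> V. ?g v = K} = K"
    proof
      show "{v \<in> V. ?g v = K} \<subseteq> K" by auto
      show "K \<subseteq> {v \<in> V. ?g v = K}"
      proof
        fix x assume x: "x \<in> K"
        then have "(w, x) \<in> R\<^sup>*" using w by auto
        then have "?g w = ?g x" using comp_eq_iff[OF R(1)] by blast
        then show "x \<in> {v \<in> V. ?g v = K}" using w x inV by auto
      qed
    qed
    have "w \<in> K" using w by auto
    moreover have "finite K" using w inV fin finite_subset by blast
    ultimately have "card K > 0" by (auto simp: card_gt_0_iff)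
    have "(\<Sum>v | v \<in> V \<and> ?g v = K. 1 / real (card (?g v))) = (\<Sum>v\<in>K. 1 / real (card K))"
      by (rule sum.cong) (use eq in auto)
    also have "\<dots> = 1" using \<open>card K > 0\<close> by simp
    finally show "(\<Sum>v | v \<in> V \<and> ?g v = K. 1 / real (card (?g v))) = 1" .
  qed
  also have "\<dots> = real (card (comps V R))" by (simp add: comps_def)
  finally show ?thesis by simp
qed

lemma rtrancl_Image_isolated:
  assumes "v \<notin> Domain R"
  shows "R\<^sup>* `` {v} = {v}"
  using assms by (auto elim: converse_rtranclE)

text \<open>The program counts classes on \<open>{..<N}\<close>, whereas a contracted graph occupies
  only part of these vertices. The excess is the same for every relation on \<open>V\<close>, so
  comparisons of counts carry over.\<close>

lemma card_comps_superset:
  assumes "finite W" "V \<subseteq> W" "R \<subseteq> V \<times> V"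
  shows "card (comps W R) = card (comps V R) + card (W - V)"
proof -
  have iso: "R\<^sup>* `` {v} = {v}" if "v \<in> W - V" for v
    using rtrancl_Image_isolated[of v R] that assms(3) by blast
  have "comps W R = comps V R \<union> comps (W - V) R"
    using assms(2) by (auto simp: comps_def)
  moreover have "comps V R \<inter> comps (W - V) R = {}"
  proof -
    have "R\<^sup>* `` {v} \<subseteq> V" if "v \<in> V" for v using assms(3) that by (auto elim: rtranclE)
    moreover have "v \<in> R\<^sup>* `` {v}" for v by simp
    ultimately show ?thesis by (fastforce simp: comps_def)
  qed
  moreover have "card (comps (W - V) R) = card (W - V)"
  proof -
    have "comps (W - V) R = (\<lambda>v. {v}) ` (W - V)" unfolding comps_def using iso by (rule image_cong[OF refl])
    then show ?thesis by (simp add: card_image)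
  qed
  moreover have "finite V" "finite (W - V)" using assms finite_subset by auto
  ultimately show ?thesis by (simp add: card_Un_disjoint)
qed

text \<open>Only the classes meeting a set outside of which two relations agree matter for comparing
  their numbers of classes.\<close>

lemma card_comps_local_change:
  assumes fin: "finite V" and Z: "Z \<subseteq> V" and sym: "sym R" "sym R'"
    and sub: "R \<subseteq> V \<times> V" "R' \<subseteq> V \<times> V"
    and agree: "\<And>x y. x \<notin> Z \<Longrightarrow> (x, y) \<in> R \<longleftrightarrow> (x, y) \<in> R'"
  shows "card (comps V R) + card (comps Z R') = card (comps V R') + card (comps Z R)"
proof -
  have *: "{K \<in> comps V R1. K \<inter> Z = {}} \<subseteq> {K \<in> comps V R2. K \<inter> Z = {}}"
    if ag: "\<And>x y. x \<notin> Z \<Longrightarrow> (x, y) \<in> R1 \<longleftrightarrow> (x, y) \<in> R2" for R1 R2 :: "'a rel"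
  proof
    fix K assume "K \<in> {K \<in> comps V R1. K \<inter> Z = {}}"
    then obtain v where v: "v \<in> V" "K = R1\<^sup>* `` {v}" "K \<inter> Z = {}" by (auto simp: comps_def)
    have "R2\<^sup>* `` {v} = K"
    proof
      show "R2\<^sup>* `` {v} \<subseteq> K"
      proof
        fix x assume "x \<in> R2\<^sup>* `` {v}"
        then have "(v, x) \<in> R2\<^sup>*" by simp
        then show "x \<in> K"
        proof (rule rtrancl_closed)
          show "v \<in> K" using v by auto
          fix x y assume "x \<in> K" "(x, y) \<in> R2"
          then show "y \<in> K" using v ag[of x y] by (auto intro: rtrancl_into_rtrancl)
        qed
      qed
      show "K \<subseteq> R2\<^sup>* `` {v}"
      proof
        fix x assume "x \<in> K"
        then have "(v, x) \<in> R1\<^sup>*" using v by simp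
        then have "x \<in> K \<inter> R2\<^sup>* `` {v}"
        proof (rule rtrancl_closed)
          show "v \<in> K \<inter> R2\<^sup>* `` {v}" using v by auto
          fix x y assume "x \<in> K \<inter> R2\<^sup>* `` {v}" "(x, y) \<in> R1"
          then show "y \<in> K \<inter> R2\<^sup>* `` {v}" using v ag[of x y] by (auto intro: rtrancl_into_rtrancl)
        qed
        then show "x \<in> R2\<^sup>* `` {v}" by simp
      qed
    qed
    then show "K \<in> {K \<in> comps V R2. K \<inter> Z = {}}" using v by (auto simp: comps_def)
  qed
  have split: "card (comps V R1) = card {K \<in> comps V R1. K \<inter> Z = {}} + card (comps Z R1)"
    if s: "sym R1" "R1 \<subseteq> V \<times> V" for R1
  proof -
    have "comps V R1 = {K \<in> comps V R1. K \<inter> Z = {}} \<union> comps Z R1"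
    proof
      show "comps V R1 \<subseteq> {K \<in> comps V R1. K \<inter> Z = {}} \<union> comps Z R1"
      proof
        fix K assume K: "K \<in> comps V R1"
        show "K \<in> {K \<in> comps V R1. K \<inter> Z = {}} \<union> comps Z R1"
        proof (cases "K \<inter> Z = {}")
          case False
          then obtain z where z: "z \<in> K" "z \<in> Z" by auto
          obtain v where "K = R1\<^sup>* `` {v}" using K by (auto simp: comps_def)
          then have "K = R1\<^sup>* `` {z}" using z(1) comp_eq_iff[OF s(1)] by blast
          then show ?thesis using z(2) by (auto simp: comps_def)
        qed (use K in auto)
      qed
      show "{K \<in> comps V R1. K \<inter> Z = {}} \<union> comps Z R1 \<subseteq> comps V R1"
        using Z by (auto simp: comps_def)
    qed
    moreover have "{K \<in> comps V R1. K \<inter> Z = {}} \<inter> comps Z R1 = {}" by (auto simp: comps_def)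
    moreover have "finite (comps V R1)" "finite (comps Z R1)"
      using fin finite_subset[OF Z fin] by simp_all
    ultimately show ?thesis by (metis (no_types, lifting) card_Un_disjoint finite_Un)
  qed
  have "{K \<in> comps V R. K \<inter> Z = {}} = {K \<in> comps V R'. K \<inter> Z = {}}"
    using *[of R R'] *[of R' R] agree by blast
  then show ?thesis using split[OF sym(1) sub(1)] split[OF sym(2) sub(2)] by simp
qed

section \<open>Proper 3-edge-colourings and bicoloured cycles\<close>

text \<open>When \<open>a\<close> and \<open>b\<close> are fixed-point-free involutions of
  \<open>V\<close> that nowhere agree, the classes of this relation are the vertex sets of the
  bicoloured cycles.\<close>

definition bic :: "'a set \<Rightarrow> ('a \<Rightarrow> 'a) \<Rightarrow> ('a \<Rightarrow> 'a) \<Rightarrow> 'a rel" where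
  "bic V a b = {(v, w). v \<in> V \<and> (w = a v \<or> w = b v)}"

definition swapf :: "'a set \<Rightarrow> ('a \<Rightarrow> 'b) \<Rightarrow> ('a \<Rightarrow> 'b) \<Rightarrow> 'a \<Rightarrow> 'b" where
  "swapf Z a b v = (if v \<in> Z then b v else a v)"

text \<open>\<open>p\<close> and \<open>q\<close> are the third neighbours of \<open>x3\<close> and
  \<open>x4\<close>. Since \<open>p\<close> is not adjacent to \<open>x1\<close> nor
  \<open>q\<close> to \<open>x2\<close>, merging \<open>x3\<close> into \<open>x1\<close> and
  \<open>x4\<close> into \<open>x2\<close> creates no double edge; in a cubic graph this says that
  the square lies in no \<open>K_2,3\<close>.\<close>

definition bad_square :: "'a rel \<Rightarrow> 'a \<Rightarrow> 'a \<Rightarrow> 'a \<Rightarrow> 'a \<Rightarrow> 'a \<Rightarrow> 'a \<Rightarrow> bool" where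
  "bad_square E x1 x2 x3 x4 p q \<longleftrightarrow>
     (x1, x2) \<in> E \<and> (x2, x3) \<in> E \<and> (x3, x4) \<in> E \<and> (x4, x1) \<in> E \<and> x1 \<noteq> x3 \<and> x2 \<noteq> x4 \<and>
     (x3, p) \<in> E \<and> p \<noteq> x2 \<and> p \<noteq> x4 \<and> (x1, p) \<notin> E \<and>
     (x4, q) \<in> E \<and> q \<noteq> x1 \<and> q \<noteq> x3 \<and> (x2, q) \<notin> E"

lemma bic_commute: "bic V a b = bic V b a"
  by (auto simp: bic_def)

lemma sym_bic:
  assumes "\<And>v. v \<in> V \<Longrightarrow> a v \<in> V \<and> a (a v) = v" "\<And>v. v \<in> V \<Longrightarrow> b v \<in> V \<and> b (b v) = v"
  shows "sym (bic V a b)"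
  using assms by (auto simp: sym_def bic_def)

lemma bic_sub:
  assumes "\<And>v. v \<in> V \<Longrightarrow> a v \<in> V" "\<And>v. v \<in> V \<Longrightarrow> b v \<in> V"
  shows "bic V a b \<subseteq> V \<times> V"
  using assms by (auto simp: bic_def)

text \<open>The surplus of a vertex on a cycle of length \<open>L\<close>. Truncation at 0 splits
  off the deficit of hexagon vertices, which is always \<open>1/6\<close>.\<close>

definition discharge :: "nat \<Rightarrow> real" where
  "discharge L = max 0 (1 - 7 / real L)"

lemma discharge_nonneg [simp]: "discharge L \<ge> 0"
  by (simp add: discharge_def)

lemma discharge_mono: "0 < m \<Longrightarrow> m \<le> L \<Longrightarrow> discharge m \<le> discharge L"
  by (auto simp: discharge_def max_def divide_left_mono intro!: divide_left_mono)

text \<open>The colours alternate, starting with \<open>a\<close> at \<open>v1\<close>. A rotation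
  by two places preserves this pattern and a reflection exchanges the colours; these symmetries
  reduce the case distinctions below.\<close>

definition hexa :: "('a \<Rightarrow> 'a) \<Rightarrow> ('a \<Rightarrow> 'a) \<Rightarrow> 'a \<Rightarrow> 'a \<Rightarrow> 'a \<Rightarrow> 'a \<Rightarrow> 'a \<Rightarrow> 'a \<Rightarrow> bool" where
  "hexa a b v1 v2 v3 v4 v5 v6 \<longleftrightarrow>
     a v1 = v2 \<and> b v2 = v3 \<and> a v3 = v4 \<and> b v4 = v5 \<and> a v5 = v6 \<and> b v6 = v1"

text \<open>\<open>a v\<close> is the other end of the \<open>a\<close>-coloured edge at
  \<open>v\<close>, and \<open>A\<close> is one side of the bipartition. The maps are involutions of
  the whole type, so that compositions such as \<open>c \<circ> a\<close> are injective
  outright.\<close>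

locale tricoloured =
  fixes V A :: "'a set" and a b c :: "'a \<Rightarrow> 'a"
  assumes fin: "finite V"
    and inv: "a (a v) = v" "b (b v) = v" "c (c v) = v"
    and closed: "v \<in> V \<Longrightarrow> a v \<in> V" "v \<in> V \<Longrightarrow> b v \<in> V" "v \<in> V \<Longrightarrow> c v \<in> V"
    and distinct: "v \<in> V \<Longrightarrow> a v \<noteq> b v" "v \<in> V \<Longrightarrow> a v \<noteq> c v" "v \<in> V \<Longrightarrow> b v \<noteq> c v"
    and bip: "v \<in> V \<Longrightarrow> a v \<in> A \<longleftrightarrow> v \<notin> A" "v \<in> V \<Longrightarrow> b v \<in> A \<longleftrightarrow> v \<notin> A"
      "v \<in> V \<Longrightarrow> c v \<in> A \<longleftrightarrow> v \<notin> A"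
begin

definition edges :: "'a rel" where
  "edges = {(v, w). v \<in> V \<and> (w = a v \<or> w = b v \<or> w = c v)}"

abbreviation comp_ab :: "'a \<Rightarrow> 'a set" where "comp_ab v \<equiv> (bic V a b)\<^sup>* `` {v}"
abbreviation comp_ac :: "'a \<Rightarrow> 'a set" where "comp_ac v \<equiv> (bic V a c)\<^sup>* `` {v}"
abbreviation comp_bc :: "'a \<Rightarrow> 'a set" where "comp_bc v \<equiv> (bic V b c)\<^sup>* `` {v}"

text \<open>Together with \<open>rotated\<close> this generates all permutations of the colours:
  facts are proved for one arrangement and transferred.\<close>

lemma swapped: "tricoloured V A b a c"
  using fin inv closed distinct bip by unfold_locales metis+

lemma rotated: "tricoloured V A b c a"
  using fin inv closed distinct bip by unfold_locales metis+

lemma edges_swapped: "tricoloured.edges V b a c = edges"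
  unfolding tricoloured.edges_def[OF swapped] edges_def by auto

lemma edges_rotated: "tricoloured.edges V b c a = edges"
  unfolding tricoloured.edges_def[OF rotated] edges_def by auto

lemma sym_ab: "sym (bic V a b)" and sym_ac: "sym (bic V a c)" and sym_bc: "sym (bic V b c)"
  by (rule sym_bic; use inv closed in blast)+

lemma sub_ab: "bic V a b \<subseteq> V \<times> V" and sub_ac: "bic V a c \<subseteq> V \<times> V" and sub_bc: "bic V b c \<subseteq> V \<times> V"
  by (rule bic_sub; use closed in blast)+

lemma comp_ab_sub: "v \<in> V \<Longrightarrow> comp_ab v \<subseteq> V" and comp_ac_sub: "v \<in> V \<Longrightarrow> comp_ac v \<subseteq> V"
  using sub_ab sub_ac by (auto elim: rtranclE)

lemma comp_ac_closed:
  assumes "v \<in> V" "u \<in> comp_ac v"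
  shows "a u \<in> comp_ac v" "c u \<in> comp_ac v"
proof -
  have "u \<in> V" using comp_ac_sub assms by auto
  then have "(u, a u) \<in> bic V a c" "(u, c u) \<in> bic V a c" by (auto simp: bic_def)
  then show "a u \<in> comp_ac v" "c u \<in> comp_ac v" using assms(2) by (auto intro: rtrancl_into_rtrancl)
qed

text \<open>\<open>v\<close>, its two neighbours and \<open>c (a v)\<close> are distinct, since
  edges change sides and none is doubled. With fewer than eight vertices this leaves room for a
  single cycle, the case that discharging does not cover.\<close>

lemma card_comp_ge_4:
  assumes v: "v \<in> V"
  shows "card (comp_ac v) \<ge> 4"
proof -
  have "{v, a v, c v, c (a v)} \<subseteq> comp_ac v"
    using comp_ac_closed[OF v] by auto
  moreover have "card {v, a v, c v, c (a v)} = 4"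
  proof -
    have "c (a v) \<noteq> v" using distinct(2)[OF v] inv by metis
    moreover have "c (a v) \<noteq> c v" using bip(1)[OF v] inv by metis
    moreover have "c (a v) \<noteq> a v" "v \<noteq> a v" "v \<noteq> c v"
      using bip v closed by metis+
    ultimately show ?thesis using distinct(2)[OF v] by auto
  qed
  ultimately show ?thesis
    using card_mono[OF finite_subset[OF comp_ac_sub[OF v] fin]] by metis
qed

section \<open>Bicoloured hexagons and their Kempe swaps\<close>

lemma hexaD:
  assumes h: "hexa a b v1 v2 v3 v4 v5 v6" and v: "v1 \<in> V"
  shows "{v1, v2, v3, v4, v5, v6} \<subseteq> V" "distinct [v1, v2, v3, v4, v5, v6]"
    "a v1 = v2" "b v2 = v3" "a v3 = v4" "b v4 = v5" "a v5 = v6" "b v6 = v1"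
    "a v2 = v1" "b v3 = v2" "a v4 = v3" "b v5 = v4" "a v6 = v5" "b v1 = v6"
    "v1 \<in> A \<longleftrightarrow> v3 \<in> A" "v1 \<in> A \<longleftrightarrow> v5 \<in> A" "v1 \<in> A \<longleftrightarrow> v2 \<notin> A" "v1 \<in> A \<longleftrightarrow> v4 \<notin> A" "v1 \<in> A \<longleftrightarrow> v6 \<notin> A"
proof -
  show e: "a v1 = v2" "b v2 = v3" "a v3 = v4" "b v4 = v5" "a v5 = v6" "b v6 = v1"
    using h by (auto simp: hexa_def)
  then show e': "a v2 = v1" "b v3 = v2" "a v4 = v3" "b v5 = v4" "a v6 = v5" "b v1 = v6"
    using inv by metis+
  have V: "v2 \<in> V" "v3 \<in> V" "v4 \<in> V" "v5 \<in> V" "v6 \<in> V" using e v closed by metis+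
  show s: "v1 \<in> A \<longleftrightarrow> v3 \<in> A" "v1 \<in> A \<longleftrightarrow> v5 \<in> A" "v1 \<in> A \<longleftrightarrow> v2 \<notin> A" "v1 \<in> A \<longleftrightarrow> v4 \<notin> A" "v1 \<in> A \<longleftrightarrow> v6 \<notin> A"
    using e e' V v bip by metis+
  have "v1 \<noteq> v3" "v3 \<noteq> v5" "v5 \<noteq> v1" "v2 \<noteq> v4" "v4 \<noteq> v6" "v6 \<noteq> v2"
    using e e' V v distinct(1) by metis+
  then show "distinct [v1, v2, v3, v4, v5, v6]" using s by auto
  show "{v1, v2, v3, v4, v5, v6} \<subseteq> V" using V v by auto
qed

lemma hexa_comp:
  assumes h: "hexa a b v1 v2 v3 v4 v5 v6" and v: "v1 \<in> V"
  shows "comp_ab v1 = {v1, v2, v3, v4, v5, v6}"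
proof
  note D = hexaD[OF h v]
  show "comp_ab v1 \<subseteq> {v1, v2, v3, v4, v5, v6}"
  proof
    fix x assume "x \<in> comp_ab v1"
    then have "(v1, x) \<in> (bic V a b)\<^sup>*" by simp
    then show "x \<in> {v1, v2, v3, v4, v5, v6}"
      by (rule rtrancl_closed) (use D in \<open>auto simp: bic_def\<close>)
  qed
  have "(v1, v2) \<in> bic V a b" "(v2, v3) \<in> bic V a b" "(v3, v4) \<in> bic V a b" "(v4, v5) \<in> bic V a b"
    "(v5, v6) \<in> bic V a b"
    using D by (auto simp: bic_def)
  then show "{v1, v2, v3, v4, v5, v6} \<subseteq> comp_ab v1"
    by (auto intro: rtrancl_trans)
qed

lemma hexa_rotate: "hexa a b v1 v2 v3 v4 v5 v6 \<Longrightarrow> hexa a b v3 v4 v5 v6 v1 v2"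
  by (auto simp: hexa_def)

lemma hexa_reflect: "hexa a b v1 v2 v3 v4 v5 v6 \<Longrightarrow> hexa b a v1 v6 v5 v4 v3 v2"
  unfolding hexa_def by (metis inv)

text \<open>\<open>c \<circ> a\<close> walks along an \<open>ac\<close>-cycle two edges at a time;
  the orbit of an injective map inside a finite set closes up at its start.\<close>

lemma return_power:
  assumes v: "v \<in> V"
  shows "\<exists>m>0. ((c \<circ> a) ^^ m) v = v"
proof -
  have inj: "inj (c \<circ> a)" using inv by (metis comp_apply injI)
  have "((c \<circ> a) ^^ i) v \<in> V" for i using v closed by (induction i) auto
  then have "range (\<lambda>i. ((c \<circ> a) ^^ i) v) \<subseteq> V" by auto
  then have "\<not> inj (\<lambda>i. ((c \<circ> a) ^^ i) v)"
    using fin finite_subset infinite_UNIV_nat finite_imageD by blast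
  then obtain i j where "i \<noteq> j" "((c \<circ> a) ^^ i) v = ((c \<circ> a) ^^ j) v" by (auto simp: inj_def)
  then obtain i j where ij: "i < j" "((c \<circ> a) ^^ i) v = ((c \<circ> a) ^^ j) v"
    by (metis linorder_neqE_nat)
  have "((c \<circ> a) ^^ i) (((c \<circ> a) ^^ (j - i)) v) = ((c \<circ> a) ^^ i) v"
    using ij by (metis funpow_add comp_apply le_add_diff_inverse less_imp_le)
  moreover have "inj ((c \<circ> a) ^^ i)" using inj by (induction i) (auto intro: inj_compose)
  ultimately have "((c \<circ> a) ^^ (j - i)) v = v" by (auto dest: injD)
  then show ?thesis using ij by (intro exI[of _ "j - i"]) auto
qed

lemma swap_involution:
  assumes Z: "\<And>v. v \<in> Z \<Longrightarrow> a v \<in> Z \<and> b v \<in> Z" "Z \<subseteq> V" and v: "v \<in> V"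
  shows "swapf Z a b v \<in> V \<and> swapf Z a b (swapf Z a b v) = v"
  using assms inv closed unfolding swapf_def by metis

text \<open>After the swap the recoloured edge leads from \<open>v3\<close> to \<open>v2\<close>.
  From there the old \<open>ac\<close>-cycle of \<open>v1\<close> is followed away from the hexagon.
  It meets the hexagon nowhere but in \<open>v1\<close> and \<open>v2\<close>, so it survives
  unchanged until it arrives at \<open>v1\<close> again.\<close>

lemma hexa_joins_after_swap:
  assumes h: "hexa a b v1 v2 v3 v4 v5 v6" and v: "v1 \<in> V"
    and dist: "(v1, v3) \<notin> (bic V a c)\<^sup>*" "(v1, v5) \<notin> (bic V a c)\<^sup>*"
  shows "(v3, v1) \<in> (bic V (swapf {v1, v2, v3, v4, v5, v6} a b) c)\<^sup>*"
proof (rule ccontr)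
  note D = hexaD[OF h v]
  let ?Z = "{v1, v2, v3, v4, v5, v6}"
  let ?R = "bic V (swapf ?Z a b) c"
  assume no: "(v3, v1) \<notin> ?R\<^sup>*"
  \<comment> \<open>Counting starts at \<open>Suc i\<close> since the edge from \<open>v1\<close> to
    \<open>v2\<close> is the one that the swap takes away from colour \<open>a\<close>. All points
    reached lie on the side of \<open>v1\<close>, which keeps them off \<open>v2\<close>,
    \<open>v4\<close>, \<open>v6\<close>.\<close>
  have *: "(v3, ((c \<circ> a) ^^ Suc i) v1) \<in> ?R\<^sup>* \<and> (v1, ((c \<circ> a) ^^ Suc i) v1) \<in> (bic V a c)\<^sup>*
      \<and> (((c \<circ> a) ^^ Suc i) v1 \<in> A \<longleftrightarrow> v1 \<in> A) \<and> ((c \<circ> a) ^^ Suc i) v1 \<in> V" for i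
  proof (induction i)
    case 0
    have "(v3, v2) \<in> ?R" "(v2, c v2) \<in> ?R" using D by (auto simp: bic_def swapf_def)
    moreover have "(v1, v2) \<in> bic V a c" "(v2, c v2) \<in> bic V a c" using D by (auto simp: bic_def)
    ultimately show ?case using D closed bip by (auto intro: rtrancl_trans)
  next
    case (Suc i)
    define u where "u = ((c \<circ> a) ^^ Suc i) v1"
    have u: "(v3, u) \<in> ?R\<^sup>*" "(v1, u) \<in> (bic V a c)\<^sup>*" "u \<in> A \<longleftrightarrow> v1 \<in> A" "u \<in> V"
      using Suc.IH unfolding u_def by blast+
    have "u \<noteq> v1" "u \<noteq> v3" "u \<noteq> v5" using u no dist by auto
    moreover have "u \<noteq> v2" "u \<noteq> v4" "u \<noteq> v6" using u(3) D by auto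
    ultimately have "(u, a u) \<in> ?R" "(a u, c (a u)) \<in> ?R" using u(4) closed by (auto simp: bic_def swapf_def)
    moreover have "(u, a u) \<in> bic V a c" "(a u, c (a u)) \<in> bic V a c" using u(4) closed by (auto simp: bic_def)
    moreover have eq: "((c \<circ> a) ^^ Suc (Suc i)) v1 = c (a u)" by (simp add: u_def)
    ultimately show ?case unfolding eq using u closed bip by (auto intro: rtrancl_into_rtrancl)
  qed
  obtain m where "m > 0" "((c \<circ> a) ^^ m) v1 = v1" using return_power[OF v] by blast
  then show False using *[of "m - 1"] no by (metis Suc_diff_1)
qed

lemma sym_bic_swapf:
  assumes Z: "\<And>v. v \<in> Z \<Longrightarrow> a v \<in> Z \<and> b v \<in> Z" "Z \<subseteq> V"
  shows "sym (bic V (swapf Z a b) c)" "bic V (swapf Z a b) c \<subseteq> V \<times> V"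
proof -
  have "\<And>v. v \<in> V \<Longrightarrow> swapf Z a b v \<in> V \<and> swapf Z a b (swapf Z a b v) = v"
    by (rule swap_involution[OF Z])
  then show "sym (bic V (swapf Z a b) c)" "bic V (swapf Z a b) c \<subseteq> V \<times> V"
    using inv closed by (blast intro: sym_bic bic_sub[THEN subsetD])+
qed

end

text \<open>Swapping the colours of a hexagon that meets three different \<open>ac\<close>-cycles merges these three
  into one, so at a local optimum it must split one \<open>bc\<close>-cycle into three.\<close>

lemma (in tricoloured) hexa_optimal:
  assumes h: "hexa a b v1 v2 v3 v4 v5 v6" and v: "v1 \<in> V"
    and opt: "card (comps V (bic V a c)) + card (comps V (bic V b c)) \<le>
      card (comps V (bic V (swapf (comp_ab v1) a b) c)) + card (comps V (bic V (swapf (comp_ab v1) b a) c))"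
    and dist: "(v1, v3) \<notin> (bic V a c)\<^sup>*" "(v1, v5) \<notin> (bic V a c)\<^sup>*" "(v3, v5) \<notin> (bic V a c)\<^sup>*"
  shows "(v1, v3) \<in> (bic V b c)\<^sup>* \<and> (v1, v5) \<in> (bic V b c)\<^sup>*"
proof -
  note D = hexaD[OF h v]
  let ?Z = "{v1, v2, v3, v4, v5, v6}"
  let ?a = "swapf ?Z a b" and ?b = "swapf ?Z b a"
  have Z: "comp_ab v1 = ?Z" by (rule hexa_comp[OF h v])
  have Zc: "\<And>v. v \<in> ?Z \<Longrightarrow> a v \<in> ?Z \<and> b v \<in> ?Z" "\<And>v. v \<in> ?Z \<Longrightarrow> b v \<in> ?Z \<and> a v \<in> ?Z" using D by auto
  note sa = sym_bic_swapf[OF Zc(1) D(1)]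
  note sb = tricoloured.sym_bic_swapf[OF swapped Zc(2) D(1)]
  have agree: "(x, y) \<in> bic V a c \<longleftrightarrow> (x, y) \<in> bic V ?a c" "(x, y) \<in> bic V b c \<longleftrightarrow> (x, y) \<in> bic V ?b c"
    if "x \<notin> ?Z" for x y using that by (auto simp: bic_def swapf_def)
  have eqA: "card (comps V (bic V a c)) + card (comps ?Z (bic V ?a c)) = card (comps V (bic V ?a c)) + card (comps ?Z (bic V a c))"
    by (rule card_comps_local_change[OF fin D(1) sym_ac sa(1) sub_ac sa(2)]) (use agree in auto)
  have eqB: "card (comps V (bic V b c)) + card (comps ?Z (bic V ?b c)) = card (comps V (bic V ?b c)) + card (comps ?Z (bic V b c))"
    by (rule card_comps_local_change[OF fin D(1) sym_bc sb(1) sub_bc sb(2)]) (use agree in auto)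
  have cA: "card (comps ?Z (bic V a c)) = 3"
  proof -
    have "(v1, v2) \<in> (bic V a c)\<^sup>*" "(v3, v4) \<in> (bic V a c)\<^sup>*" "(v5, v6) \<in> (bic V a c)\<^sup>*"
      using D by (auto simp: bic_def)
    then have "comp_ac v2 = comp_ac v1" "comp_ac v4 = comp_ac v3" "comp_ac v6 = comp_ac v5"
      using comp_eq_iff[OF sym_ac] by metis+
    then have "comps ?Z (bic V a c) = {comp_ac v1, comp_ac v3, comp_ac v5}"
      by (auto simp: comps_def)
    moreover have "comp_ac v1 \<noteq> comp_ac v3" "comp_ac v1 \<noteq> comp_ac v5" "comp_ac v3 \<noteq> comp_ac v5"
      using dist comp_eq_iff[OF sym_ac] by metis+
    ultimately show ?thesis by simp
  qed
  have cA': "card (comps ?Z (bic V ?a c)) \<le> 1"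
  proof -
    let ?R = "bic V ?a c"
    have j1: "(v3, v1) \<in> ?R\<^sup>*" by (rule hexa_joins_after_swap[OF h v dist(1,2)])
    have "{v3, v4, v5, v6, v1, v2} = ?Z" by auto
    then have j2: "(v5, v3) \<in> ?R\<^sup>*"
      using hexa_joins_after_swap[OF hexa_rotate[OF h]] D dist rtrancl_sym[OF sym_ac] by (metis insert_subset)
    have "(v1, v6) \<in> ?R\<^sup>*" "(v3, v2) \<in> ?R\<^sup>*" "(v5, v4) \<in> ?R\<^sup>*"
      using D by (auto simp: bic_def swapf_def)
    with j1 j2 have "(v1, x) \<in> ?R\<^sup>*" if "x \<in> ?Z" for x
      using that rtrancl_sym[OF sa(1)] by (elim insertE) (blast intro: rtrancl_trans)+
    then have "?R\<^sup>* `` {x} = ?R\<^sup>* `` {v1}" if "x \<in> ?Z" for x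
      using that comp_eq_iff[OF sa(1)] by metis
    then have "comps ?Z ?R \<subseteq> {?R\<^sup>* `` {v1}}" unfolding comps_def by blast
    then show ?thesis by (metis card_mono finite.emptyI finite_insert card_1_singleton_iff One_nat_def)
  qed
  have cB': "card (comps ?Z (bic V ?b c)) \<le> 3"
  proof -
    let ?R = "bic V ?b c"
    have "(v1, v2) \<in> ?R\<^sup>*" "(v3, v4) \<in> ?R\<^sup>*" "(v5, v6) \<in> ?R\<^sup>*"
      using D by (auto simp: bic_def swapf_def)
    then have "?R\<^sup>* `` {v2} = ?R\<^sup>* `` {v1}" "?R\<^sup>* `` {v4} = ?R\<^sup>* `` {v3}" "?R\<^sup>* `` {v6} = ?R\<^sup>* `` {v5}"
      using comp_eq_iff[OF sb(1)] by metis+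
    then have "comps ?Z ?R = set [?R\<^sup>* `` {v1}, ?R\<^sup>* `` {v3}, ?R\<^sup>* `` {v5}]"
      by (auto simp: comps_def)
    then show ?thesis using card_length[of "[?R\<^sup>* `` {v1}, ?R\<^sup>* `` {v3}, ?R\<^sup>* `` {v5}]"] by simp
  qed
  \<comment> \<open>The swap saves at least two \<open>ac\<close>-classes and leaves at most three
    \<open>bc\<close>-classes at the hexagon, so optimality forces a single \<open>bc\<close>-class
    before the swap.\<close>
  have "card (comps ?Z (bic V b c)) \<le> 1"
    using eqA eqB cA cA' cB' opt unfolding Z by linarith
  moreover have "{comp_bc v1, comp_bc v3, comp_bc v5} \<subseteq> comps ?Z (bic V b c)"
    by (auto simp: comps_def)
  moreover have "finite (comps ?Z (bic V b c))" by simp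
  ultimately have "comp_bc v1 = comp_bc v3" "comp_bc v1 = comp_bc v5"
    using card_le_Suc0_iff_eq[of "comps ?Z (bic V b c)"] by (auto simp: insert_subset)
  then show ?thesis using comp_eq_iff[OF sym_bc] by metis
qed

text \<open>\<open>conn\<close> and \<open>large\<close> serve to exclude a hexagon with all three
  chords: its vertices would form a closed set of size 6.\<close>

locale squareless = tricoloured +
  assumes no_square: "\<not> bad_square edges x1 x2 x3 x4 p q"
    and conn: "S \<subseteq> V \<Longrightarrow> S \<noteq> {} \<Longrightarrow> (\<And>v. v \<in> S \<Longrightarrow> a v \<in> S \<and> b v \<in> S \<and> c v \<in> S) \<Longrightarrow> S = V"
    and large: "card V \<ge> 8"
begin

lemma squareless_swapped: "squareless V A b a c"
proof (intro squareless.intro swapped squareless_axioms.intro)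
  show "\<not> bad_square (tricoloured.edges V b a c) x1 x2 x3 x4 p q" for x1 x2 x3 x4 p q
    unfolding edges_swapped by (rule no_square)
  show "S = V" if "S \<subseteq> V" "S \<noteq> {}" "\<And>v. v \<in> S \<Longrightarrow> b v \<in> S \<and> a v \<in> S \<and> c v \<in> S" for S
    by (rule conn) (use that in blast)+
qed (rule large)

lemma squareless_rotated: "squareless V A b c a"
proof (intro squareless.intro rotated squareless_axioms.intro)
  show "\<not> bad_square (tricoloured.edges V b c a) x1 x2 x3 x4 p q" for x1 x2 x3 x4 p q
    unfolding edges_rotated by (rule no_square)
  show "S = V" if "S \<subseteq> V" "S \<noteq> {}" "\<And>v. v \<in> S \<Longrightarrow> b v \<in> S \<and> c v \<in> S \<and> a v \<in> S" for S
    by (rule conn) (use that in blast)+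
qed (rule large)

text \<open>The remaining edges at a bicoloured square all have colour \<open>c\<close>, and
  opposite corners have different \<open>c\<close>-neighbours. No third neighbour is shared by
  opposite corners, which makes the square bad.\<close>

lemma no_bicoloured_square:
  assumes v: "v \<in> V"
  shows "b (a (b (a v))) \<noteq> v"
proof
  assume eq: "b (a (b (a v))) = v"
  define x2 x3 x4 where "x2 = a v" and "x3 = b x2" and "x4 = a x3"
  have V: "x2 \<in> V" "x3 \<in> V" "x4 \<in> V" using v closed by (auto simp: x2_def x3_def x4_def)
  have e: "a v = x2" "b x2 = x3" "a x3 = x4" "b x4 = v" "a x2 = v" "b x3 = x2" "a x4 = x3" "b v = x4"
    using eq inv by (metis x2_def x3_def x4_def)+
  have n: "v \<noteq> x3" "x2 \<noteq> x4" using e V v distinct(1) by metis+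
  have "bad_square edges v x2 x3 x4 (c x3) (c x4)"
    unfolding bad_square_def
  proof (intro conjI)
    show ne: "c x3 \<noteq> x2" "c x3 \<noteq> x4" "c x4 \<noteq> v" "c x4 \<noteq> x3"
      using distinct(2,3)[OF V(2)] distinct(2,3)[OF V(3)] e by auto
    have "c x3 \<noteq> c v" "c x4 \<noteq> c x2" using n inv(3) by metis+
    then show "(v, c x3) \<notin> edges" "(x2, c x4) \<notin> edges" using ne by (auto simp: edges_def e)
  qed (use e n V v in \<open>auto simp: edges_def\<close>)
  then show False using no_square by blast
qed

text \<open>Walking along the cycle two edges at a time, a return after one double step would be a
  double edge and after two a bicoloured square; after three it is a hexagon. Otherwise
  \<open>v\<close>, \<open>w3\<close>, \<open>w5\<close>, \<open>w7\<close> are distinct, and their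
  \<open>a\<close>-neighbours on the other side complete eight vertices.\<close>

lemma hexa_or_long:
  assumes v: "v \<in> V"
  shows "(\<exists>v2 v3 v4 v5 v6. hexa a b v v2 v3 v4 v5 v6) \<or> 8 \<le> card (comp_ab v)"
proof (cases "b (a (b (a (b (a v))))) = v")
  case True
  then show ?thesis by (auto simp: hexa_def)
next
  case False
  define w3 w5 w7 where "w3 = b (a v)" and "w5 = b (a w3)" and "w7 = b (a w5)"
  have V: "w3 \<in> V" "w5 \<in> V" "w7 \<in> V" using v closed by (auto simp: w3_def w5_def w7_def)
  have inj: "b (a x) = b (a y) \<Longrightarrow> x = y" "a x = a y \<Longrightarrow> x = y" for x y using inv by metis+
  have n1: "w3 \<noteq> v" "w5 \<noteq> w3" "w7 \<noteq> w5"
  proof -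
    have *: "b (a x) \<noteq> x" if "x \<in> V" for x using distinct(1)[OF that] inv(2) by metis
    show "w3 \<noteq> v" "w5 \<noteq> w3" "w7 \<noteq> w5" unfolding w7_def w5_def w3_def
      using * v V(1,2) by (auto simp: w5_def w3_def)
  qed
  have n2: "w5 \<noteq> v" "w7 \<noteq> w3"
    using no_bicoloured_square[OF v] no_bicoloured_square[OF V(1)] by (auto simp: w3_def w5_def w7_def)
  have n3: "w7 \<noteq> v" using False by (simp add: w3_def w5_def w7_def)
  let ?W = "{v, w3, w5, w7}"
  have cW: "card ?W = 4" using n1 n2 n3 by auto
  have sW: "x \<in> A \<longleftrightarrow> v \<in> A" if "x \<in> ?W" for x
    using that V v bip closed unfolding w3_def w5_def w7_def by auto
  have caW: "card (a ` ?W) = 4" using cW card_image[of a ?W] inj(2) by (metis inj_onI)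
  have "?W \<inter> a ` ?W = {}"
  proof -
    have "a x \<in> A \<longleftrightarrow> v \<notin> A" if "x \<in> ?W" for x
      using sW[OF that] bip(1)[of x] that V v by auto
    then have "y \<in> A \<longleftrightarrow> v \<notin> A" if "y \<in> a ` ?W" for y using that by blast
    then show ?thesis using sW by blast
  qed
  then have c8: "card (?W \<union> a ` ?W) = 8" using cW caW by (subst card_Un_disjoint) auto
  have cl: "a x \<in> comp_ab v" "b x \<in> comp_ab v" if x: "x \<in> comp_ab v" for x
  proof -
    have "x \<in> V" using comp_ab_sub[OF v] x by blast
    then have "(x, a x) \<in> bic V a b" "(x, b x) \<in> bic V a b" by (auto simp: bic_def)
    then show "a x \<in> comp_ab v" "b x \<in> comp_ab v" using x by (auto intro: rtrancl_into_rtrancl)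
  qed
  have "v \<in> comp_ab v" by simp
  then have W: "?W \<subseteq> comp_ab v" using cl unfolding w3_def w5_def w7_def by simp
  then have "?W \<union> a ` ?W \<subseteq> comp_ab v" using cl by blast
  then show ?thesis
    using c8 card_mono[OF finite_subset[OF comp_ab_sub[OF v] fin]] by metis
qed

text \<open>The ten vertices are \<open>v1\<close> to \<open>v4\<close>, their
  \<open>c\<close>-neighbours, \<open>y = a (c v2)\<close> and \<open>c y\<close>. Two coincidences
  are excluded through squares: \<open>y = c v1\<close> would close a bicoloured square, and
  \<open>y = c v3\<close> a square with colours \<open>c\<close>, \<open>a\<close>,
  \<open>c\<close>, \<open>b\<close>.\<close>

lemma chordless_pair_long:
  assumes h: "hexa a b v1 v2 v3 v4 v5 v6" and v: "v1 \<in> V"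
    and cl: "\<And>x. x \<in> {v1, v2, v3, v4, v5, v6} \<Longrightarrow> c x \<notin> {v1, v2, v3, v4, v5, v6}"
    and con: "(v1, v3) \<in> (bic V a c)\<^sup>*"
  shows "10 \<le> card (comp_ac v1)"
proof -
  note D = hexaD[OF h v]
  have V: "v2 \<in> V" "v3 \<in> V" "v4 \<in> V" "v5 \<in> V" "v6 \<in> V" using D(1) by auto
  have inj: "c x = c y \<Longrightarrow> x = y" "a x = a y \<Longrightarrow> x = y" for x y using inv by metis+
  have cn: "c v1 \<notin> {v1, v2, v3, v4, v5, v6}" "c v2 \<notin> {v1, v2, v3, v4, v5, v6}"
    "c v3 \<notin> {v1, v2, v3, v4, v5, v6}" "c v4 \<notin> {v1, v2, v3, v4, v5, v6}" using cl by auto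
  define y where "y = a (c v2)"
  have yV: "y \<in> V" using V closed by (auto simp: y_def)
  have y1: "y \<noteq> c v1"
  proof
    assume "y = c v1"
    then have "c (a (c (a v1))) = v1" using inv D(3) by (metis y_def)
    moreover have "squareless V A c a b" using squareless.squareless_rotated[OF squareless_rotated] .
    ultimately show False
      using squareless.no_bicoloured_square[OF squareless.squareless_swapped, of V A c a b v1] v by blast
  qed
  have y3: "y \<noteq> c v3"
  proof
    assume y: "y = c v3"
    \<comment> \<open>The third neighbours of \<open>c v3\<close> and \<open>v3\<close> are
      \<open>b (c v3)\<close> and \<open>v4\<close>. The absence of chords keeps them from being
      shared with the opposite corner; for example, \<open>b (c v3) = v1\<close> would mean
      \<open>c v3 = v6\<close>.\<close>
    have "bad_square edges v2 (c v2) (c v3) v3 (b (c v3)) v4"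
      unfolding bad_square_def
    proof (intro conjI)
      show "(v2, c v2) \<in> edges" "(v3, v4) \<in> edges" using V D by (auto simp: edges_def)
      show "(c v2, c v3) \<in> edges" using V y closed by (auto simp: edges_def y_def)
      show "(c v3, v3) \<in> edges" using V closed inv by (auto simp: edges_def)
      show "(v3, v2) \<in> edges" using V D by (auto simp: edges_def)
      show "(c v3, b (c v3)) \<in> edges" using V closed by (auto simp: edges_def)
      show "v2 \<noteq> c v3" "v4 \<noteq> v2" "v4 \<noteq> c v3" using cn D by auto
      show "c v2 \<noteq> v3" using cn by auto
      show "b (c v3) \<noteq> c v2" using y distinct(1)[of "c v3"] closed V inv by (metis y_def)
      have "c v3 \<noteq> v2" "c v3 \<noteq> v6" using cn by auto
      then show "b (c v3) \<noteq> v3" using D(10) inv(2) by metis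
      have "b (c v3) \<noteq> v1" using \<open>c v3 \<noteq> v6\<close> D(14) inv(2) by metis
      then show "(v2, b (c v3)) \<notin> edges"
        using \<open>b (c v3) \<noteq> c v2\<close> \<open>b (c v3) \<noteq> v3\<close> D by (auto simp: edges_def)
      have "v4 \<noteq> c (c v2)" using D inv by auto
      moreover have "v4 \<noteq> a (c v2)" using cn y by (auto simp: y_def)
      moreover have "c v2 \<noteq> v5" using cn by auto
      then have "v4 \<noteq> b (c v2)" using D(6) inv(2) by metis
      ultimately show "(c v2, v4) \<notin> edges" by (auto simp: edges_def)
    qed
    then show False using no_square by blast
  qed
  have "c v2 \<noteq> v1" "c v2 \<noteq> v3" using cn by auto
  then have y2: "y \<noteq> v2" "y \<noteq> v4" using D(9,11) inv(1) unfolding y_def by metis+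
  let ?W = "{v1, v3, c v2, c v4, c y}" and ?B = "{v2, v4, c v1, c v3, y}"
  have "c y \<noteq> v1" "c y \<noteq> v3" "c y \<noteq> c v2" "c y \<noteq> c v4" "c v2 \<noteq> c v4" "c v1 \<noteq> c v3"
  proof -
    have *: "v2 \<noteq> v4" "v1 \<noteq> v3" using D(2) by auto
    show "c y \<noteq> v1" "c y \<noteq> v3" using y1 y3 inv(3) by metis+
    show "c y \<noteq> c v2" "c y \<noteq> c v4" "c v2 \<noteq> c v4" "c v1 \<noteq> c v3" using y2 * inj(1) by blast+
  qed
  then have W: "card ?W = 5" and B: "card ?B = 5" using cn D(2) y1 y2 y3 by auto
  have yA: "y \<in> A \<longleftrightarrow> v2 \<in> A" using bip V closed by (auto simp: y_def)
  have "x \<in> A \<longleftrightarrow> v1 \<in> A" if "x \<in> ?W" for x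
    using that bip(3)[OF V(1)] bip(3)[OF V(3)] bip(3)[OF yV] D(15-19) yA by auto
  moreover have "x \<in> A \<longleftrightarrow> v1 \<notin> A" if "x \<in> ?B" for x
    using that bip(3)[OF v] bip(3)[OF V(2)] D(15-19) yA by auto
  ultimately have "?W \<inter> ?B = {}" by blast
  then have c: "card (?W \<union> ?B) = 10" using W B by (subst card_Un_disjoint) auto
  have "v1 \<in> comp_ac v1" "v3 \<in> comp_ac v1" using con by auto
  then have "v2 \<in> comp_ac v1" "v4 \<in> comp_ac v1" using comp_ac_closed[OF v] D by metis+
  moreover have "y \<in> comp_ac v1" using calculation comp_ac_closed[OF v] by (auto simp: y_def)
  ultimately have "?W \<union> ?B \<subseteq> comp_ac v1" using con comp_ac_closed[OF v] by auto
  then show ?thesis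
    using c card_mono[OF finite_subset[OF comp_ac_sub[OF v] fin]] by metis
qed

section \<open>Surplus seen from the vertices of a hexagon\<close>

lemma sum_hexa:
  assumes "distinct [v1, v2, v3, v4, v5, v6]"
  shows "sum f {v1, v2, v3, v4, v5, v6} = f v1 + f v2 + f v3 + f v4 + f v5 + (f v6 :: real)"
  using assms by (simp add: add.assoc)

text \<open>\<open>v1\<close> to \<open>v4\<close> lie on a single \<open>ac\<close>-cycle of length
  at least 10, where every vertex has surplus at least \<open>3/10\<close>; four of these make
  \<open>6/5\<close>.\<close>

lemma chordless_pair_sum:
  assumes h: "hexa a b v1 v2 v3 v4 v5 v6" and v: "v1 \<in> V"
    and cl: "\<And>x. x \<in> {v1, v2, v3, v4, v5, v6} \<Longrightarrow> c x \<notin> {v1, v2, v3, v4, v5, v6}"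
    and con: "(v1, v3) \<in> (bic V a c)\<^sup>*"
  shows "6 / 5 \<le> (\<Sum>x\<in>{v1, v2, v3, v4, v5, v6}. discharge (card (comp_ac x)))"
proof -
  note D = hexaD[OF h v]
  have "(v1, v2) \<in> (bic V a c)\<^sup>*" "(v3, v4) \<in> (bic V a c)\<^sup>*" using D by (auto simp: bic_def)
  then have e: "comp_ac v2 = comp_ac v1" "comp_ac v4 = comp_ac v1" "comp_ac v3 = comp_ac v1"
    using comp_eq_iff[OF sym_ac] con by metis+
  have "discharge 10 \<le> discharge (card (comp_ac v1))"
    using chordless_pair_long[OF assms] by (intro discharge_mono) auto
  moreover have "discharge 10 = 3 / 10" by (simp add: discharge_def)
  ultimately have "3 / 10 \<le> discharge (card (comp_ac v1))" by simp
  then show ?thesis unfolding sum_hexa[OF D(2)] e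
    using discharge_nonneg[of "card (comp_ac v5)"] discharge_nonneg[of "card (comp_ac v6)"] by linarith
qed

lemma chordless_ac_sum:
  assumes h: "hexa a b v1 v2 v3 v4 v5 v6" and v: "v1 \<in> V"
    and cl: "\<And>x. x \<in> {v1, v2, v3, v4, v5, v6} \<Longrightarrow> c x \<notin> {v1, v2, v3, v4, v5, v6}"
    and con: "(v1, v3) \<in> (bic V a c)\<^sup>* \<or> (v1, v5) \<in> (bic V a c)\<^sup>* \<or> (v3, v5) \<in> (bic V a c)\<^sup>*"
  shows "6 / 5 \<le> (\<Sum>x\<in>{v1, v2, v3, v4, v5, v6}. discharge (card (comp_ac x)))"
proof -
  have V: "v3 \<in> V" "v5 \<in> V" using hexaD(1)[OF h v] by auto
  have r: "{v3, v4, v5, v6, v1, v2} = {v1, v2, v3, v4, v5, v6}"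
    "{v5, v6, v1, v2, v3, v4} = {v1, v2, v3, v4, v5, v6}" by auto
  from con consider "(v1, v3) \<in> (bic V a c)\<^sup>*" | "(v5, v1) \<in> (bic V a c)\<^sup>*" | "(v3, v5) \<in> (bic V a c)\<^sup>*"
    using rtrancl_sym[OF sym_ac] by blast
  then show ?thesis
  proof cases
    case 1 then show ?thesis using chordless_pair_sum[OF h v cl] by blast
  next
    case 2
    show ?thesis
      using chordless_pair_sum[OF hexa_rotate[OF hexa_rotate[OF h]] V(2) _ 2] cl unfolding r by blast
  next
    case 3
    show ?thesis
      using chordless_pair_sum[OF hexa_rotate[OF h] V(1) _ 3] cl unfolding r by blast
  qed
qed

text \<open>The six vertices and, for want of chords, six further \<open>c\<close>-neighbours lie on
  one cycle, so each of the six has surplus at least \<open>1 - 7/12\<close>.\<close>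

lemma chordless_all_sum:
  assumes h: "hexa a b v1 v2 v3 v4 v5 v6" and v: "v1 \<in> V"
    and cl: "\<And>x. x \<in> {v1, v2, v3, v4, v5, v6} \<Longrightarrow> c x \<notin> {v1, v2, v3, v4, v5, v6}"
    and con: "(v1, v3) \<in> (bic V a c)\<^sup>*" "(v1, v5) \<in> (bic V a c)\<^sup>*"
  shows "2 \<le> (\<Sum>x\<in>{v1, v2, v3, v4, v5, v6}. discharge (card (comp_ac x)))"
proof -
  note D = hexaD[OF h v]
  let ?Z = "{v1, v2, v3, v4, v5, v6}"
  have "(v1, v2) \<in> (bic V a c)\<^sup>*" "(v3, v4) \<in> (bic V a c)\<^sup>*" "(v5, v6) \<in> (bic V a c)\<^sup>*"
    using D by (auto simp: bic_def)
  then have e: "comp_ac v2 = comp_ac v1" "comp_ac v4 = comp_ac v1" "comp_ac v3 = comp_ac v1"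
    "comp_ac v5 = comp_ac v1" "comp_ac v6 = comp_ac v1"
    using comp_eq_iff[OF sym_ac] con by metis+
  have self: "x \<in> comp_ac x" for x by simp
  have Z: "?Z \<subseteq> comp_ac v1"
    using self[of v1] self[of v2] self[of v3] self[of v4] self[of v5] self[of v6] unfolding e by simp
  then have "?Z \<union> c ` ?Z \<subseteq> comp_ac v1" using comp_ac_closed[OF v] by blast
  moreover have "card (?Z \<union> c ` ?Z) = 12"
  proof -
    have "card ?Z = 6" using D(2) by simp
    moreover have "card (c ` ?Z) = card ?Z" by (intro card_image inj_onI) (metis inv(3))
    moreover have "?Z \<inter> c ` ?Z = {}" using cl by blast
    ultimately show ?thesis by (subst card_Un_disjoint) auto
  qed
  ultimately have "12 \<le> card (comp_ac v1)"
    using card_mono[OF finite_subset[OF comp_ac_sub[OF v] fin]] by metis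
  then have "discharge 12 \<le> discharge (card (comp_ac v1))" by (intro discharge_mono) auto
  moreover have "discharge 12 = 5 / 12" by (simp add: discharge_def)
  ultimately have "5 / 12 \<le> discharge (card (comp_ac v1))" by simp
  then show ?thesis unfolding sum_hexa[OF D(2)] e by linarith
qed

text \<open>Two chords: the hexagon spans \<open>K\<^sub>3\<^sub>,\<^sub>3\<close> minus the edge \<open>v2 v5\<close>.\<close>

lemma two_chords_comp:
  assumes h: "hexa a b v1 v2 v3 v4 v5 v6" and v: "v1 \<in> V"
    and ch: "c v1 = v4" "c v3 = v6" and no: "c v2 \<noteq> v5" and x: "x \<in> {v1, v2, v3, v4, v5, v6}"
  shows "8 \<le> card (comp_ac x)" "a (c v2) \<noteq> c v5 \<Longrightarrow> 10 \<le> card (comp_ac x)"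
proof -
  note D = hexaD[OF h v]
  have V: "v2 \<in> V" "v3 \<in> V" "v4 \<in> V" "v5 \<in> V" "v6 \<in> V" using D(1) by auto
  have ch': "c v4 = v1" "c v6 = v3" using ch inv by metis+
  have inj: "c y = c z \<Longrightarrow> y = z" "a y = a z \<Longrightarrow> y = z" for y z using inv by metis+
  have c2: "c v2 \<notin> {v1, v2, v3, v4, v5, v6}"
  proof -
    have "c v2 \<noteq> v1" "c v2 \<noteq> v3" using distinct(2,3)[OF V(1)] D(4,9) by auto
    moreover have "c v2 \<noteq> v2" "c v2 \<noteq> v4" "c v2 \<noteq> v6" using bip(3)[OF V(1)] D(15-19) by metis+
    ultimately show ?thesis using no by simp
  qed
  have c5: "c v5 \<notin> {v1, v2, v3, v4, v5, v6}"
  proof -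
    have "c v5 \<noteq> v2" using no inv(3) by metis
    moreover have "c v5 \<noteq> v6" "c v5 \<noteq> v4" using distinct(2,3)[OF V(4)] D(7,12) by auto
    moreover have "c v5 \<noteq> v1" "c v5 \<noteq> v3" "c v5 \<noteq> v5" using bip(3)[OF V(4)] D(15-19) by metis+
    ultimately show ?thesis by simp
  qed
  have "v2 \<noteq> v5" using D(2) by simp
  then have c25: "c v2 \<noteq> c v5" using inj(1) by blast
  \<comment> \<open>The chords alternate with the \<open>a\<close>-edges, so
    \<open>v2 v1 v4 v3 v6 v5\<close> is a path of the \<open>ac\<close>-cycle. It continues with
    \<open>c v2\<close> and \<open>c v5\<close> at its ends.\<close>
  have all: "v \<in> comp_ac x" if "v \<in> {v1, v2, v3, v4, v5, v6}" for v
  proof -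
    have "(v1, v2) \<in> bic V a c" "(v1, v4) \<in> bic V a c" "(v4, v3) \<in> bic V a c" "(v3, v6) \<in> bic V a c"
      "(v6, v5) \<in> bic V a c"
      using D ch by (auto simp: bic_def)
    then have *: "(v1, v2) \<in> (bic V a c)\<^sup>*" "(v1, v4) \<in> (bic V a c)\<^sup>*" "(v1, v3) \<in> (bic V a c)\<^sup>*"
      "(v1, v6) \<in> (bic V a c)\<^sup>*" "(v1, v5) \<in> (bic V a c)\<^sup>*"
      by (meson r_into_rtrancl rtrancl_into_rtrancl)+
    then have "(v1, v) \<in> (bic V a c)\<^sup>*" using that by auto
    moreover have "(v1, x) \<in> (bic V a c)\<^sup>*" using x * by auto
    ultimately show ?thesis using rtrancl_sym[OF sym_ac] by (auto intro: rtrancl_trans)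
  qed
  have xV: "x \<in> V" using x D(1) by auto
  note clo = comp_ac_closed[OF xV]
  have fc: "finite (comp_ac x)" using finite_subset[OF comp_ac_sub[OF xV] fin] .
  let ?S = "{v1, v2, v3, v4, v5, v6} \<union> {c v2, c v5}"
  have S: "?S \<subseteq> comp_ac x" using all clo by auto
  have cS: "card ?S = 8" using D(2) c2 c5 c25 by (subst card_Un_disjoint) auto
  show "8 \<le> card (comp_ac x)" using S cS card_mono[OF fc] by metis
  \<comment> \<open>The cycle closes at length 8 if \<open>a\<close> joins \<open>c v2\<close> to
    \<open>c v5\<close>; otherwise it runs through at least two more vertices.\<close>
  assume n: "a (c v2) \<noteq> c v5"
  let ?y = "a (c v2)"
  have yS: "?y \<notin> ?S"
  proof -
    have "a z \<in> {v1, v2, v3, v4, v5, v6}" if "z \<in> {v1, v2, v3, v4, v5, v6}" for z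
      using that D(3,5,7,9,11,13) by auto
    then have "?y \<noteq> z" if "z \<in> {v1, v2, v3, v4, v5, v6}" for z
      using that c2 inv(1) by metis
    moreover have "?y \<noteq> c v2" using bip(1)[of "c v2"] closed V by metis
    ultimately show ?thesis using n by auto
  qed
  have "c z \<in> ?S" if "z \<in> ?S" for z using that ch ch' inv by auto
  then have cyS: "c ?y \<notin> ?S" using yS inv(3) by metis
  have "c ?y \<noteq> ?y" using bip(3)[of ?y] closed V by metis
  then have "card (?S \<union> {?y, c ?y}) = 10" using cS yS cyS by (subst card_Un_disjoint) auto
  moreover have "?S \<union> {?y, c ?y} \<subseteq> comp_ac x" using S clo by auto
  ultimately show "10 \<le> card (comp_ac x)" using card_mono[OF fc] by metis
qed

text \<open>\<open>a (c v2)\<close> and \<open>b (c v2)\<close> differ, so at most one of the two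
  cycles through the hexagon closes at length 8, and the other has length at least 10. Per vertex
  this yields \<open>1/8 + 3/10\<close>, which is more than \<open>2/5\<close>, and six times
  \<open>2/5\<close> exceeds 2.\<close>

lemma two_chords_sum:
  assumes h: "hexa a b v1 v2 v3 v4 v5 v6" and v: "v1 \<in> V" and ch: "c v1 = v4" "c v3 = v6"
  shows "2 \<le> (\<Sum>x\<in>{v1, v2, v3, v4, v5, v6}. discharge (card (comp_ac x)) + discharge (card (comp_bc x)))"
proof -
  note D = hexaD[OF h v]
  let ?Z = "{v1, v2, v3, v4, v5, v6}"
  have V: "v2 \<in> V" "v3 \<in> V" using D(1) by auto
  have ch': "c v4 = v1" "c v6 = v3" using ch inv(3) by metis+
  have no: "c v2 \<noteq> v5"
  proof
    assume e: "c v2 = v5"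
    then have "c v5 = v2" using inv(3) by metis
    then have "?Z = V"
      by (intro conn D(1)) (use D(3-14) ch ch' e in auto)
    moreover have "card ?Z = 6" using D(2) by simp
    ultimately show False using large by simp
  qed
  note A = two_chords_comp[OF h v ch no]
  have Z': "{v3, v2, v1, v6, v5, v4} = ?Z" by auto
  \<comment> \<open>After rotation and reflection \<open>v2\<close> and \<open>v5\<close> are still
    in the second and fifth place, so both estimates depend on neighbours of the same vertex
    \<open>c v2\<close>.\<close>
  note B = squareless.two_chords_comp[OF squareless_swapped hexa_reflect[OF hexa_rotate[OF h]] V(2) ch(2,1) no,
      unfolded Z']
  have d: "1 / 8 \<le> discharge L" if "8 \<le> L" for L
    using discharge_mono[of 8 L] that by (simp add: discharge_def)
  have d': "3 / 10 \<le> discharge L" if "10 \<le> L" for L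
  proof -
    have "discharge 10 = 3 / 10" by (simp add: discharge_def)
    then show ?thesis using discharge_mono[of 10 L] that by simp
  qed
  have "a (c v2) \<noteq> b (c v2)" using distinct(1) closed V by metis
  then consider "a (c v2) \<noteq> c v5" | "b (c v2) \<noteq> c v5" by metis
  then have t: "2 / 5 \<le> discharge (card (comp_ac x)) + discharge (card (comp_bc x))" if x: "x \<in> ?Z" for x
  proof cases
    case 1
    show ?thesis using d'[OF A(2)[OF x 1]] d[OF B(1)[OF x]] by linarith
  next
    case 2
    show ?thesis using d'[OF B(2)[OF x 2]] d[OF A(1)[OF x]] by linarith
  qed
  have "real (card ?Z) * (2 / 5) \<le> (\<Sum>x\<in>?Z. discharge (card (comp_ac x)) + discharge (card (comp_bc x)))"
    by (rule sum_bounded_below) (rule t)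
  moreover have "card ?Z = 6" using D(2) by simp
  ultimately show ?thesis by simp
qed

text \<open>The chord \<open>v1 v4\<close> closes the square \<open>v1 v2 v3 v4\<close>, with third
  neighbours \<open>c v3\<close> and \<open>v5\<close>. As the square is not bad, there is a second
  chord, \<open>v3 v6\<close> or \<open>v2 v5\<close>.\<close>

lemma chord_sum:
  assumes h: "hexa a b v1 v2 v3 v4 v5 v6" and v: "v1 \<in> V" and ch: "c v1 = v4"
  shows "2 \<le> (\<Sum>x\<in>{v1, v2, v3, v4, v5, v6}. discharge (card (comp_ac x)) + discharge (card (comp_bc x)))"
proof -
  note D = hexaD[OF h v]
  have V: "v2 \<in> V" "v3 \<in> V" "v4 \<in> V" "v5 \<in> V" using D(1) by auto
  have ch': "c v4 = v1" using ch inv(3) by metis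
  have "c v3 = v6 \<or> c v2 = v5"
  proof (rule ccontr)
    assume n: "\<not> (c v3 = v6 \<or> c v2 = v5)"
    have n3: "c v3 \<noteq> v2" "c v3 \<noteq> v4" using distinct(2,3)[OF V(2)] D(5,10) by auto
    have "bad_square edges v1 v2 v3 v4 (c v3) v5"
      unfolding bad_square_def edges_def using D v V n n3 ch ch' by auto
    then show False using no_square by blast
  qed
  then show ?thesis
  proof
    assume "c v3 = v6"
    then show ?thesis using two_chords_sum[OF h v ch] by blast
  next
    assume "c v2 = v5"
    then have "c v5 = v2" using inv(3) by metis
    moreover have "{v5, v6, v1, v2, v3, v4} = {v1, v2, v3, v4, v5, v6}" by auto
    ultimately show ?thesis
      using two_chords_sum[OF hexa_rotate[OF hexa_rotate[OF h]] V(4) _ ch] by metis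
  qed
qed

end

text \<open>The number of \<open>ab\<close>-cycles is left out because exchanging \<open>a\<close>
  and \<open>b\<close> does not alter it.\<close>

definition kempe_optimal :: "'a set \<Rightarrow> ('a \<Rightarrow> 'a) \<Rightarrow> ('a \<Rightarrow> 'a) \<Rightarrow> ('a \<Rightarrow> 'a) \<Rightarrow> bool" where
  "kempe_optimal V a b c \<longleftrightarrow> (\<forall>v\<in>V.
     card (comps V (bic V a c)) + card (comps V (bic V b c)) \<le>
       card (comps V (bic V (swapf ((bic V a b)\<^sup>* `` {v}) a b) c)) +
       card (comps V (bic V (swapf ((bic V a b)\<^sup>* `` {v}) b a) c)))"

context squareless
begin

text \<open>Without chords there are two situations. If \<open>v1\<close>, \<open>v3\<close>,
  \<open>v5\<close> lie on three cycles of one other colour pair, optimality puts them on one cycle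
  of the remaining pair, which alone gives 2. Otherwise two of them share a cycle in each of the two
  pairs, giving \<open>6/5 + 6/5\<close>. A chord can only join opposite corners.\<close>

lemma hexa_sum:
  assumes h: "hexa a b v1 v2 v3 v4 v5 v6" and v: "v1 \<in> V" and opt: "kempe_optimal V a b c"
  shows "2 \<le> (\<Sum>x\<in>comp_ab v1. discharge (card (comp_ac x)) + discharge (card (comp_bc x)))"
proof -
  note D = hexaD[OF h v]
  let ?Z = "{v1, v2, v3, v4, v5, v6}"
  have V: "v3 \<in> V" "v5 \<in> V" using D(1) by auto
  have rf: "{v1, v6, v5, v4, v3, v2} = ?Z" by auto
  note sw = squareless_swapped and re = hexa_reflect[OF h]
  have nn: "0 \<le> (\<Sum>x\<in>?Z. discharge (card (comp_ac x)))" "0 \<le> (\<Sum>x\<in>?Z. discharge (card (comp_bc x)))"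
    by (auto intro: sum_nonneg)
  have "2 \<le> (\<Sum>x\<in>?Z. discharge (card (comp_ac x)) + discharge (card (comp_bc x)))"
  proof (cases "\<forall>x\<in>?Z. c x \<notin> ?Z")
    case True
    then have cl: "\<And>x. x \<in> ?Z \<Longrightarrow> c x \<notin> ?Z" by blast
    then have cl': "\<And>x. x \<in> {v1, v6, v5, v4, v3, v2} \<Longrightarrow> c x \<notin> {v1, v6, v5, v4, v3, v2}" unfolding rf .
    note opt1 = opt[unfolded kempe_optimal_def, rule_format, OF v]
    have opt2: "card (comps V (bic V b c)) + card (comps V (bic V a c)) \<le>
      card (comps V (bic V (swapf ((bic V b a)\<^sup>* `` {v1}) b a) c)) + card (comps V (bic V (swapf ((bic V b a)\<^sup>* `` {v1}) a b) c))"
      using opt1 unfolding bic_commute[of V b a] by linarith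
    consider (A) "(v1, v3) \<notin> (bic V a c)\<^sup>*" "(v1, v5) \<notin> (bic V a c)\<^sup>*" "(v3, v5) \<notin> (bic V a c)\<^sup>*"
      | (B) "(v1, v5) \<notin> (bic V b c)\<^sup>*" "(v1, v3) \<notin> (bic V b c)\<^sup>*" "(v5, v3) \<notin> (bic V b c)\<^sup>*"
      | (C) "(v1, v3) \<in> (bic V a c)\<^sup>* \<or> (v1, v5) \<in> (bic V a c)\<^sup>* \<or> (v3, v5) \<in> (bic V a c)\<^sup>*"
        "(v1, v5) \<in> (bic V b c)\<^sup>* \<or> (v1, v3) \<in> (bic V b c)\<^sup>* \<or> (v5, v3) \<in> (bic V b c)\<^sup>*"
      by blast
    then show ?thesis
    proof cases
      case A
      have "(v1, v3) \<in> (bic V b c)\<^sup>* \<and> (v1, v5) \<in> (bic V b c)\<^sup>*" by (rule hexa_optimal[OF h v opt1 A])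
      then have "2 \<le> (\<Sum>x\<in>?Z. discharge (card (comp_bc x)))"
        using squareless.chordless_all_sum[OF sw re v cl'] unfolding rf by blast
      then show ?thesis using nn by (simp only: sum.distrib)
    next
      case B
      have "(v1, v5) \<in> (bic V a c)\<^sup>* \<and> (v1, v3) \<in> (bic V a c)\<^sup>*"
        by (rule tricoloured.hexa_optimal[OF swapped re v opt2 B])
      then have "2 \<le> (\<Sum>x\<in>?Z. discharge (card (comp_ac x)))"
        using chordless_all_sum[OF h v cl] by blast
      then show ?thesis using nn by (simp only: sum.distrib)
    next
      case C
      have "6 / 5 \<le> (\<Sum>x\<in>?Z. discharge (card (comp_ac x)))" by (rule chordless_ac_sum[OF h v cl C(1)])
      moreover have "6 / 5 \<le> (\<Sum>x\<in>?Z. discharge (card (comp_bc x)))"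
        using squareless.chordless_ac_sum[OF sw re v cl' C(2)] unfolding rf .
      ultimately show ?thesis by (simp only: sum.distrib)
    qed
  next
    case False
    have ncs: "c v1 \<notin> {v1, v3, v5, v2, v6}" "c v3 \<notin> {v1, v3, v5, v2, v4}" "c v5 \<notin> {v1, v3, v5, v4, v6}"
    proof -
      have "c v1 \<noteq> v2" "c v1 \<noteq> v6" using distinct(2,3)[OF v] D(3,14) by auto
      moreover have "c v3 \<noteq> v4" "c v3 \<noteq> v2" using distinct(2,3)[OF V(1)] D(5,10) by auto
      moreover have "c v5 \<noteq> v6" "c v5 \<noteq> v4" using distinct(2,3)[OF V(2)] D(7,12) by auto
      moreover have "c v1 \<notin> {v1, v3, v5}" using bip(3)[OF v] D(15,16) by auto
      moreover have "c v3 \<notin> {v1, v3, v5}" using bip(3)[OF V(1)] D(15,16) by auto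
      moreover have "c v5 \<notin> {v1, v3, v5}" using bip(3)[OF V(2)] D(15,16) by auto
      ultimately show "c v1 \<notin> {v1, v3, v5, v2, v6}" "c v3 \<notin> {v1, v3, v5, v2, v4}" "c v5 \<notin> {v1, v3, v5, v4, v6}"
        by simp_all
    qed
    from False obtain x where x: "x \<in> ?Z" "c x \<in> ?Z" by blast
    then have "c v1 \<in> ?Z \<or> c v3 \<in> ?Z \<or> c v5 \<in> ?Z"
    proof -
      have "x \<in> {v1, v3, v5} \<or> c x \<in> {v1, v3, v5}"
      proof (rule ccontr)
        assume n: "\<not> ?thesis"
        then have "x \<in> A \<longleftrightarrow> v1 \<notin> A" "c x \<in> A \<longleftrightarrow> v1 \<notin> A" using x D(15-19) by auto
        moreover have "x \<in> V" using x D(1) by blast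
        ultimately show False using bip(3) by blast
      qed
      then show ?thesis using x inv(3) by (metis insertE singletonD)
    qed
    then consider "c v1 = v4" | "c v3 = v6" | "c v5 = v2" using ncs by auto
    then show ?thesis
    proof cases
      case 1 then show ?thesis by (rule chord_sum[OF h v])
    next
      case 2
      moreover have "{v3, v4, v5, v6, v1, v2} = ?Z" by auto
      ultimately show ?thesis using chord_sum[OF hexa_rotate[OF h] V(1)] by metis
    next
      case 3
      moreover have "{v5, v6, v1, v2, v3, v4} = ?Z" by auto
      ultimately show ?thesis using chord_sum[OF hexa_rotate[OF hexa_rotate[OF h]] V(2)] by metis
    qed
  qed
  then show ?thesis unfolding hexa_comp[OF h v] .
qed

section \<open>Balancing surplus and deficit over all vertices\<close>

lemma card_comp_cases:
  assumes "v \<in> V"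
  shows "card (comp_ab v) = 6 \<and> (\<exists>v2 v3 v4 v5 v6. hexa a b v v2 v3 v4 v5 v6) \<or> 8 \<le> card (comp_ab v)"
proof -
  have "card (comp_ab v) = 6" if "hexa a b v v2 v3 v4 v5 v6" for v2 v3 v4 v5 v6
    using hexa_comp[OF that assms] hexaD(2)[OF that assms] by simp
  then show ?thesis using hexa_or_long[OF assms] by blast
qed

text \<open>The demand 2 of a hexagon, spread evenly over its six vertices, is \<open>1/3\<close>
  each.\<close>

lemma hexagon_count:
  assumes opt: "kempe_optimal V a b c"
  shows "real (card {v \<in> V. card (comp_ab v) = 6}) / 3 \<le>
    (\<Sum>v\<in>V. discharge (card (comp_ac v)) + discharge (card (comp_bc v)))"
proof -
  let ?H = "{v \<in> V. card (comp_ab v) = 6}"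
  let ?q = "\<lambda>v. discharge (card (comp_ac v)) + discharge (card (comp_bc v))"
  have finH: "finite ?H" using fin by simp
  have "(\<Sum>v\<in>?H. ?q v - 1 / 3) = (\<Sum>K\<in>comp_ab ` ?H. \<Sum>v | v \<in> ?H \<and> comp_ab v = K. ?q v - 1 / 3)"
    by (rule sum.image_gen[OF finH])
  also have "\<dots> \<ge> 0"
  proof (rule sum_nonneg)
    fix K assume "K \<in> comp_ab ` ?H"
    then obtain w where w: "w \<in> V" "card (comp_ab w) = 6" "K = comp_ab w" by blast
    then obtain v2 v3 v4 v5 v6 where h: "hexa a b w v2 v3 v4 v5 v6" using card_comp_cases[OF w(1)] by auto
    have "{v. v \<in> ?H \<and> comp_ab v = K} = K"
    proof
      show "{v. v \<in> ?H \<and> comp_ab v = K} \<subseteq> K" by blast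
      show "K \<subseteq> {v. v \<in> ?H \<and> comp_ab v = K}"
      proof
        fix x assume x: "x \<in> K"
        then have "(w, x) \<in> (bic V a b)\<^sup>*" using w(3) by blast
        then have "comp_ab x = K" using w(3) comp_eq_iff[OF sym_ab] by metis
        then show "x \<in> {v. v \<in> ?H \<and> comp_ab v = K}" using w x comp_ab_sub[OF w(1)] by auto
      qed
    qed
    moreover have "(\<Sum>v\<in>K. ?q v - 1 / 3) = (\<Sum>v\<in>K. ?q v) - real (card K) / 3"
      by (simp add: sum_subtractf)
    moreover have "2 \<le> (\<Sum>v\<in>K. ?q v)" using hexa_sum[OF h w(1) opt] w(3) by simp
    ultimately show "0 \<le> (\<Sum>v | v \<in> ?H \<and> comp_ab v = K. ?q v - 1 / 3)" using w by simp
  qed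
  finally have "real (card ?H) / 3 \<le> (\<Sum>v\<in>?H. ?q v)" by (simp add: sum_subtractf)
  also have "\<dots> \<le> (\<Sum>v\<in>V. ?q v)" by (rule sum_mono2) (use fin in auto)
  finally show ?thesis .
qed

text \<open>The left side is the sum of \<open>1 - 7/L\<close> over all vertices. A length is 6 or
  at least 8, so truncation discards nothing but the value \<open>-1/6\<close> at length 6.\<close>

lemma card_comps_discharge:
  "real (card V) - 7 * real (card (comps V (bic V a b))) =
    (\<Sum>v\<in>V. discharge (card (comp_ab v))) - real (card {v \<in> V. card (comp_ab v) = 6}) / 6"
proof -
  have *: "1 - 7 * (1 / real (card (comp_ab v))) =
      discharge (card (comp_ab v)) - (if card (comp_ab v) = 6 then 1 / 6 else 0)" if v: "v \<in> V" for v
    using card_comp_cases[OF v] by (auto simp: discharge_def field_simps)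
  have "real (card V) - 7 * real (card (comps V (bic V a b))) =
      (\<Sum>v\<in>V. 1 - 7 * (1 / real (card (comp_ab v))))"
    unfolding card_comps_eq_sum[OF fin sym_ab sub_ab] by (simp add: sum_subtractf sum_distrib_left)
  also have "\<dots> = (\<Sum>v\<in>V. discharge (card (comp_ab v)) - (if card (comp_ab v) = 6 then 1 / 6 else 0))"
    by (rule sum.cong[OF refl *])
  also have "\<dots> = (\<Sum>v\<in>V. discharge (card (comp_ab v))) - (\<Sum>v\<in>V. if card (comp_ab v) = 6 then 1 / 6 else 0)"
    by (rule sum_subtractf)
  also have "(\<Sum>v\<in>V. if card (comp_ab v) = 6 then 1 / 6 else (0::real)) = (\<Sum>v\<in>{v \<in> V. card (comp_ab v) = 6}. 1 / 6)"
    using fin by (simp add: sum.If_cases Int_def)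
  finally show ?thesis by simp
qed

text \<open>In the sum of the three instances of \<open>hexagon_count\<close> every surplus occurs
  twice. The total surplus is therefore at least a sixth of the number of hexagon vertices over all
  pairs, which is precisely the total deficit.\<close>

theorem kempe_optimal_bound:
  assumes "kempe_optimal V a b c" "kempe_optimal V a c b" "kempe_optimal V b c a"
  shows "7 * (card (comps V (bic V a b)) + card (comps V (bic V a c)) + card (comps V (bic V b c))) \<le> 3 * card V"
proof -
  note rot = squareless_rotated
  note acb = squareless.squareless_rotated[OF squareless_swapped]
  note comm = bic_commute[of V b a] bic_commute[of V c a] bic_commute[of V c b]
  note h1 = hexagon_count[OF assms(1)] and d1 = card_comps_discharge
  note h2 = squareless.hexagon_count[OF acb assms(2), unfolded comm] 
    and d2 = squareless.card_comps_discharge[OF acb, unfolded comm]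
  note h3 = squareless.hexagon_count[OF rot assms(3), unfolded comm]
    and d3 = squareless.card_comps_discharge[OF rot, unfolded comm]
  have "7 * real (card (comps V (bic V a b)) + card (comps V (bic V a c)) + card (comps V (bic V b c))) \<le> 3 * real (card V)"
    using h1 h2 h3 d1 d2 d3 by (simp add: sum.distrib)
  then show ?thesis by (simp flip: of_nat_le_iff)
qed

end

section \<open>Contracting squares\<close>

text \<open>The vertex set is \<open>Domain E\<close>: a deleted vertex is one without edges, so
  that contraction acts on the edge relation alone.\<close>

definition cubic_bip :: "'a set \<Rightarrow> 'a rel \<Rightarrow> bool" where
  "cubic_bip A E \<longleftrightarrow> finite E \<and> sym E \<and> (\<forall>(u, v)\<in>E. u \<in> A \<longleftrightarrow> v \<notin> A) \<and>
     (\<forall>v\<in>Domain E. card (E `` {v}) = 3) \<and> (\<forall>u\<in>Domain E. \<forall>v\<in>Domain E. (u, v) \<in> E\<^sup>*)"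

text \<open>The square collapses onto the edge \<open>x1 x2\<close>, which is inherited from
  \<open>E\<close>, and the outer edges of \<open>x3\<close> and \<open>x4\<close> move to
  \<open>x1\<close> and \<open>x2\<close>.\<close>

definition contract :: "'a rel \<Rightarrow> 'a \<Rightarrow> 'a \<Rightarrow> 'a \<Rightarrow> 'a \<Rightarrow> 'a \<Rightarrow> 'a \<Rightarrow> 'a rel" where
  "contract E x1 x2 x3 x4 p q =
     {(u, v) \<in> E. u \<notin> {x3, x4} \<and> v \<notin> {x3, x4}} \<union> {(x1, p), (p, x1), (x2, q), (q, x2)}"

definition perfect :: "'a rel \<Rightarrow> ('a \<Rightarrow> 'a) \<Rightarrow> bool" where
  "perfect E h \<longleftrightarrow> (\<forall>v\<in>Domain E. (v, h v) \<in> E \<and> h (h v) = v)"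

text \<open>In a cubic graph the 2-factors are the complements of the perfect matchings. The
  matching is a single involution, which is easier to lift through a contraction.\<close>

definition factor :: "'a rel \<Rightarrow> ('a \<Rightarrow> 'a) \<Rightarrow> 'a rel" where
  "factor E h = {(u, v) \<in> E. v \<noteq> h u}"

lemma sym_factor:
  assumes "sym E" "perfect E h"
  shows "sym (factor E h)"
proof (rule symI)
  fix u v assume "(u, v) \<in> factor E h"
  then have uv: "(u, v) \<in> E" "v \<noteq> h u" by (auto simp: factor_def)
  then have vu: "(v, u) \<in> E" using assms(1) by (meson symD)
  have "u \<noteq> h v" using assms(2) uv vu unfolding perfect_def by (metis Domain.DomainI)
  then show "(v, u) \<in> factor E h" using vu by (auto simp: factor_def)
qed

text \<open>Handshake argument: the sides split the arcs starting in \<open>K\<close> into two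
  halves that reversal exchanges, so the degree sum over \<open>K\<close> is even. It will show that
  a path starting in one corner of an expanded square ends in another corner.\<close>

lemma no_single_odd_vertex:
  assumes fin: "finite R" and sym: "sym R" and bip: "\<And>u v. (u, v) \<in> R \<Longrightarrow> u \<in> A \<longleftrightarrow> v \<notin> A"
    and K: "finite K" "\<And>u v. u \<in> K \<Longrightarrow> (u, v) \<in> R \<Longrightarrow> v \<in> K"
    and x: "x \<in> K" "card (R `` {x}) = 1" and deg: "\<And>v. v \<in> K \<Longrightarrow> v \<noteq> x \<Longrightarrow> card (R `` {v}) = 2"
  shows False
proof -
  let ?S = "{(u, v) \<in> R. u \<in> K}"
  have finS: "finite ?S" using fin by (rule rev_finite_subset) auto
  have "?S = (SIGMA u:K. R `` {u})" by auto
  then have "card ?S = (\<Sum>u\<in>K. card (R `` {u}))"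
    using K(1) fin by (simp add: card_SigmaI finite_Image)
  also have "\<dots> = 1 + (\<Sum>u\<in>K - {x}. card (R `` {u}))"
    using K(1) x by (simp add: sum.remove)
  also have "(\<Sum>u\<in>K - {x}. card (R `` {u})) = (\<Sum>u\<in>K - {x}. 2)"
    by (rule sum.cong) (use deg in auto)
  finally have odd: "odd (card ?S)" by simp
  let ?S1 = "{(u, v) \<in> ?S. u \<in> A}" and ?S2 = "{(u, v) \<in> ?S. u \<notin> A}"
  have iff: "(u, v) \<in> R \<and> u \<in> K \<and> u \<notin> A \<longleftrightarrow> (v, u) \<in> R \<and> v \<in> K \<and> v \<in> A" for u v
    using bip[of u v] bip[of v u] K(2)[of u v] K(2)[of v u] symD[OF sym] by blast
  have "e \<in> ?S2 \<longleftrightarrow> e \<in> ?S1\<inverse>" for e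
    using iff[of "fst e" "snd e"] by (cases e) simp
  then have "?S2 = ?S1\<inverse>" by blast
  then have "card ?S2 = card ?S1" by (simp add: card_inverse)
  moreover have "card ?S = card ?S1 + card ?S2"
  proof -
    have "finite ?S1" "finite ?S2" "?S1 \<inter> ?S2 = {}" using finS by (auto intro: rev_finite_subset)
    then have "card (?S1 \<union> ?S2) = card ?S1 + card ?S2" by (rule card_Un_disjoint)
    moreover have "?S1 \<union> ?S2 = ?S" by auto
    ultimately show ?thesis by (simp only:)
  qed
  ultimately show False using odd by simp
qed

locale square =
  fixes A :: "'a set" and E :: "'a rel" and x1 x2 x3 x4 p q :: 'a
  assumes cubic: "cubic_bip A E" and bad: "bad_square E x1 x2 x3 x4 p q"
begin

abbreviation "E' \<equiv> contract E x1 x2 x3 x4 p q"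

lemma finE: "finite E" and symE: "sym E" and bipE: "(u, v) \<in> E \<Longrightarrow> u \<in> A \<longleftrightarrow> v \<notin> A"
  and degE: "v \<in> Domain E \<Longrightarrow> card (E `` {v}) = 3"
  and connE: "u \<in> Domain E \<Longrightarrow> v \<in> Domain E \<Longrightarrow> (u, v) \<in> E\<^sup>*"
  using cubic unfolding cubic_bip_def by auto

lemma E_sym: "(u, v) \<in> E \<Longrightarrow> (v, u) \<in> E"
  using symE by (meson symD)

lemma edges: "(x1, x2) \<in> E" "(x2, x3) \<in> E" "(x3, x4) \<in> E" "(x4, x1) \<in> E" "(x3, p) \<in> E" "(x4, q) \<in> E"
    "(x2, x1) \<in> E" "(x3, x2) \<in> E" "(x4, x3) \<in> E" "(x1, x4) \<in> E" "(p, x3) \<in> E" "(q, x4) \<in> E"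
  and nonedges: "(x1, p) \<notin> E" "(p, x1) \<notin> E" "(x2, q) \<notin> E" "(q, x2) \<notin> E"
  and neq: "x1 \<noteq> x3" "x2 \<noteq> x4" "p \<noteq> x2" "p \<noteq> x4" "q \<noteq> x1" "q \<noteq> x3"
  using bad E_sym unfolding bad_square_def by blast+

lemma sides: "x3 \<in> A \<longleftrightarrow> x1 \<in> A" "q \<in> A \<longleftrightarrow> x1 \<in> A" "x2 \<in> A \<longleftrightarrow> x1 \<notin> A" "x4 \<in> A \<longleftrightarrow> x1 \<notin> A" "p \<in> A \<longleftrightarrow> x1 \<notin> A"
  using bipE edges by blast+

lemma distinct6: "distinct [x1, x2, x3, x4, p, q]"
  using neq sides by auto

lemma nb3: "E `` {x3} = {x2, x4, p}" and nb4: "E `` {x4} = {x1, x3, q}"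
proof -
  have *: "S = E `` {v}" if "S \<subseteq> E `` {v}" "card S = 3" "v \<in> Domain E" for S v
    using that degE finE by (intro card_subset_eq) (auto simp: finite_Image)
  show "E `` {x3} = {x2, x4, p}" using *[of "{x2, x4, p}" x3] edges distinct6 by auto
  show "E `` {x4} = {x1, x3, q}" using *[of "{x1, x3, q}" x4] edges distinct6 by auto
qed

lemma to3: "(u, x3) \<in> E \<longleftrightarrow> u \<in> {x2, x4, p}" and to4: "(u, x4) \<in> E \<longleftrightarrow> u \<in> {x1, x3, q}"
  and from3: "(x3, u) \<in> E \<longleftrightarrow> u \<in> {x2, x4, p}" and from4: "(x4, u) \<in> E \<longleftrightarrow> u \<in> {x1, x3, q}"
  using nb3 nb4 E_sym by blast+

lemma E'_iff: "(u, v) \<in> E' \<longleftrightarrow> (u, v) \<in> E \<and> u \<notin> {x3, x4} \<and> v \<notin> {x3, x4} \<or>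
    (u, v) \<in> {(x1, p), (p, x1), (x2, q), (q, x2)}"
  by (auto simp: contract_def)

lemma symE': "sym E'"
  using E_sym by (auto simp: sym_def E'_iff)

lemma finE': "finite E'"
  using finE by (auto simp: contract_def intro: rev_finite_subset)

lemma nbE':
  assumes "v \<notin> {x3, x4}"
  shows "E' `` {v} = (if v = x1 then insert p (E `` {x1} - {x4}) else if v = x2 then insert q (E `` {x2} - {x3})
    else if v = p then insert x1 (E `` {p} - {x3}) else if v = q then insert x2 (E `` {q} - {x4}) else E `` {v})"
proof -
  have s: "(x1, x3) \<notin> E" "(x2, x4) \<notin> E" "(p, x4) \<notin> E" "(q, x3) \<notin> E"
    using distinct6 by (auto simp: to3 to4)
  have "v \<noteq> x1 \<Longrightarrow> v \<noteq> x2 \<Longrightarrow> v \<noteq> p \<Longrightarrow> v \<noteq> q \<Longrightarrow> (v, x3) \<notin> E \<and> (v, x4) \<notin> E"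
    using assms by (auto simp: to3 to4)
  then show ?thesis using assms s distinct6 unfolding set_eq_iff Image_singleton_iff E'_iff
    by auto
qed

lemma Domain': "Domain E' = Domain E - {x3, x4}"
proof
  show "Domain E' \<subseteq> Domain E - {x3, x4}"
    using edges distinct6 by (auto simp: E'_iff Domain_iff)
  show "Domain E - {x3, x4} \<subseteq> Domain E'"
  proof
    fix v assume v: "v \<in> Domain E - {x3, x4}"
    then have "card (E `` {v}) = 3" using degE by auto
    then have "E `` {v} \<noteq> {}" by auto
    then have "E' `` {v} \<noteq> {}" using nbE'[of v] v by (auto split: if_splits)
    then show "v \<in> Domain E'" by auto
  qed
qed

lemma cubic_contract: "cubic_bip A E'"
  unfolding cubic_bip_def
proof (intro conjI ballI)
  show "finite E'" by (rule finE')
  show "sym E'" by (rule symE')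
  show "case e of (u, v) \<Rightarrow> u \<in> A \<longleftrightarrow> v \<notin> A" if "e \<in> E'" for e
    using that bipE sides by (cases e) (auto simp: E'_iff)
  show "card (E' `` {v}) = 3" if v: "v \<in> Domain E'" for v
  proof -
    have v': "v \<in> Domain E" "v \<notin> {x3, x4}" using v Domain' by auto
    have f: "finite (E `` {w})" for w using finE by (simp add: finite_Image)
    have *: "card (insert y (E `` {w} - {z})) = 3" if "w \<in> Domain E" "(w, z) \<in> E" "(w, y) \<notin> E" for w y z
      using that degE[of w] f[of w] by (simp add: card_Diff_singleton)
    show ?thesis unfolding nbE'[OF v'(2)]
      using *[of x1 x4 p] *[of x2 x3 q] *[of p x3 x1] *[of q x4 x2] edges nonedges degE[OF v'(1)] by auto
  qed
  show "(u, v) \<in> E'\<^sup>*" if uv: "u \<in> Domain E'" "v \<in> Domain E'" for u v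
  proof -
    \<comment> \<open>\<open>\<phi>\<close> is the quotient map of the contraction; walks in
      \<open>E\<close> project to walks in \<open>E'\<close>.\<close>
    define \<phi> where "\<phi> z = (if z = x3 then x1 else if z = x4 then x2 else z)" for z
    have e12: "(x1, x2) \<in> E'" "(x2, x1) \<in> E'" using edges distinct6 by (auto simp: E'_iff)
    have step: "(\<phi> y, \<phi> z) \<in> E'\<^sup>*" if yz: "(y, z) \<in> E" for y z
    proof -
      consider "y = x3" | "y = x4" | "z = x3" | "z = x4" | "y \<notin> {x3, x4}" "z \<notin> {x3, x4}" by blast
      then show ?thesis
      proof cases
        case 1
        then have "z \<in> {x2, x4, p}" using yz from3 by blast
        then show ?thesis using 1 e12 distinct6 by (auto simp: \<phi>_def E'_iff)
      next
        case 2
        then have "z \<in> {x1, x3, q}" using yz from4 by blast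
        then show ?thesis using 2 e12 distinct6 by (auto simp: \<phi>_def E'_iff)
      next
        case 3
        then have "y \<in> {x2, x4, p}" using yz to3 by blast
        then show ?thesis using 3 e12 distinct6 by (auto simp: \<phi>_def E'_iff)
      next
        case 4
        then have "y \<in> {x1, x3, q}" using yz to4 by blast
        then show ?thesis using 4 e12 distinct6 by (auto simp: \<phi>_def E'_iff)
      next
        case 5
        then show ?thesis using yz by (auto simp: \<phi>_def E'_iff)
      qed
    qed
    have "(\<phi> y, \<phi> z) \<in> E'\<^sup>*" if "(y, z) \<in> E\<^sup>*" for y z
      using that by (induction rule: rtrancl_induct) (auto intro: rtrancl_trans step)
    moreover have "(u, v) \<in> E\<^sup>*" "\<phi> u = u" "\<phi> v = v" using uv Domain' connE by (auto simp: \<phi>_def)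
    ultimately show ?thesis by metis
  qed
qed

text \<open>\<open>S\<close> contains the vertices of the contracted graph whose partner changes.
  Outside it the old matching survives, and \<open>new\<close> guarantees that no surviving edge is
  one of the two added by the contraction.\<close>

lemma perfect_extend:
  assumes h: "perfect E' h" and S: "S \<subseteq> Domain E'" "\<And>v. v \<in> S \<Longrightarrow> h v \<in> S"
    and eq: "\<And>v. v \<notin> S \<Longrightarrow> v \<notin> {x3, x4} \<Longrightarrow> k v = h v"
    and new: "h x1 = p \<Longrightarrow> x1 \<in> S" "h x2 = q \<Longrightarrow> x2 \<in> S"
    and S': "\<And>v. v \<in> S \<union> {x3, x4} \<Longrightarrow> (v, k v) \<in> E \<and> k (k v) = v"
  shows "perfect E k"
  unfolding perfect_def
proof
  fix v assume v: "v \<in> Domain E"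
  show "(v, k v) \<in> E \<and> k (k v) = v"
  proof (cases "v \<in> S \<union> {x3, x4}")
    case False
    then have v': "v \<in> Domain E'" using v Domain' by auto
    then have hv: "(v, h v) \<in> E'" "h (h v) = v" using h by (auto simp: perfect_def)
    then have D: "h v \<in> Domain E'" using symE' by (meson Domain.DomainI symD)
    have "h v \<notin> S" using S(2) hv(2) False by force
    moreover have "h v \<notin> {x3, x4}" using D Domain' by auto
    ultimately have k: "k v = h v" "k (h v) = v" using eq False hv(2) by auto
    have "(v, h v) \<notin> {(x1, p), (p, x1), (x2, q), (q, x2)}"
    proof
      assume "(v, h v) \<in> {(x1, p), (p, x1), (x2, q), (q, x2)}"
      then have "h x1 = p \<and> (v = x1 \<or> h v = x1) \<or> h x2 = q \<and> (v = x2 \<or> h v = x2)" using hv(2) by auto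
      then show False using new False \<open>h v \<notin> S\<close> by auto
    qed
    then show ?thesis using hv(1) k by (auto simp: E'_iff)
  qed (rule S')
qed

text \<open>If \<open>x1 p\<close> is matched, it stands for \<open>x3 p\<close> and leaves
  \<open>x1\<close> over; otherwise \<open>x1\<close> keeps its partner and \<open>x3\<close> is
  left over. This corner is \<open>w\<close>, and \<open>g\<close> is the analogous one of
  \<open>x2\<close> and \<open>x4\<close>. The two are adjacent on the square whichever they are,
  and get matched.\<close>

definition expand_path :: "('a \<Rightarrow> 'a) \<Rightarrow> 'a \<Rightarrow> 'a" where
  "expand_path h =
     (let w = if h x1 = p then x1 else x3;
          g = if h x2 = q then x2 else x4;
          h1 = if h x1 = p then h(x3 := p, p := x3) else h;
          h2 = if h x2 = q then h1(x4 := q, q := x4) else h1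
      in h2(w := g, g := w))"

text \<open>Only one square edge is matched, so the other three form a path of the factor through
  all corners. Merged corners thus stay in one class, and every factor edge of the contracted graph
  lifts to a connection.\<close>

lemma expand_path:
  assumes h: "perfect E' h" and ne: "h x1 \<noteq> x2"
  shows "perfect E (expand_path h)"
    "card (comps (Domain E) (factor E (expand_path h))) \<le> card (comps (Domain E') (factor E' h))"
proof -
  let ?k = "expand_path h"
  define w where "w = (if h x1 = p then x1 else x3)"
  define g where "g = (if h x2 = q then x2 else x4)"
  have D: "x1 \<in> Domain E'" "x2 \<in> Domain E'" "p \<in> Domain E'" "q \<in> Domain E'" by (auto simp: E'_iff Domain_iff)
  have hD: "h v \<in> Domain E'" "(v, h v) \<in> E'" "h (h v) = v" if "v \<in> Domain E'" for v
    using h that symE' unfolding perfect_def by (meson Domain.DomainI symD)+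
  have hp: "h x1 = p \<Longrightarrow> h p = x1" and hq: "h x2 = q \<Longrightarrow> h q = x2" using hD D by metis+
  have hx1: "h x1 \<notin> {x3, x4}" using hD(1) D Domain' by auto
  have ne2: "h x2 \<noteq> x1" using ne hD D by metis
  have k: "?k w = g" "?k g = w" "h x1 = p \<Longrightarrow> ?k x3 = p \<and> ?k p = x3" "h x2 = q \<Longrightarrow> ?k x4 = q \<and> ?k q = x4"
    "\<And>v. v \<notin> {x3, x4, w, g} \<Longrightarrow> (h x1 = p \<longrightarrow> v \<noteq> p) \<Longrightarrow> (h x2 = q \<longrightarrow> v \<noteq> q) \<Longrightarrow> ?k v = h v"
    using distinct6 by (auto simp: expand_path_def Let_def w_def g_def)
  define S where "S = (if h x1 = p then {x1, p} else {}) \<union> (if h x2 = q then {x2, q} else {})"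
  have wg: "(w, g) \<in> E" "(g, w) \<in> E" "w \<in> {x1, x3}" "g \<in> {x2, x4}" using edges by (auto simp: w_def g_def)
  show perf: "perfect E ?k"
  proof (rule perfect_extend[OF h, of S])
    show "S \<subseteq> Domain E'" using D by (auto simp: S_def)
    show "h v \<in> S" if "v \<in> S" for v using that hp hq by (auto simp: S_def split: if_splits)
    show "?k v = h v" if "v \<notin> S" "v \<notin> {x3, x4}" for v
      using that by (intro k(5)) (auto simp: S_def w_def g_def split: if_splits)
    show "h x1 = p \<Longrightarrow> x1 \<in> S" "h x2 = q \<Longrightarrow> x2 \<in> S" by (auto simp: S_def)
    show "(v, ?k v) \<in> E \<and> ?k (?k v) = v" if v: "v \<in> S \<union> {x3, x4}" for v
    proof -
      have "v \<in> {w, g} \<or> h x1 = p \<and> v \<in> {x3, p} \<or> h x2 = q \<and> v \<in> {x4, q}"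
        using v by (auto simp: S_def w_def g_def split: if_splits)
      then show ?thesis using k(1-4) wg edges by auto
    qed
  qed
  let ?R = "factor E ?k"
  have sR: "sym ?R" by (rule sym_factor[OF symE perf])
  have kx1: "?k x1 \<in> {x2, x4} \<Longrightarrow> w = x1 \<and> ?k x1 = g"
    using k(1) k(5)[of x1] ne hx1 distinct6 by (cases "h x1 = p") (auto simp: w_def g_def)
  have kx3: "?k x3 \<in> {x2, x4} \<Longrightarrow> w = x3 \<and> ?k x3 = g"
    using k(1,3) distinct6 by (cases "h x1 = p") (auto simp: w_def)
  have sq: "(i, j) \<in> ?R" if "i \<in> {x1, x3}" "j \<in> {x2, x4}" "(i, j) \<noteq> (w, g)" for i j
    using that kx1 kx3 edges distinct6 by (auto simp: factor_def)
  have sq': "(j, i) \<in> ?R" if "i \<in> {x1, x3}" "j \<in> {x2, x4}" "(i, j) \<noteq> (w, g)" for i j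
    using sq[OF that] sR by (meson symD)
  have con1: "(x1, v) \<in> ?R\<^sup>*" if v: "v \<in> {x1, x2, x3, x4}" for v
  proof -
    \<comment> \<open>The path formed by the three unmatched square edges is \<open>w\<close>,
      \<open>g'\<close>, \<open>w'\<close>, \<open>g\<close>.\<close>
    define w' where "w' = (if w = x1 then x3 else x1)"
    define g' where "g' = (if g = x2 then x4 else x2)"
    have e: "(w, g') \<in> ?R" "(g', w') \<in> ?R" "(w', g) \<in> ?R" "(g', w) \<in> ?R" "(w', g') \<in> ?R" "(g, w') \<in> ?R"
    proof -
      have "w' \<in> {x1, x3}" "g' \<in> {x2, x4}" "w' \<noteq> w" "g' \<noteq> g"
        using wg(3,4) neq by (auto simp: w'_def g'_def)
      then show "(w, g') \<in> ?R" "(g', w') \<in> ?R" "(w', g) \<in> ?R" "(g', w) \<in> ?R" "(w', g') \<in> ?R" "(g, w') \<in> ?R"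
        using sq sq' wg(3,4) by blast+
    qed
    then have "(w', w) \<in> ?R\<^sup>*" "(w', g) \<in> ?R\<^sup>*" "(w', g') \<in> ?R\<^sup>*"
      by (meson r_into_rtrancl rtrancl_into_rtrancl)+
    then have "(w', y) \<in> ?R\<^sup>*" if "y \<in> {x1, x2, x3, x4}" for y
      using that wg(3,4) by (auto simp: w'_def g'_def split: if_splits)
    then show ?thesis using v rtrancl_sym[OF sR] by (meson insertI1 rtrancl_trans)
  qed
  have con: "(u, v) \<in> ?R\<^sup>*" if "u \<in> {x1, x2, x3, x4}" "v \<in> {x1, x2, x3, x4}" for u v
    using con1 that rtrancl_sym[OF sR] by (meson rtrancl_trans)
  have e1: "(x1, p) \<in> ?R\<^sup>*" if "h x1 \<noteq> p"
  proof -
    have "?k x3 = g" using that k(1) by (simp add: w_def)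
    then have "(x3, p) \<in> ?R" using edges wg(4) distinct6 by (auto simp: factor_def)
    then show ?thesis using con[of x1 x3] by (auto intro: rtrancl_into_rtrancl)
  qed
  have e2: "(x2, q) \<in> ?R\<^sup>*" if "h x2 \<noteq> q"
  proof -
    have "?k x4 = w" using that k(2) by (simp add: g_def)
    then have "(x4, q) \<in> ?R" using edges wg(3) distinct6 by (auto simp: factor_def)
    then show ?thesis using con[of x2 x4] by (auto intro: rtrancl_into_rtrancl)
  qed
  show "card (comps (Domain E) ?R) \<le> card (comps (Domain E') (factor E' h))"
  proof (rule card_comps_map_le[where \<phi> = id])
    show "finite (Domain E')" using finE' by (simp add: finite_Domain)
    show "sym ?R" by (rule sR)
    show "\<exists>x\<in>Domain E'. (id x, v) \<in> ?R\<^sup>*" if "v \<in> Domain E" for v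
    proof (cases "v \<in> {x3, x4}")
      case True
      then show ?thesis using con1[of v] D by auto
    next
      case False
      then show ?thesis using that Domain' by auto
    qed
    show "(id u, id v) \<in> ?R\<^sup>*" if "(u, v) \<in> factor E' h" for u v
    proof -
      have uv: "(u, v) \<in> E'" "v \<noteq> h u" using that by (auto simp: factor_def)
      from uv(1) consider "(u, v) \<in> E" "u \<notin> {x3, x4}" "v \<notin> {x3, x4}" | "(u, v) = (x1, p)" | "(u, v) = (p, x1)"
        | "(u, v) = (x2, q)" | "(u, v) = (q, x2)" unfolding E'_iff by blast
      then show ?thesis
      proof cases
        case 1
        show ?thesis
        proof (cases "v = ?k u")
          case True
          then have "u \<in> {w, g} \<or> h x1 = p \<and> u = p \<or> h x2 = q \<and> u = q" using k(5)[of u] 1 uv(2) by auto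
          then have "u \<in> {w, g}" using k(3,4) True 1 by auto
          then have "u \<in> {x1, x2, x3, x4}" "v \<in> {x1, x2, x3, x4}" using True k(1,2) wg(3,4) by auto
          then show ?thesis using con by simp
        next
          case False
          then show ?thesis using 1 by (auto simp: factor_def)
        qed
      next
        case 2 then show ?thesis using e1 uv(2) by auto
      next
        case 3
        then have "h x1 \<noteq> p" using uv(2) hp by auto
        then show ?thesis using e1 3 rtrancl_sym[OF sR] by auto
      next
        case 4 then show ?thesis using e2 uv(2) by auto
      next
        case 5
        then have "h x2 \<noteq> q" using uv(2) hq by auto
        then show ?thesis using e2 5 rtrancl_sym[OF sR] by auto
      qed
    qed
  qed
qed

text \<open>If \<open>x1 x2\<close> is matched in the contracted graph, no outer edge of a corner is
  matched, so the square must be covered by one of its two pairs of opposite edges. This is one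
  choice, \<open>expand_14\<close> the other.\<close>

definition expand_12 :: "('a \<Rightarrow> 'a) \<Rightarrow> 'a \<Rightarrow> 'a" where
  "expand_12 h = h(x1 := x2, x2 := x1, x3 := x4, x4 := x3)"

definition expand_14 :: "('a \<Rightarrow> 'a) \<Rightarrow> 'a \<Rightarrow> 'a" where
  "expand_14 h = h(x1 := x4, x4 := x1, x2 := x3, x3 := x2)"

text \<open>Apart from the square edges every corner has degree 1 in the factor, so the outer paths
  pair up the corners. If \<open>x1\<close> is paired with \<open>x2\<close> or \<open>x4\<close>,
  the completion that matches it to this very corner leaves two factor edges linking both paths. If
  it is paired with \<open>x3\<close>, the merged corners are connected already.\<close>

lemma expand_square:
  assumes h: "perfect E' h" and hx: "h x1 = x2"
  shows "perfect E (expand_12 h)" "perfect E (expand_14 h)"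
    "card (comps (Domain E) (factor E (expand_12 h))) \<le> card (comps (Domain E') (factor E' h)) \<or>
     card (comps (Domain E) (factor E (expand_14 h))) \<le> card (comps (Domain E') (factor E' h))"
proof -
  let ?sq = "{x1, x2, x3, x4}"
  have D: "x1 \<in> Domain E'" "x2 \<in> Domain E'" by (auto simp: E'_iff Domain_iff)
  have hx': "h x2 = x1" using h hx D by (metis perfect_def)
  have ne: "h x1 \<noteq> p" "h x2 \<noteq> q" using hx hx' distinct6 by auto
  show p1: "perfect E (expand_12 h)"
    by (rule perfect_extend[OF h, of "{x1, x2}"])
      (use D hx hx' ne edges distinct6 in \<open>auto simp: expand_12_def\<close>)
  show p2: "perfect E (expand_14 h)"
    by (rule perfect_extend[OF h, of "{x1, x2}"])
      (use D hx hx' ne edges distinct6 in \<open>auto simp: expand_14_def\<close>)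
  \<comment> \<open>\<open>F\<close> is the part of the factor common to both completions: the outer
    paths and cycles, in which a corner keeps only its edge leaving the square.\<close>
  define F where "F = {(u, v) \<in> E. \<not> (u \<in> ?sq \<and> v \<in> ?sq) \<and> (u \<in> ?sq \<or> v \<noteq> h u)}"
  have hE: "(u, h u) \<in> E" "h u \<notin> ?sq" "h (h u) = u" if u: "u \<in> Domain E" "u \<notin> ?sq" for u
  proof -
    have u': "u \<in> Domain E'" using u Domain' by auto
    then have *: "(u, h u) \<in> E'" "h (h u) = u" using h by (auto simp: perfect_def)
    have D': "h u \<in> Domain E'" using *(1) symE' by (meson Domain.DomainI symD)
    have "h u \<noteq> x1" "h u \<noteq> x2" using *(2) hx hx' u by auto
    then show "h u \<notin> ?sq" using D' Domain' by auto
    then show "(u, h u) \<in> E" using *(1) u(2) by (auto simp: E'_iff)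
    show "h (h u) = u" by fact
  qed
  have symF: "sym F"
  proof (rule symI)
    fix u v assume uv: "(u, v) \<in> F"
    then have "(u, v) \<in> E" "(v, u) \<in> E" using E_sym by (auto simp: F_def)
    moreover have "v \<in> Domain E" using calculation by blast
    moreover have "v \<in> ?sq \<or> u \<noteq> h v"
      using uv hE(2,3)[of v] calculation by (auto simp: F_def)
    ultimately show "(v, u) \<in> F" using uv by (auto simp: F_def)
  qed
  have finF: "finite F" using finE by (rule rev_finite_subset) (auto simp: F_def)
  have deg2: "card (F `` {v}) = 2" if v: "v \<in> Domain E" "v \<notin> ?sq" for v
  proof -
    have "F `` {v} = E `` {v} - {h v}" using v(2) by (auto simp: F_def)
    then show ?thesis using degE[OF v(1)] hE(1)[OF v] finE by (simp add: card_Diff_singleton finite_Image)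
  qed
  have deg1: "card (F `` {v}) = 1" if v: "v \<in> ?sq" for v
  proof -
    have c: "card (E `` {v} - {s, t}) = 1" if "s \<noteq> t" "(v, s) \<in> E" "(v, t) \<in> E" for s t
    proof -
      have "card (E `` {v}) = 3" using degE that by blast
      moreover have "card {s, t} = 2" using that by simp
      ultimately show ?thesis using that card_Diff_subset[of "{s, t}" "E `` {v}"] by simp
    qed
    have "v \<in> {x1, x3} \<Longrightarrow> F `` {v} = E `` {v} - {x2, x4}"
    proof -
      assume v: "v \<in> {x1, x3}"
      have "(v, x1) \<notin> E" "(v, x3) \<notin> E" using bipE v sides by blast+
      then show "F `` {v} = E `` {v} - {x2, x4}" using v by (auto simp: F_def)
    qed
    moreover have "v \<in> {x2, x4} \<Longrightarrow> F `` {v} = E `` {v} - {x1, x3}"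
    proof -
      assume v: "v \<in> {x2, x4}"
      have "(v, x2) \<notin> E" "(v, x4) \<notin> E" using bipE v sides by blast+
      then show "F `` {v} = E `` {v} - {x1, x3}" using v by (auto simp: F_def)
    qed
    moreover have "v \<in> {x1, x3} \<Longrightarrow> (v, x2) \<in> E \<and> (v, x4) \<in> E" "v \<in> {x2, x4} \<Longrightarrow> (v, x1) \<in> E \<and> (v, x3) \<in> E"
      using edges by blast+
    moreover have "v \<in> {x1, x3} \<or> v \<in> {x2, x4}" using v by blast
    ultimately show ?thesis using c[of x2 x4] c[of x1 x3] neq by metis
  qed
  \<comment> \<open>A corner alone in its \<open>F\<close>-class would be the only vertex of odd
    degree there.\<close>
  have other: "\<exists>y\<in>?sq - {x}. (x, y) \<in> F\<^sup>*" if x: "x \<in> ?sq" for x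
  proof (rule ccontr)
    assume n: "\<not> ?thesis"
    have xD: "x \<in> Domain E" using x edges by auto
    have KD: "F\<^sup>* `` {x} \<subseteq> Domain E"
    proof
      fix y assume "y \<in> F\<^sup>* `` {x}"
      then have "(x, y) \<in> F\<^sup>*" by simp
      then show "y \<in> Domain E"
        by (rule rtrancl_closed) (use xD E_sym in \<open>auto simp: F_def\<close>)
    qed
    show False
    proof (rule no_single_odd_vertex[OF finF symF, of A "F\<^sup>* `` {x}" x])
      show "u \<in> A \<longleftrightarrow> v \<notin> A" if "(u, v) \<in> F" for u v using that bipE by (auto simp: F_def)
      show "finite (F\<^sup>* `` {x})" using KD finE by (meson finite_Domain finite_subset)
      show "v \<in> F\<^sup>* `` {x}" if "u \<in> F\<^sup>* `` {x}" "(u, v) \<in> F" for u v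
        using that rtrancl_into_rtrancl[of x u F v] by simp
      show "card (F `` {x}) = 1" by (rule deg1[OF x])
      show "card (F `` {v}) = 2" if "v \<in> F\<^sup>* `` {x}" "v \<noteq> x" for v
        using that n KD by (intro deg2) auto
    qed simp
  qed
  have main: "card (comps (Domain E) (factor E k)) \<le> card (comps (Domain E') (factor E' h))"
    if pk: "perfect E k" and kF: "F \<subseteq> factor E k"
      and j: "(x1, x3) \<in> (factor E k)\<^sup>*" "(x2, x4) \<in> (factor E k)\<^sup>*" for k
  proof (rule card_comps_map_le[where \<phi> = id])
    let ?R = "factor E k"
    show "finite (Domain E')" using finE' by (simp add: finite_Domain)
    show sR: "sym ?R" by (rule sym_factor[OF symE pk])
    show "\<exists>x\<in>Domain E'. (id x, v) \<in> ?R\<^sup>*" if "v \<in> Domain E" for v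
    proof (cases "v \<in> {x3, x4}")
      case True
      then show ?thesis using j D by auto
    next
      case False
      then show ?thesis using that Domain' by auto
    qed
    have "(x3, p) \<in> F" "(x4, q) \<in> F" using edges distinct6 by (auto simp: F_def)
    then have e: "(x1, p) \<in> ?R\<^sup>*" "(x2, q) \<in> ?R\<^sup>*" using j kF by (auto intro: rtrancl_into_rtrancl)
    show "(id u, id v) \<in> ?R\<^sup>*" if "(u, v) \<in> factor E' h" for u v
    proof -
      have uv: "(u, v) \<in> E'" "v \<noteq> h u" using that by (auto simp: factor_def)
      show ?thesis
      proof (cases "(u, v) \<in> {(x1, p), (p, x1), (x2, q), (q, x2)}")
        case True
        then show ?thesis using e rtrancl_sym[OF sR] by auto
      next
        case False
        then have o: "(u, v) \<in> E" "u \<notin> {x3, x4}" "v \<notin> {x3, x4}" using uv(1) by (auto simp: E'_iff)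
        moreover have "\<not> (u \<in> ?sq \<and> v \<in> ?sq)" using o uv(2) hx hx' bipE[of x1 x1] bipE[of x2 x2] by auto
        ultimately have "(u, v) \<in> F" using uv(2) by (auto simp: F_def)
        then show ?thesis using kF by auto
      qed
    qed
  qed
  have F1: "F \<subseteq> factor E (expand_12 h)" and F2: "F \<subseteq> factor E (expand_14 h)"
    using distinct6 by (auto simp: F_def factor_def expand_12_def expand_14_def split: if_splits)
  have s1: "(x1, x4) \<in> factor E (expand_12 h)" "(x2, x3) \<in> factor E (expand_12 h)"
    "(x4, x1) \<in> factor E (expand_12 h)"
    and s2: "(x1, x2) \<in> factor E (expand_14 h)" "(x3, x4) \<in> factor E (expand_14 h)"
    "(x2, x1) \<in> factor E (expand_14 h)" "(x4, x3) \<in> factor E (expand_14 h)"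
    using edges distinct6 by (auto simp: factor_def expand_12_def expand_14_def)
  have F1': "(u, v) \<in> F\<^sup>* \<Longrightarrow> (u, v) \<in> (factor E (expand_12 h))\<^sup>*"
    and F2': "(u, v) \<in> F\<^sup>* \<Longrightarrow> (u, v) \<in> (factor E (expand_14 h))\<^sup>*" for u v
    using rtrancl_mono[OF F1] rtrancl_mono[OF F2] by blast+
  note sy1 = rtrancl_sym[OF sym_factor[OF symE p1]] and sy2 = rtrancl_sym[OF sym_factor[OF symE p2]]
  from other[of x1] consider "(x1, x2) \<in> F\<^sup>*" | "(x1, x4) \<in> F\<^sup>*" | "(x1, x3) \<in> F\<^sup>*" "(x1, x2) \<notin> F\<^sup>*" "(x1, x4) \<notin> F\<^sup>*"
    by auto
  then show "card (comps (Domain E) (factor E (expand_12 h))) \<le> card (comps (Domain E') (factor E' h)) \<or>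
     card (comps (Domain E) (factor E (expand_14 h))) \<le> card (comps (Domain E') (factor E' h))"
  proof cases
    case 1
    let ?R = "factor E (expand_12 h)"
    have "(x1, x2) \<in> ?R\<^sup>*" using F1' 1 by blast
    then have "(x1, x3) \<in> ?R\<^sup>*" "(x2, x4) \<in> ?R\<^sup>*"
      using s1 sy1 by (meson r_into_rtrancl rtrancl_trans)+
    then show ?thesis using main[OF p1 F1] by blast
  next
    case 2
    let ?R = "factor E (expand_14 h)"
    have "(x1, x4) \<in> ?R\<^sup>*" using F2' 2 by blast
    then have "(x1, x3) \<in> ?R\<^sup>*" "(x2, x4) \<in> ?R\<^sup>*"
      using s2 sy2 by (meson r_into_rtrancl rtrancl_trans)+
    then show ?thesis using main[OF p2 F2] by blast
  next
    \<comment> \<open>\<open>x2\<close> can be linked neither to \<open>x1\<close> nor to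
      \<open>x3\<close>, so parity links it to \<open>x4\<close>.\<close>
    case 3
    have "(x2, x1) \<notin> F\<^sup>*" using 3 rtrancl_sym[OF symF] by blast
    moreover have "(x2, x3) \<notin> F\<^sup>*" using 3 rtrancl_sym[OF symF] by (meson rtrancl_trans)
    ultimately have "(x2, x4) \<in> F\<^sup>*" using other[of x2] by auto
    then show ?thesis using main[OF p1 F1] F1' 3 by blast
  qed
qed

end

section \<open>Programs with bounded loops\<close>

text \<open>\<open>For k x p\<close> runs \<open>p\<close> with \<open>x = 0, \<dots>, k * n - 1\<close>. Such programs terminate in polynomial time by
  construction, so that only their functional behaviour \<open>run\<close> has to be analysed.\<close>

datatype prog =
    Nop
  | Asg string aexp aexp
  | Sq prog prog (infixr \<open>;;\<close> 60)
  | Ite bexp prog prog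
  | For nat string prog

abbreviation val :: "string \<Rightarrow> aexp" where "val x \<equiv> Cell x (Const 0)"
abbreviation Set :: "string \<Rightarrow> aexp \<Rightarrow> prog" where "Set x a \<equiv> Asg x (Const 0) a"

primrec nmul :: "nat \<Rightarrow> aexp" where
  "nmul 0 = Const 0"
| "nmul (Suc k) = Plus (val ''n'') (nmul k)"

primrec compile :: "prog \<Rightarrow> com" where
  "compile Nop = Skip"
| "compile (Asg x i a) = Assign x i a"
| "compile (p ;; q) = Seq (compile p) (compile q)"
| "compile (Ite b p q) = If b (compile p) (compile q)"
| "compile (For k x p) = Seq (Assign x (Const 0) (Const 0))
     (While (Less (val x) (nmul k)) (Seq (compile p) (Assign x (Const 0) (Plus (val x) (Const 1)))))"

primrec run :: "prog \<Rightarrow> state \<Rightarrow> state" where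
  "run Nop s = s"
| "run (Asg x i a) s = s(x := (s x)(aval i s := aval a s))"
| "run (p ;; q) s = run q (run p s)"
| "run (Ite b p q) s = (if bval b s then run p s else run q s)"
| "run (For k x p) s = ((\<lambda>s. (run p s)(x := (run p s x)(0 := Suc (run p s x 0)))) ^^ (k * s ''n'' 0)) (s(x := (s x)(0 := 0)))"

declare run.simps(5) [simp del]

primrec wr :: "prog \<Rightarrow> string set" where
  "wr Nop = {}"
| "wr (Asg x i a) = {x}"
| "wr (p ;; q) = wr p \<union> wr q"
| "wr (Ite b p q) = wr p \<union> wr q"
| "wr (For k x p) = insert x (wr p)"

text \<open>A body that writes neither \<open>n\<close> nor its own counter fixes the number of
  rounds at loop entry.\<close>

primrec ok :: "prog \<Rightarrow> bool" where
  "ok Nop \<longleftrightarrow> True"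
| "ok (Asg x i a) \<longleftrightarrow> x \<noteq> ''n''"
| "ok (p ;; q) \<longleftrightarrow> ok p \<and> ok q"
| "ok (Ite b p q) \<longleftrightarrow> ok p \<and> ok q"
| "ok (For k x p) \<longleftrightarrow> x \<noteq> ''n'' \<and> x \<notin> wr p \<and> ok p"

text \<open>\<open>[:0, k:]\<close> is the polynomial \<open>k * n\<close>. Each round also pays for
  its test and the increment; the leading 2 pays for initialisation and the final test. Adding both
  branches of a conditional bounds the more expensive one.\<close>

primrec cost :: "prog \<Rightarrow> nat poly" where
  "cost Nop = 1"
| "cost (Asg x i a) = 1"
| "cost (p ;; q) = cost p + cost q"
| "cost (Ite b p q) = 1 + cost p + cost q"
| "cost (For k x p) = 2 + [:0, k:] * (cost p + 2)"

lemma run_frame: "y \<notin> wr p \<Longrightarrow> run p s y = s y"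
proof (induction p arbitrary: s)
  case (For k x p)
  have "((\<lambda>s. (run p s)(x := (run p s x)(0 := Suc (run p s x 0)))) ^^ m) r y = r y" for m r
    using For by (induction m arbitrary: r) (auto simp: funpow_swap1)
  then show ?case using For by (simp add: run.simps(5))
qed auto

lemma ok_n: "ok p \<Longrightarrow> ''n'' \<notin> wr p"
  by (induction p) auto

lemma run_n [simp]: "ok p \<Longrightarrow> run p s ''n'' = s ''n''"
  by (simp add: run_frame ok_n)

lemma aval_nmul [simp]: "aval (nmul k) s = k * s ''n'' 0"
  by (induction k) auto

lemma exec_compile:
  "ok p \<Longrightarrow> \<exists>t \<le> poly (cost p) (s ''n'' 0). exec (compile p) s t (run p s)"
proof (induction p arbitrary: s)
  case Nop
  show ?case using exec_Skip[of s] by (intro exI[of _ 1] conjI) simp_all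
next
  case (Asg x i a)
  show ?case using exec_Assign[of x i a s] unfolding compile.simps run.simps cost.simps poly_1
    by (metis order_refl)
next
  case (Sq p q)
  then obtain t1 where t1: "t1 \<le> poly (cost p) (s ''n'' 0)" "exec (compile p) s t1 (run p s)" by fastforce
  from Sq obtain t2 where t2: "t2 \<le> poly (cost q) (s ''n'' 0)" "exec (compile q) (run p s) t2 (run q (run p s))"
    using run_n[of p s] by (metis ok.simps(3))
  show ?case using exec_Seq[OF t1(2) t2(2)] t1(1) t2(1) by (auto intro!: exI[of _ "t1 + t2"])
next
  case (Ite b p q)
  show ?case
  proof (cases "bval b s")
    case True
    obtain t where "t \<le> poly (cost p) (s ''n'' 0)" "exec (compile p) s t (run p s)" using Ite by fastforce
    then show ?thesis using True by (auto intro!: exI[of _ "Suc t"] exec_IfTrue)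
  next
    case False
    obtain t where "t \<le> poly (cost q) (s ''n'' 0)" "exec (compile q) s t (run q s)" using Ite by fastforce
    then show ?thesis using False by (auto intro!: exI[of _ "Suc t"] exec_IfFalse)
  qed
next
  case (For k x p)
  let ?B = "\<lambda>s. (run p s)(x := (run p s x)(0 := Suc (run p s x 0)))"
  let ?W = "While (Less (val x) (nmul k)) (Seq (compile p) (Assign x (Const 0) (Plus (val x) (Const 1))))"
  define N where "N = s ''n'' 0"
  define C where "C = poly (cost p) N"
  \<comment> \<open>The induction is over the number \<open>m\<close> of rounds still to be run,
    which the counter determines.\<close>
  have *: "\<exists>t \<le> m * (C + 2) + 1. exec ?W r t ((?B ^^ m) r)" if "r ''n'' 0 = N" "r x 0 + m = k * N" for m r
    using that
  proof (induction m arbitrary: r)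
    case 0
    then show ?case by (auto intro!: exI[of _ 1] exec_WhileFalse)
  next
    case (Suc m)
    obtain t where t: "t \<le> C" "exec (compile p) r t (run p r)"
      using For.IH For.prems Suc.prems(1) by (metis C_def ok.simps(5))
    have x: "run p r x = r x" using For.prems by (simp add: run_frame)
    have e: "exec (Seq (compile p) (Assign x (Const 0) (Plus (val x) (Const 1)))) r (t + 1) (?B r)"
      using exec_Seq[OF t(2) exec_Assign[of x "Const 0" "Plus (val x) (Const 1)"]] by simp
    have "''n'' \<noteq> x" using For.prems by auto
    then have "(?B r) ''n'' 0 = N" using For.prems Suc.prems(1) by simp
    moreover have "(?B r) x 0 + m = k * N" using Suc.prems(2) x by simp
    ultimately obtain t' where t': "t' \<le> m * (C + 2) + 1" "exec ?W (?B r) t' ((?B ^^ m) (?B r))"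
      using Suc.IH by blast
    have eq: "(?B ^^ Suc m) r = (?B ^^ m) (?B r)" by (simp only: funpow_Suc_right o_apply)
    have "bval (Less (val x) (nmul k)) r" using Suc.prems by simp
    then have "exec ?W r (Suc (t + 1 + t')) ((?B ^^ Suc m) r)"
      unfolding eq by (rule exec_WhileTrue[OF _ e t'(2)])
    moreover have "Suc (t + 1 + t') \<le> Suc m * (C + 2) + 1" using t(1) t'(1) by simp
    ultimately show ?case by blast
  qed
  let ?s = "s(x := (s x)(0 := 0))"
  have "?s ''n'' 0 = N" "?s x 0 + k * N = k * N" using For.prems by (auto simp: N_def)
  then obtain t where t: "t \<le> k * N * (C + 2) + 1" "exec ?W ?s t ((?B ^^ (k * N)) ?s)" using * by blast
  have "exec (compile (For k x p)) s (1 + t) (run (For k x p) s)"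
    using exec_Seq[OF exec_Assign[of x "Const 0" "Const 0" s], of ?W t "(?B ^^ (k * N)) ?s"] t(2)
    by (simp add: N_def run.simps(5))
  moreover have "1 + t \<le> poly (cost (For k x p)) (s ''n'' 0)"
    using t(1) by (simp add: C_def N_def algebra_simps)
  ultimately show ?case by blast
qed

text \<open>Loop invariant rule. The step may assume that arrays outside \<open>wr p\<close> still
  have their values from before the loop, so invariants need not repeat what is untouched.\<close>

lemma run_For:
  assumes ok: "ok (For k x p)" and N: "s ''n'' 0 = N"
    and init: "I 0 (s(x := (s x)(0 := 0)))"
    and step: "\<And>i r. i < k * N \<Longrightarrow> r ''n'' 0 = N \<Longrightarrow> r x 0 = i \<Longrightarrow> (\<And>y. y \<notin> wr p \<Longrightarrow> y \<noteq> x \<Longrightarrow> r y = s y) \<Longrightarrow>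
      I i r \<Longrightarrow> I (Suc i) ((run p r)(x := (run p r x)(0 := Suc i)))"
  shows "I (k * N) (run (For k x p) s)"
proof -
  let ?B = "\<lambda>s. (run p s)(x := (run p s x)(0 := Suc (run p s x 0)))"
  let ?s = "s(x := (s x)(0 := 0))"
  have "I m ((?B ^^ m) ?s) \<and> ((?B ^^ m) ?s) ''n'' 0 = N \<and> ((?B ^^ m) ?s) x 0 = m \<and>
      (\<forall>y. y \<notin> wr p \<longrightarrow> y \<noteq> x \<longrightarrow> ((?B ^^ m) ?s) y = s y)" if "m \<le> k * N" for m
    using that
  proof (induction m)
    case 0
    have "''n'' \<noteq> x" using ok by auto
    then have "?s ''n'' 0 = N" "?s x 0 = 0" "\<forall>y. y \<notin> wr p \<longrightarrow> y \<noteq> x \<longrightarrow> ?s y = s y" using N by auto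
    then show ?case unfolding funpow_0 using init by blast
  next
    case (Suc m)
    define r where "r = (?B ^^ m) ?s"
    have r: "I m r" "r ''n'' 0 = N" "r x 0 = m" "\<And>y. y \<notin> wr p \<Longrightarrow> y \<noteq> x \<Longrightarrow> r y = s y"
      using Suc unfolding r_def by (blast dest: Suc_leD)+
    have nx: "''n'' \<noteq> x" and x: "run p r x 0 = m" using ok r(3) by (auto simp: run_frame)
    have eq: "(?B ^^ Suc m) ?s = (run p r)(x := (run p r x)(0 := Suc m))" using x by (simp add: r_def)
    let ?q = "(run p r)(x := (run p r x)(0 := Suc m))"
    have "I (Suc m) ?q" using Suc.prems by (intro step r) auto
    moreover have "?q ''n'' 0 = N" "?q x 0 = Suc m" "\<forall>y. y \<notin> wr p \<longrightarrow> y \<noteq> x \<longrightarrow> ?q y = s y"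
      using ok r(2,4) nx by (auto simp: run_frame)
    ultimately show ?case unfolding eq by blast
  qed
  then show ?thesis using N by (simp add: run.simps(5))
qed

section \<open>Components by label propagation\<close>

text \<open>The three colours live in arrays named \<open>c\<close>, \<open>cc\<close>,
  \<open>ccc\<close>. With unary names, inequality with a literal name is decided by
  rewriting.\<close>

definition cn :: "nat \<Rightarrow> string" where
  "cn k = CHR ''c'' # replicate k (CHR ''c'')"

lemma cn_eq_Cons [simp]: "cn k = a # w \<longleftrightarrow> a = CHR ''c'' \<and> w = replicate k (CHR ''c'')"
  "a # w = cn k \<longleftrightarrow> a = CHR ''c'' \<and> w = replicate k (CHR ''c'')"
  by (auto simp: cn_def)

lemma cn_inj [simp]: "cn j = cn k \<longleftrightarrow> j = k"
  by (simp add: cn_def)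

text \<open>The factor graph as the program sees it, \<open>h\<close> being the removed matching. A
  colour missing at \<open>v\<close> may contribute the loop at \<open>v\<close>, which does not
  affect reachability.\<close>

definition crel :: "nat \<Rightarrow> (nat \<Rightarrow> nat \<Rightarrow> nat) \<Rightarrow> (nat \<Rightarrow> nat) \<Rightarrow> nat rel" where
  "crel N c h = {(v, w). v < N \<and> (\<exists>k<3. w = c k v) \<and> w \<noteq> h v}"

definition relax :: "nat \<Rightarrow> prog" where
  "relax k = Ite (And (Not (Eq (Cell (cn k) (val ''i'')) (Cell ''h'' (val ''i''))))
                      (Less (Cell ''l'' (Cell (cn k) (val ''i''))) (Cell ''l'' (val ''i''))))
     (Asg ''l'' (val ''i'') (Cell ''l'' (Cell (cn k) (val ''i'')))) Nop"

text \<open>Labels decrease to the least vertex of each class, so the vertices labelled by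
  themselves represent the classes. \<open>3 * n\<close> rounds suffice because \<open>crel\<close>
  has at most that many pairs, and the number of pairs bounds the length of a shortest path.\<close>

definition count :: prog where
  "count = For 1 ''i'' (Asg ''l'' (val ''i'') (val ''i'')) ;;
     For 3 ''j'' (For 1 ''i'' (relax 0 ;; relax 1 ;; relax 2)) ;;
     Set ''z'' (Const 0) ;;
     For 1 ''i'' (Ite (Eq (Cell ''l'' (val ''i'')) (val ''i'')) (Set ''z'' (Plus (val ''z'') (Const 1))) Nop)"

lemma wr_relax [simp]: "wr (relax k) = {''l''}" and ok_relax [simp]: "ok (relax k)"
  by (auto simp: relax_def)

lemma wr_count [simp]: "wr count = {''i'', ''j'', ''l'', ''z''}" and ok_count [simp]: "ok count"
  by (auto simp: count_def)

definition relaxl :: "(nat \<Rightarrow> nat) \<Rightarrow> (nat \<Rightarrow> nat) \<Rightarrow> nat \<Rightarrow> (nat \<Rightarrow> nat) \<Rightarrow> nat \<Rightarrow> nat" where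
  "relaxl c h i l = (if c i \<noteq> h i \<and> l (c i) < l i then l(i := l (c i)) else l)"

lemma run_relax: "run (relax k) s = s(''l'' := relaxl (s (cn k)) (s ''h'') (s ''i'' 0) (s ''l''))"
  by (auto simp: relax_def relaxl_def)

text \<open>Updating in place is harmless since labels only decrease: bounds in terms of the labels
  before the update stay valid.\<close>

lemma relax3:
  fixes c :: "nat \<Rightarrow> nat \<Rightarrow> nat" and N :: nat and h :: "nat \<Rightarrow> nat"
  defines "R \<equiv> crel N c h"
  assumes i: "i < N" and l: "\<forall>v<N. (v, l v) \<in> R\<^sup>*"
    and l': "l' = relaxl (c 2) h i (relaxl (c 1) h i (relaxl (c 0) h i l))"
    and cN: "\<forall>k<3. c k i < N"
  shows "\<And>v. v < N \<Longrightarrow> (v, l' v) \<in> R\<^sup>*" "\<And>v. l' v \<le> l v" "\<And>w. (i, w) \<in> R \<Longrightarrow> l' i \<le> l w"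
proof -
  have step: "(\<forall>v. v < N \<longrightarrow> (v, relaxl (c k) h i m v) \<in> R\<^sup>*) \<and> (\<forall>v. relaxl (c k) h i m v \<le> m v) \<and>
      (c k i \<noteq> h i \<longrightarrow> relaxl (c k) h i m i \<le> m (c k i))"
    if m: "\<forall>v. v < N \<longrightarrow> (v, m v) \<in> R\<^sup>*" and "k < 3" for m k
  proof -
    have "(i, m (c k i)) \<in> R\<^sup>*" if "c k i \<noteq> h i"
    proof -
      have "(i, c k i) \<in> R" unfolding R_def crel_def using i that \<open>k < 3\<close> by blast
      moreover have "(c k i, m (c k i)) \<in> R\<^sup>*" using m cN \<open>k < 3\<close> by blast
      ultimately show ?thesis by (rule converse_rtrancl_into_rtrancl)
    qed
    then show ?thesis using m i by (auto simp: relaxl_def)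
  qed
  define m1 where "m1 = relaxl (c 0) h i l"
  define m2 where "m2 = relaxl (c 1) h i m1"
  have s0: "(\<forall>v. v < N \<longrightarrow> (v, m1 v) \<in> R\<^sup>*) \<and> (\<forall>v. m1 v \<le> l v) \<and> (c 0 i \<noteq> h i \<longrightarrow> m1 i \<le> l (c 0 i))"
    unfolding m1_def by (rule step) (use l in auto)
  have s1: "(\<forall>v. v < N \<longrightarrow> (v, m2 v) \<in> R\<^sup>*) \<and> (\<forall>v. m2 v \<le> m1 v) \<and> (c 1 i \<noteq> h i \<longrightarrow> m2 i \<le> m1 (c 1 i))"
    unfolding m2_def by (rule step) (use s0 in auto)
  have s2: "(\<forall>v. v < N \<longrightarrow> (v, l' v) \<in> R\<^sup>*) \<and> (\<forall>v. l' v \<le> m2 v) \<and> (c 2 i \<noteq> h i \<longrightarrow> l' i \<le> m2 (c 2 i))"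
    unfolding l' m1_def[symmetric] m2_def[symmetric] by (rule step) (use s1 in auto)
  show "\<And>v. v < N \<Longrightarrow> (v, l' v) \<in> R\<^sup>*" using s2 by blast
  show "\<And>v. l' v \<le> l v" using s0 s1 s2 by (meson le_trans)
  show "l' i \<le> l w" if w: "(i, w) \<in> R" for w
  proof -
    obtain k where k: "k < 3" "w = c k i" "c k i \<noteq> h i" using w unfolding R_def crel_def by blast
    then have "k = 0 \<or> k = 1 \<or> k = 2" by auto
    then show ?thesis using k(2,3) s0 s1 s2 by (metis le_trans)
  qed
qed

lemma card_crel_le: "card (crel N c h) \<le> 3 * N" and finite_crel [simp]: "finite (crel N c h)"
proof -
  have sub: "crel N c h \<subseteq> (\<lambda>(v, k). (v, c k v)) ` ({..<N} \<times> {..<3})" by (auto simp: crel_def)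
  show "finite (crel N c h)" using sub by (rule finite_subset) simp
  have "card (crel N c h) \<le> card ({..<N} \<times> {..<3::nat})"
    using card_mono[OF _ sub] card_image_le[of "{..<N} \<times> {..<3::nat}" "\<lambda>(v, k). (v, c k v)"] by fastforce
  then show "card (crel N c h) \<le> 3 * N" by simp
qed

lemma count_correct:
  fixes s :: state
  defines "N \<equiv> s ''n'' 0" and "R \<equiv> crel (s ''n'' 0) (\<lambda>k. s (cn k)) (s ''h'')"
  assumes sym: "sym R" and cN: "\<And>k v. k < 3 \<Longrightarrow> v < N \<Longrightarrow> s (cn k) v < N"
  shows "run count s ''z'' 0 = card (comps {..<N} R)"
    "\<And>u v. u < N \<Longrightarrow> v < N \<Longrightarrow> run count s ''l'' u = run count s ''l'' v \<longleftrightarrow> (u, v) \<in> R\<^sup>*"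
proof -
  let ?p1 = "For 1 ''i'' (Asg ''l'' (val ''i'') (val ''i''))"
  let ?p2 = "For 3 ''j'' (For 1 ''i'' (relax 0 ;; relax 1 ;; relax 2))"
  let ?p3 = "For 1 ''i'' (Ite (Eq (Cell ''l'' (val ''i'')) (val ''i'')) (Set ''z'' (Plus (val ''z'') (Const 1))) Nop)"
  define s1 where "s1 = run ?p1 s"
  define s2 where "s2 = run ?p2 s1"
  define s3 where "s3 = run (Set ''z'' (Const 0)) s2"
  have run: "run count s = run ?p3 s3" by (simp add: count_def s1_def s2_def s3_def)
  have "\<forall>v < 1 * N. run ?p1 s ''l'' v = v"
    by (rule run_For[where I = "\<lambda>i r. \<forall>v < i. r ''l'' v = v"]) (auto simp: N_def)
  then have l1: "\<forall>v < N. s1 ''l'' v = v" by (simp add: s1_def)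
  have f1: "s1 y = s y" if "y \<notin> {''i'', ''l''}" for y using that unfolding s1_def by (simp add: run_frame)
  \<comment> \<open>After \<open>j\<close> rounds a label is at most every vertex reachable in at
    most \<open>j\<close> steps, while it never leaves its class.\<close>
  let ?I = "\<lambda>j r. (\<forall>v<N. (v, r ''l'' v) \<in> R\<^sup>*) \<and> (\<forall>m\<le>j. \<forall>v w. v < N \<longrightarrow> (v, w) \<in> R ^^ m \<longrightarrow> r ''l'' v \<le> w)"
  have RN: "w < N" if "(v, w) \<in> R" for v w using that cN unfolding R_def crel_def N_def by blast
  have "?I (3 * N) (run ?p2 s1)"
  proof (rule run_For[where I = ?I])
    show "ok ?p2" by simp
    show "s1 ''n'' 0 = N" using f1 by (simp add: N_def)
    show "?I 0 (s1(''j'' := (s1 ''j'')(0 := 0)))" using l1 by auto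
    fix j r assume r: "r ''n'' 0 = N" "\<And>y. y \<notin> wr (For 1 ''i'' (relax 0;; relax 1;; relax 2)) \<Longrightarrow> y \<noteq> ''j'' \<Longrightarrow> r y = s1 y" "?I j r"
    have rf: "r y = s y" if "y \<notin> {''i'', ''j'', ''l''}" for y using that r(2)[of y] f1[of y] by auto
    \<comment> \<open>Within a round, labels are compared with those at its start, in
      \<open>r\<close>, although some neighbours have been updated already.\<close>
    let ?J = "\<lambda>i q. (\<forall>v<N. (v, q ''l'' v) \<in> R\<^sup>*) \<and> (\<forall>v. q ''l'' v \<le> r ''l'' v) \<and>
      (\<forall>v<i. \<forall>w. (v, w) \<in> R \<longrightarrow> q ''l'' v \<le> r ''l'' w)"
    let ?b = "relax 0;; relax 1;; relax 2"
    have J: "?J (1 * N) (run (For 1 ''i'' ?b) r)"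
    proof (rule run_For[where I = ?J])
      show "?J 0 (r(''i'' := (r ''i'')(0 := 0)))" using r(3) by auto
      fix i q assume q: "i < 1 * N" "q ''i'' 0 = i" "\<And>y. y \<notin> wr ?b \<Longrightarrow> y \<noteq> ''i'' \<Longrightarrow> q y = r y" "?J i q"
      have c: "q (cn k) = s (cn k)" "q ''h'' = s ''h''" for k
        using q(3)[of "cn k"] q(3)[of "''h''"] rf by auto
      have e: "run ?b q ''l'' = relaxl (s (cn 2)) (s ''h'') i (relaxl (s (cn 1)) (s ''h'') i (relaxl (s (cn 0)) (s ''h'') i (q ''l'')))"
        using q(2) by (simp add: run_relax c)
      have i: "i < s ''n'' 0" using q(1) by (simp add: N_def)
      have l: "\<forall>v < s ''n'' 0. (v, q ''l'' v) \<in> (crel (s ''n'' 0) (\<lambda>k. s (cn k)) (s ''h''))\<^sup>*"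
        using q(4) unfolding R_def N_def by blast
      have cc: "\<forall>k<3. s (cn k) i < s ''n'' 0" using cN q(1) by (auto simp: N_def)
      note R3 = relax3[OF i l e cc, folded R_def N_def]
      have "?J (Suc i) (run ?b q)"
      proof (intro conjI allI impI)
        show "(v, run ?b q ''l'' v) \<in> R\<^sup>*" if "v < N" for v using R3(1)[OF that] .
        show le: "run ?b q ''l'' v \<le> r ''l'' v" for v using R3(2)[of v] q(4) le_trans by blast
        show "run ?b q ''l'' v \<le> r ''l'' w" if "v < Suc i" "(v, w) \<in> R" for v w
        proof (cases "v = i")
          case True
          then show ?thesis using R3(3)[of w] that(2) q(4) le_trans by blast
        next
          case False
          then have "v < i" using that(1) by simp
          then have "q ''l'' v \<le> r ''l'' w" using q(4) that(2) by blast
          then show ?thesis using R3(2)[of v] by linarith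
        qed
      qed
      then show "?J (Suc i) ((run ?b q)(''i'' := (run ?b q ''i'')(0 := Suc i)))" by simp
    qed (use r in auto)
    define q where "q = run (For 1 ''i'' ?b) r"
    have J1: "(v, q ''l'' v) \<in> R\<^sup>*" if "v < N" for v using J that unfolding q_def by blast
    have J2: "q ''l'' v \<le> r ''l'' v" for v using J unfolding q_def by blast
    have J3: "q ''l'' v \<le> r ''l'' w" if "v < N" "(v, w) \<in> R" for v w
      using J that unfolding q_def by (simp only: nat_mult_1)
    have r3: "r ''l'' v \<le> w" if "m \<le> j" "v < N" "(v, w) \<in> R ^^ m" for m v w using r(3) that by blast
    have "?I (Suc j) q"
    proof (intro conjI allI impI)
      show "(v, q ''l'' v) \<in> R\<^sup>*" if "v < N" for v using J1 that .
      fix m v w assume m: "m \<le> Suc j" and v: "v < N" and vw: "(v, w) \<in> R ^^ m"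
      show "q ''l'' v \<le> w"
      proof (cases m)
        case 0
        then show ?thesis using vw J2[of v] r3[of 0 v v] v by simp
      next
        case (Suc m')
        then obtain u where u: "(v, u) \<in> R" "(u, w) \<in> R ^^ m'" using vw by (meson relpow_Suc_D2)
        then have "q ''l'' v \<le> r ''l'' u" using J3 v by blast
        also have "\<dots> \<le> w" by (rule r3[of m']) (use u RN m Suc in auto)
        finally show ?thesis .
      qed
    qed
    then show "?I (Suc j) ((run (For 1 ''i'' ?b) r)(''j'' := (run (For 1 ''i'' ?b) r ''j'')(0 := Suc j)))"
      unfolding q_def by simp
  qed
  then have I: "?I (3 * N) s2" by (simp only: s2_def)
  have le: "s2 ''l'' v \<le> w" if "v < N" "(v, w) \<in> R\<^sup>*" for v w
  proof -
    have fin: "finite R" by (simp add: R_def)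
    have "(v, w) \<in> (\<Union>n\<in>{n. n \<le> card R}. R ^^ n)" using that(2) rtrancl_finite_eq_relpow[OF fin] by simp
    then obtain m where "m \<le> card R" "(v, w) \<in> R ^^ m" by auto
    moreover have "card R \<le> 3 * N" unfolding R_def N_def by (rule card_crel_le)
    ultimately show ?thesis using I that(1) by (meson le_trans)
  qed
  have RsN: "w < N" if "(v, w) \<in> R\<^sup>*" "v < N" for v w using that by (cases rule: rtranclE) (auto intro: RN)
  have reach: "(v, s2 ''l'' v) \<in> R\<^sup>*" if "v < N" for v using I that by blast
  have iff: "s2 ''l'' u = s2 ''l'' v \<longleftrightarrow> (u, v) \<in> R\<^sup>*" if uv: "u < N" "v < N" for u v
  proof
    assume "s2 ''l'' u = s2 ''l'' v"
    then show "(u, v) \<in> R\<^sup>*" using reach uv rtrancl_sym[OF sym] by (metis rtrancl_trans)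
  next
    assume e: "(u, v) \<in> R\<^sup>*"
    have "s2 ''l'' u \<le> s2 ''l'' v" using le[OF uv(1)] e reach[OF uv(2)] by (meson rtrancl_trans)
    moreover have "s2 ''l'' v \<le> s2 ''l'' u"
      using le[OF uv(2)] rtrancl_sym[OF sym e] reach[OF uv(1)] by (meson rtrancl_trans)
    ultimately show "s2 ''l'' u = s2 ''l'' v" by simp
  qed
  have l3: "run count s ''l'' = s2 ''l''" unfolding run by (simp add: run_frame s3_def)
  then show "\<And>u v. u < N \<Longrightarrow> v < N \<Longrightarrow> run count s ''l'' u = run count s ''l'' v \<longleftrightarrow> (u, v) \<in> R\<^sup>*"
    using iff by simp
  have n3: "s3 ''n'' 0 = N" by (simp add: s3_def s2_def f1 N_def)
  have "run ?p3 s3 ''z'' 0 = card {v. v < 1 * N \<and> s2 ''l'' v = v}"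
  proof (rule run_For[where I = "\<lambda>i r. r ''z'' 0 = card {v. v < i \<and> s2 ''l'' v = v}"])
    show "ok ?p3" by simp
    show "s3 ''n'' 0 = N" by (rule n3)
    show "(s3(''i'' := (s3 ''i'')(0 := 0))) ''z'' 0 = card {v. v < 0 \<and> s2 ''l'' v = v}" by (simp add: s3_def)
    fix i r assume r: "r ''i'' 0 = i" "r ''z'' 0 = card {v. v < i \<and> s2 ''l'' v = v}"
      "\<And>y. y \<notin> wr (Ite (Eq (Cell ''l'' (val ''i'')) (val ''i'')) (Set ''z'' (Plus (val ''z'') (Const 1))) Nop) \<Longrightarrow> y \<noteq> ''i'' \<Longrightarrow> r y = s3 y"
    have l: "r ''l'' = s2 ''l''" using r(3)[of "''l''"] by (simp add: s3_def)
    have "{v. v < Suc i \<and> s2 ''l'' v = v} = (if s2 ''l'' i = i then insert i {v. v < i \<and> s2 ''l'' v = v} else {v. v < i \<and> s2 ''l'' v = v})"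
      by (auto simp: less_Suc_eq)
    then show "((run (Ite (Eq (Cell ''l'' (val ''i'')) (val ''i'')) (Set ''z'' (Plus (val ''z'') (Const 1))) Nop) r)
        (''i'' := (run (Ite (Eq (Cell ''l'' (val ''i'')) (val ''i'')) (Set ''z'' (Plus (val ''z'') (Const 1))) Nop) r ''i'')(0 := Suc i))) ''z'' 0
        = card {v. v < Suc i \<and> s2 ''l'' v = v}"
      using r l by simp
  qed
  also have "card {v. v < 1 * N \<and> s2 ''l'' v = v} = card (comps {..<N} R)"
  proof (rule bij_betw_same_card[of "\<lambda>v. R\<^sup>* `` {v}"], rule bij_betw_imageI)
    show "inj_on (\<lambda>v. R\<^sup>* `` {v}) {v. v < 1 * N \<and> s2 ''l'' v = v}"
    proof (rule inj_onI)
      fix u v assume "u \<in> {v. v < 1 * N \<and> s2 ''l'' v = v}" "v \<in> {v. v < 1 * N \<and> s2 ''l'' v = v}" "R\<^sup>* `` {u} = R\<^sup>* `` {v}"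
      then show "u = v" using iff comp_eq_iff[OF sym] by fastforce
    qed
    show "(\<lambda>v. R\<^sup>* `` {v}) ` {v. v < 1 * N \<and> s2 ''l'' v = v} = comps {..<N} R"
    proof
      show "(\<lambda>v. R\<^sup>* `` {v}) ` {v. v < 1 * N \<and> s2 ''l'' v = v} \<subseteq> comps {..<N} R" by (auto simp: comps_def)
      show "comps {..<N} R \<subseteq> (\<lambda>v. R\<^sup>* `` {v}) ` {v. v < 1 * N \<and> s2 ''l'' v = v}"
      proof
        fix K assume "K \<in> comps {..<N} R"
        then obtain u where u: "u < N" "K = R\<^sup>* `` {u}" by (auto simp: comps_def)
        have r: "(u, s2 ''l'' u) \<in> R\<^sup>*" "s2 ''l'' u < N" using reach u RsN by auto
        then have "s2 ''l'' (s2 ''l'' u) = s2 ''l'' u" using iff u by metis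
        moreover have "K = R\<^sup>* `` {s2 ''l'' u}" using u r comp_eq_iff[OF sym] by metis
        ultimately show "K \<in> (\<lambda>v. R\<^sup>* `` {v}) ` {v. v < 1 * N \<and> s2 ''l'' v = v}" using r by auto
      qed
    qed
  qed
  finally show "run count s ''z'' 0 = card (comps {..<N} R)" unfolding run .
qed

section \<open>Maintaining a proper edge colouring\<close>

text \<open>A colour class is stored as an involution whose fixed points are the vertices that it misses.\<close>

definition col :: "state \<Rightarrow> nat \<Rightarrow> nat \<Rightarrow> nat" where
  "col s k v = (if v < s ''n'' 0 then s (cn k) v else v)"

text \<open>The colouring is partial: two colours may agree at a vertex only where both are missing.
  Being the identity from \<open>N\<close> on makes the maps involutions of the whole type.\<close>

definition pcol :: "nat \<Rightarrow> nat set \<Rightarrow> (nat \<Rightarrow> nat \<Rightarrow> nat) \<Rightarrow> bool" where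
  "pcol N A c \<longleftrightarrow> (\<forall>k<3. \<forall>v. c k (c k v) = v) \<and> (\<forall>k<3. \<forall>v\<ge>N. c k v = v) \<and>
     (\<forall>k<3. \<forall>v. c k v \<noteq> v \<longrightarrow> (c k v \<in> A \<longleftrightarrow> v \<notin> A)) \<and>
     (\<forall>j<3. \<forall>k<3. \<forall>v. j \<noteq> k \<longrightarrow> c j v = c k v \<longrightarrow> c k v = v)"

definition cedges :: "(nat \<Rightarrow> nat \<Rightarrow> nat) \<Rightarrow> nat rel" where
  "cedges c = {(v, c k v) |v k. k < 3 \<and> c k v \<noteq> v}"

lemma pcolD:
  assumes "pcol N A c"
  shows "k < 3 \<Longrightarrow> c k (c k v) = v" "k < 3 \<Longrightarrow> N \<le> v \<Longrightarrow> c k v = v"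
    "k < 3 \<Longrightarrow> c k v \<noteq> v \<Longrightarrow> c k v \<in> A \<longleftrightarrow> v \<notin> A"
    "j < 3 \<Longrightarrow> k < 3 \<Longrightarrow> j \<noteq> k \<Longrightarrow> c j v = c k v \<Longrightarrow> c k v = v"
    "k < 3 \<Longrightarrow> v < N \<Longrightarrow> c k v < N"
  using assms unfolding pcol_def by (blast, blast, blast, blast, metis not_le)

lemma cedges_iff: "(u, v) \<in> cedges c \<longleftrightarrow> (\<exists>k<3. c k u = v \<and> u \<noteq> v)"
  by (auto simp: cedges_def)

lemma sym_cedges: "pcol N A c \<Longrightarrow> sym (cedges c)"
  by (rule symI) (metis cedges_iff pcolD(1))

lemma cedges_bound:
  assumes "pcol N A c"
  shows "cedges c \<subseteq> {..<N} \<times> {..<N}"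
proof (rule subrelI)
  fix u v assume "(u, v) \<in> cedges c"
  then obtain k where k: "k < 3" "c k u = v" "u \<noteq> v" by (auto simp: cedges_iff)
  have "u < N" using pcolD(2)[OF assms k(1), of u] k by (cases "N \<le> u") auto
  then show "(u, v) \<in> {..<N} \<times> {..<N}" using pcolD(5)[OF assms k(1), of u] k by simp
qed

lemma finite_cedges: "pcol N A c \<Longrightarrow> finite (cedges c)"
  by (rule finite_subset[OF cedges_bound]) auto

lemma sym_crel:
  assumes c: "pcol N A c" and h: "\<And>v. v \<in> Domain (cedges c) \<Longrightarrow> h (h v) = v"
  shows "sym (crel N c h)"
proof (rule symI)
  fix v w assume "(v, w) \<in> crel N c h"
  then obtain k where k: "k < 3" "w = c k v" "w \<noteq> h v" "v < N" by (auto simp: crel_def)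
  have wv: "c k w = v" "w < N" using k pcolD(1,5)[OF c] by auto
  show "(w, v) \<in> crel N c h"
  proof (cases "w = v")
    case True
    then show ?thesis using k wv by (auto simp: crel_def intro!: exI[of _ k])
  next
    case False
    then have "w \<in> Domain (cedges c)" using wv k(1) by (auto simp: cedges_iff Domain_iff)
    then have "h w \<noteq> v" using h k(3) by metis
    then show ?thesis using wv k(1) unfolding crel_def by blast
  qed
qed

lemma rtrancl_crel_bound:
  assumes c: "pcol N A c" and uv: "(u, v) \<in> (crel N c h)\<^sup>*" "u < N"
  shows "v < N"
proof -
  have "v \<in> {..<N}"
    by (rule rtrancl_closed[OF uv(1)]) (use uv(2) pcolD(5)[OF c] in \<open>auto simp: crel_def\<close>)
  then show ?thesis by simp
qed

lemma rtrancl_crel: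
  assumes c: "pcol N A c"
  shows "(crel N c h)\<^sup>* = (factor (cedges c) h)\<^sup>*"
proof -
  have "(crel N c h)\<^sup>= = (factor (cedges c) h)\<^sup>="
  proof
    show "(crel N c h)\<^sup>= \<subseteq> (factor (cedges c) h)\<^sup>=" by (auto simp: crel_def factor_def cedges_iff)
    show "(factor (cedges c) h)\<^sup>= \<subseteq> (crel N c h)\<^sup>="
    proof
      fix e assume "e \<in> (factor (cedges c) h)\<^sup>="
      then obtain u v where e: "e = (u, v)" "u = v \<or> (u, v) \<in> cedges c \<and> v \<noteq> h u" by (cases e) (auto simp: factor_def)
      moreover have "u < N" if "(u, v) \<in> cedges c" using that cedges_bound[OF c] by auto
      ultimately show "e \<in> (crel N c h)\<^sup>=" unfolding crel_def by (auto simp: cedges_iff)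
    qed
  qed
  then show ?thesis by (metis rtrancl_reflcl)
qed

definition kempe :: "(nat \<Rightarrow> nat \<Rightarrow> nat) \<Rightarrow> nat \<Rightarrow> nat \<Rightarrow> nat set \<Rightarrow> nat \<Rightarrow> nat \<Rightarrow> nat" where
  "kempe c a b K k v =
     (if v \<in> K then (if k = a then c b v else if k = b then c a v else c k v) else c k v)"

lemma kempe_correct:
  assumes c: "pcol N A c" and ab: "a < 3" "b < 3" "a \<noteq> b"
    and K: "\<And>v. v \<in> K \<Longrightarrow> c a v \<in> K \<and> c b v \<in> K"
  shows "pcol N A (kempe c a b K)" "cedges (kempe c a b K) = cedges c"
proof -
  note D = pcolD[OF c]
  have out: "c a v \<notin> K" "c b v \<notin> K" if "v \<notin> K" for v using that K D(1) ab by metis+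
  show "pcol N A (kempe c a b K)"
    unfolding pcol_def
  proof (intro conjI allI impI)
    fix k v assume k: "k < (3::nat)"
    show "kempe c a b K k (kempe c a b K k v) = v"
      using K[of v] out[of v] D(1) ab k by (auto simp: kempe_def)
    show "kempe c a b K k v = v" if "N \<le> v" using that D(2) ab k by (auto simp: kempe_def)
    show "kempe c a b K k v \<in> A \<longleftrightarrow> v \<notin> A" if "kempe c a b K k v \<noteq> v"
      using that D(3) ab k by (auto simp: kempe_def split: if_splits)
  next
    fix j k v assume jk: "j < (3::nat)" "k < (3::nat)" "j \<noteq> k" "kempe c a b K j v = kempe c a b K k v"
    then show "kempe c a b K k v = v"
      using ab D(4)[of _ _ v] by (auto simp: kempe_def split: if_splits)
  qed
  have "(\<exists>k<3. kempe c a b K k u = v) \<longleftrightarrow> (\<exists>k<3. c k u = v)" for u v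
  proof
    assume "\<exists>k<3. kempe c a b K k u = v"
    then show "\<exists>k<3. c k u = v" using ab by (auto simp: kempe_def split: if_splits)
  next
    assume "\<exists>k<3. c k u = v"
    then obtain k where k: "k < 3" "c k u = v" by blast
    show "\<exists>k<3. kempe c a b K k u = v"
      by (rule exI[of _ "if u \<in> K then if k = a then b else if k = b then a else k else k"])
        (use k ab in \<open>auto simp: kempe_def\<close>)
  qed
  then show "cedges (kempe c a b K) = cedges c" by (auto simp: cedges_iff set_eq_iff)
qed

text \<open>The vertices of the Kempe chain of \<open>v\<close> that lie on the other side of the bipartition are entered
  through an edge of colour \<open>a\<close>.\<close>

inductive_set chain :: "(nat \<Rightarrow> nat) \<Rightarrow> (nat \<Rightarrow> nat) \<Rightarrow> nat set \<Rightarrow> nat \<Rightarrow> nat set"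
  for a b A v where
    start: "v \<in> chain a b A v"
  | stepa: "x \<in> chain a b A v \<Longrightarrow> (x \<in> A \<longleftrightarrow> v \<in> A) \<Longrightarrow> a x \<in> chain a b A v"
  | stepb: "x \<in> chain a b A v \<Longrightarrow> (x \<in> A \<longleftrightarrow> v \<notin> A) \<Longrightarrow> b x \<in> chain a b A v"

text \<open>Koenig's argument. The chain leaves \<open>v\<close>, where \<open>b\<close> is missing,
  along \<open>a\<close>; as the sides alternate, it enters every vertex of the other side along an
  \<open>a\<close>-edge. \<open>u\<close> is on that side and misses \<open>a\<close>, so the chain
  never reaches it.\<close>

lemma kempe_component_avoids:
  assumes c: "pcol N A c" and ab: "a < 3" "b < 3" and d: "d < 3" "d \<noteq> a" "d \<noteq> b"
    and u: "c a u = u" "u \<in> A \<longleftrightarrow> v \<notin> A" and v: "c b v = v"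
    and abd: "{..<3} = {a, b, d}"
  shows "u \<notin> (crel N c (c d))\<^sup>* `` {v}"
proof -
  note D = pcolD[OF c]
  let ?C = "chain (c a) (c b) A v"
  \<comment> \<open>The edge by which a vertex was entered, of colour \<open>a\<close> on the far
    side and \<open>b\<close> on the side of \<open>v\<close>, leads back into the chain. This
    closes the chain under both colours in both directions.\<close>
  have inv: "((y \<in> A \<longleftrightarrow> v \<notin> A) \<longrightarrow> c a y \<noteq> y \<and> c a y \<in> ?C) \<and> ((y \<in> A \<longleftrightarrow> v \<in> A) \<longrightarrow> y = v \<or> c b y \<in> ?C)"
    if "y \<in> ?C" for y
    using that
  proof (induction rule: chain.induct)
    case start
    then show ?case by auto
  next
    case (stepa x)
    then show ?case using D(1,3)[OF ab(1)] by metis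
  next
    case (stepb x)
    then show ?case using D(1,3)[OF ab(2)] by metis
  qed
  have cl: "c a y \<in> ?C" "c b y \<in> ?C" if "y \<in> ?C" for y
    using inv[OF that] that v chain.stepa[OF that] chain.stepb[OF that] by metis+
  have "w \<in> ?C" if "(v, w) \<in> (crel N c (c d))\<^sup>*" for w
    using that chain.start
  proof (rule rtrancl_closed)
    fix x y assume x: "x \<in> ?C" "(x, y) \<in> crel N c (c d)"
    then obtain k where k: "k < 3" "y = c k x" "y \<noteq> c d x" by (auto simp: crel_def)
    then have "k \<in> {a, b, d}" using abd by auto
    then show "y \<in> ?C" using cl[OF x(1)] k by auto
  qed
  moreover have "u \<notin> ?C" using inv u by blast
  ultimately show ?thesis by blast
qed

lemma kempe_component_closed:
  assumes c: "pcol N A c" and d: "d < 3" and k: "k < 3" "k \<noteq> d" and u: "u < N"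
    and v: "v \<in> (crel N c (c d))\<^sup>* `` {u}"
  shows "c k v \<in> (crel N c (c d))\<^sup>* `` {u}"
proof (cases "c k v = c d v")
  case True
  then show ?thesis using pcolD(4)[OF c d k(1)] k(2) v by metis
next
  case False
  moreover have "v < N" using v u rtrancl_crel_bound[OF c, of u v] by simp
  ultimately have "(v, c k v) \<in> crel N c (c d)" using k unfolding crel_def by blast
  then show ?thesis using v by (auto intro: rtrancl_into_rtrancl)
qed

section \<open>Inserting and deleting edges of a coloured graph\<close>

lemma add_edge:
  assumes c: "pcol N A c" and a: "a < 3" and free: "c a u = u" "c a v = v" and uv: "u < N" "v < N"
    and side: "u \<in> A \<longleftrightarrow> v \<notin> A" and new: "(u, v) \<notin> cedges c"
  defines "c' \<equiv> c(a := (c a)(u := v, v := u))"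
  shows "pcol N A c'" "cedges c' = cedges c \<union> {(u, v), (v, u)}"
proof -
  note D = pcolD[OF c]
  have ne: "u \<noteq> v" using side by auto
  have o: "c a w \<noteq> u" "c a w \<noteq> v" if "w \<noteq> u" "w \<noteq> v" for w using that D(1)[OF a] free by metis+
  have nk: "c k u \<noteq> v" "c k v \<noteq> u" if "k < 3" for k
    using that new ne D(1)[OF that] by (metis cedges_iff)+
  show "pcol N A c'"
    unfolding pcol_def
  proof (intro conjI allI impI)
    fix k w assume k: "k < (3::nat)"
    show "c' k (c' k w) = w" using o[of w] D(1)[OF k] ne by (auto simp: c'_def)
    show "c' k w = w" if "N \<le> w" using that D(2)[OF k] uv by (auto simp: c'_def)
    show "c' k w \<in> A \<longleftrightarrow> w \<notin> A" if "c' k w \<noteq> w"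
      using that D(3)[OF k] side by (auto simp: c'_def split: if_splits)
  next
    fix j k w assume jk: "j < (3::nat)" "k < (3::nat)" "j \<noteq> k" "c' j w = c' k w"
    then show "c' k w = w"
      using D(4)[of j k w] nk[of j] nk[of k] by (auto simp: c'_def split: if_splits)
  qed
  have "(\<exists>k<3. c' k x = y \<and> x \<noteq> y) \<longleftrightarrow> (\<exists>k<3. c k x = y \<and> x \<noteq> y) \<or> (x, y) = (u, v) \<or> (x, y) = (v, u)" for x y
  proof
    assume "\<exists>k<3. c' k x = y \<and> x \<noteq> y"
    then show "(\<exists>k<3. c k x = y \<and> x \<noteq> y) \<or> (x, y) = (u, v) \<or> (x, y) = (v, u)"
      by (auto simp: c'_def split: if_splits)
  next
    assume *: "(\<exists>k<3. c k x = y \<and> x \<noteq> y) \<or> (x, y) = (u, v) \<or> (x, y) = (v, u)"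
    show "\<exists>k<3. c' k x = y \<and> x \<noteq> y"
    proof (cases "(x, y) = (u, v) \<or> (x, y) = (v, u)")
      case True
      then show ?thesis using a ne by (intro exI[of _ a]) (auto simp: c'_def)
    next
      case False
      then obtain k where k: "k < 3" "c k x = y" "x \<noteq> y" using * by blast
      then have "k = a \<Longrightarrow> x \<noteq> u \<and> x \<noteq> v" using free by auto
      then show ?thesis using k by (intro exI[of _ k]) (auto simp: c'_def)
    qed
  qed
  then show "cedges c' = cedges c \<union> {(u, v), (v, u)}" unfolding set_eq_iff split_paired_All
    by (simp add: cedges_iff, blast)
qed

lemma free_colour:
  assumes c: "pcol N A c" and deg: "card (cedges c `` {u}) < 3"
  shows "\<exists>a<3. c a u = u"
proof (rule ccontr)
  assume n: "\<not> ?thesis"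
  have inj: "inj_on (\<lambda>k. c k u) {..<3}"
    by (rule inj_onI) (metis n pcolD(4)[OF c] lessThan_iff)
  have "(\<lambda>k. c k u) ` {..<3} \<subseteq> cedges c `` {u}"
  proof (rule image_subsetI)
    fix k :: nat assume "k \<in> {..<3}"
    then have "k < 3" "c k u \<noteq> u" using n by auto
    then have "(u, c k u) \<in> cedges c" using cedges_iff by metis
    then show "c k u \<in> cedges c `` {u}" by simp
  qed
  moreover have "finite (cedges c `` {u})" using finite_cedges[OF c] by (simp add: finite_Image)
  ultimately have "card ((\<lambda>k. c k u) ` {..<3::nat}) \<le> card (cedges c `` {u})" by (metis card_mono)
  then show False using deg card_image[OF inj] by simp
qed

text \<open>With colour \<open>d\<close> as the removed matching, the classes found by
  \<open>count\<close> are the Kempe chains of the two other colours.\<close>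

definition setmate :: "nat \<Rightarrow> prog" where
  "setmate d = For 1 ''i'' (Asg ''h'' (val ''i'') (Cell (cn d) (val ''i'')))"

definition swapc :: "nat \<Rightarrow> nat \<Rightarrow> string \<Rightarrow> prog" where
  "swapc a b x = For 1 ''i'' (Ite (Eq (Cell ''l'' (val ''i'')) (Cell ''l'' (val x)))
     (Set ''t'' (Cell (cn a) (val ''i'')) ;; Asg (cn a) (val ''i'') (Cell (cn b) (val ''i'')) ;;
      Asg (cn b) (val ''i'') (val ''t'')) Nop)"

definition kswap :: "nat \<Rightarrow> nat \<Rightarrow> nat \<Rightarrow> string \<Rightarrow> prog" where
  "kswap a b d x = setmate d ;; count ;; swapc a b x"

lemma wr_setmate [simp]: "wr (setmate d) = {''i'', ''h''}" and ok_setmate [simp]: "ok (setmate d)"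
  by (auto simp: setmate_def)

lemma wr_swapc [simp]: "wr (swapc a b x) = {''i'', ''t'', cn a, cn b}" and ok_swapc [simp]: "ok (swapc a b x)"
  by (auto simp: swapc_def)

lemma wr_kswap [simp]: "wr (kswap a b d x) = {''i'', ''h'', ''j'', ''l'', ''z'', ''t'', cn a, cn b}"
  and ok_kswap [simp]: "ok (kswap a b d x)"
  by (auto simp: kswap_def)

text \<open>Such a name is no scratch variable of the recolouring, so a vertex stored under it
  survives a Kempe swap.\<close>

definition okname :: "string \<Rightarrow> bool" where
  "okname x \<longleftrightarrow> x \<notin> {''n'', ''i'', ''j'', ''l'', ''z'', ''h'', ''t''} \<and> (\<forall>k. x \<noteq> cn k)"

lemma setmate_correct:
  assumes "v < s ''n'' 0"
  shows "run (setmate d) s ''h'' v = s (cn d) v"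
proof -
  have "\<forall>v < 1 * s ''n'' 0. run (setmate d) s ''h'' v = s (cn d) v"
    unfolding setmate_def
  proof (rule run_For[where I = "\<lambda>i r. \<forall>v < i. r ''h'' v = s (cn d) v"])
    fix i r assume r: "r ''i'' 0 = i" "\<forall>v<i. r ''h'' v = s (cn d) v"
      "\<And>y. y \<notin> wr (Asg ''h'' (val ''i'') (Cell (cn d) (val ''i''))) \<Longrightarrow> y \<noteq> ''i'' \<Longrightarrow> r y = s y"
    have "r (cn d) = s (cn d)" by (rule r(3)) auto
    then show "\<forall>v<Suc i. ((run (Asg ''h'' (val ''i'') (Cell (cn d) (val ''i''))) r)(''i'' := (run (Asg ''h'' (val ''i'') (Cell (cn d) (val ''i''))) r ''i'')(0 := Suc i))) ''h'' v = s (cn d) v"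
      using r(1,2) by (auto simp: less_Suc_eq)
  qed auto
  then show ?thesis using assms by simp
qed

lemma swapc_correct:
  fixes s :: state
  assumes ab: "a \<noteq> b" and x: "okname x"
  defines "K \<equiv> {v. v < s ''n'' 0 \<and> s ''l'' v = s ''l'' (s x 0)}"
  shows "run (swapc a b x) s (cn a) v = (if v \<in> K then s (cn b) v else s (cn a) v)"
    "run (swapc a b x) s (cn b) v = (if v \<in> K then s (cn a) v else s (cn b) v)"
proof -
  let ?b = "Ite (Eq (Cell ''l'' (val ''i'')) (Cell ''l'' (val x)))
     (Set ''t'' (Cell (cn a) (val ''i'')) ;; Asg (cn a) (val ''i'') (Cell (cn b) (val ''i'')) ;;
      Asg (cn b) (val ''i'') (val ''t'')) Nop"
  let ?I = "\<lambda>i (r :: state). \<forall>v. r (cn a) v = (if v \<in> K \<and> v < i then s (cn b) v else s (cn a) v) \<and>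
      r (cn b) v = (if v \<in> K \<and> v < i then s (cn a) v else s (cn b) v)"
  have "?I (1 * s ''n'' 0) (run (swapc a b x) s)"
    unfolding swapc_def
  proof (rule run_For[where I = ?I])
    fix i r assume r: "i < 1 * s ''n'' 0" "r ''i'' 0 = i" "?I i r"
      "\<And>y. y \<notin> wr ?b \<Longrightarrow> y \<noteq> ''i'' \<Longrightarrow> r y = s y"
    have "r x = s x" "r ''l'' = s ''l''" using x by (auto intro!: r(4) simp: okname_def)
    then have iK: "i \<in> K \<longleftrightarrow> r ''l'' i = r ''l'' (r x 0)" using r(1) by (simp add: K_def)
    have ra: "r (cn a) v = (if v \<in> K \<and> v < i then s (cn b) v else s (cn a) v)"
      and rb: "r (cn b) v = (if v \<in> K \<and> v < i then s (cn a) v else s (cn b) v)" for v using r(3) by auto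
    have x': "x \<noteq> ''t''" using x by (simp add: okname_def)
    show "?I (Suc i) ((run ?b r)(''i'' := (run ?b r ''i'')(0 := Suc i)))"
    proof (cases "i \<in> K")
      case True
      then have "run ?b r = r(''t'' := (r ''t'')(0 := r (cn a) i), cn a := (r (cn a))(i := r (cn b) i), cn b := (r (cn b))(i := r (cn a) i))"
        using iK r(2) ab by simp
      then show ?thesis using True ab by (auto simp: ra rb less_Suc_eq)
    next
      case False
      then have "run ?b r = r" using iK r(2) by simp
      then show ?thesis using False by (auto simp: ra rb less_Suc_eq)
    qed
  qed auto
  then show "run (swapc a b x) s (cn a) v = (if v \<in> K then s (cn b) v else s (cn a) v)"
    "run (swapc a b x) s (cn b) v = (if v \<in> K then s (cn a) v else s (cn b) v)"
    by (auto simp: K_def)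
qed

lemma kswap_correct:
  assumes c: "pcol (s ''n'' 0) A (col s)" and ab: "a < 3" "b < 3" "a \<noteq> b" and d: "d < 3"
    and x: "okname x" "s x 0 < s ''n'' 0"
  shows "col (run (kswap a b d x) s) = kempe (col s) a b ((crel (s ''n'' 0) (col s) (col s d))\<^sup>* `` {s x 0})"
proof -
  define N where "N = s ''n'' 0"
  define s1 where "s1 = run (setmate d) s"
  define s2 where "s2 = run count s1"
  have h: "s1 ''h'' v = s (cn d) v" if "v < N" for v using setmate_correct that by (simp add: s1_def N_def)
  have f1: "s1 y = s y" if "y \<notin> {''i'', ''h''}" for y using that by (simp add: s1_def run_frame)
  have f2: "s2 y = s1 y" if "y \<notin> {''i'', ''j'', ''l'', ''z''}" for y using that by (simp add: s2_def run_frame)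
  have n: "s1 ''n'' 0 = N" "s2 ''n'' 0 = N" by (simp_all add: f1 f2 N_def)
  have R: "crel (s1 ''n'' 0) (\<lambda>k. s1 (cn k)) (s1 ''h'') = crel N (col s) (col s d)"
    unfolding crel_def n by (auto simp: col_def h f1 N_def)
  have sym: "sym (crel N (col s) (col s d))"
    using sym_crel[OF c, of "col s d"] pcolD(1)[OF c d] by (simp add: N_def)
  have "s1 (cn k) v < s1 ''n'' 0" if "k < 3" "v < s1 ''n'' 0" for k v
    using pcolD(5)[OF c that(1), of v] that(2) by (simp add: f1 col_def N_def split: if_splits)
  then have l: "s2 ''l'' u = s2 ''l'' v \<longleftrightarrow> (u, v) \<in> (crel N (col s) (col s d))\<^sup>*" if "u < N" "v < N" for u v
    using count_correct(2)[of s1 u v] that sym R n by (simp add: s2_def)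
  have x': "s2 x = s x" using x(1) by (simp add: f1 f2 okname_def)
  let ?K = "{v. v < N \<and> s2 ''l'' v = s2 ''l'' (s2 x 0)}"
  have K: "(crel N (col s) (col s d))\<^sup>* `` {s x 0} = ?K"
  proof -
    have "v < N" if "(s x 0, v) \<in> (crel N (col s) (col s d))\<^sup>*" for v
      using that x(2) rtrancl_crel_bound[OF c, of "s x 0" v] by (simp add: N_def)
    then show ?thesis using l x x' rtrancl_sym[OF sym] unfolding N_def by auto
  qed
  have sw: "run (swapc a b x) s2 (cn k) v = (if v \<in> ?K then if k = a then s (cn b) v else if k = b then s (cn a) v else s (cn k) v else s (cn k) v)" for k v
  proof -
    have "run (swapc a b x) s2 (cn k) = s (cn k)" if "k \<noteq> a" "k \<noteq> b" using that by (simp add: run_frame f1 f2)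
    then show ?thesis using swapc_correct[OF ab(3) x(1), of s2 v] n by (auto simp: f1 f2)
  qed
  have run: "run (kswap a b d x) s = run (swapc a b x) s2" by (simp add: kswap_def s1_def s2_def)
  show ?thesis
  proof (intro ext)
    fix k v
    have nn: "run (swapc a b x) s2 ''n'' 0 = N" by (simp add: n)
    show "col (run (kswap a b d x) s) k v = kempe (col s) a b ((crel (s ''n'' 0) (col s) (col s d))\<^sup>* `` {s x 0}) k v"
      unfolding run N_def[symmetric] K col_def[of "run _ _"] nn kempe_def
      by (auto simp: sw col_def N_def)
  qed
qed

text \<open>\<open>a\<close> is free at the first vertex and \<open>b\<close> at the second. If they
  differ, swapping them on the chain of the second vertex frees \<open>a\<close> there too, and
  \<open>kempe_component_avoids\<close> leaves the first vertex alone; \<open>3 - a - b\<close> is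
  the third colour.\<close>

definition ins1 :: "string \<Rightarrow> string \<Rightarrow> nat \<times> nat \<Rightarrow> prog" where
  "ins1 x y = (\<lambda>(a, b). (if a = b then Nop else kswap a b (3 - a - b) y) ;;
     Asg (cn a) (val x) (val y) ;; Asg (cn a) (val y) (val x))"

text \<open>A colour is part of an array name and cannot be held in a variable, so the search for
  free colours is unrolled over the pairs of colours.\<close>

primrec ins_list :: "string \<Rightarrow> string \<Rightarrow> (nat \<times> nat) list \<Rightarrow> prog" where
  "ins_list x y [] = Nop"
| "ins_list x y (e # es) = Ite (And (Eq (Cell (cn (fst e)) (val x)) (val x)) (Eq (Cell (cn (snd e)) (val y)) (val y)))
     (ins1 x y e) (ins_list x y es)"

definition ins :: "string \<Rightarrow> string \<Rightarrow> prog" where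
  "ins x y = ins_list x y [(0,0), (0,1), (0,2), (1,0), (1,1), (1,2), (2,0), (2,1), (2,2)]"

lemma wr_ins [simp]: "wr (ins x y) = {''i'', ''h'', ''j'', ''l'', ''z'', ''t'', cn 0, cn 1, cn 2}"
  and ok_ins [simp]: "ok (ins x y)"
  by (auto simp: ins_def ins1_def)

lemma ins1_correct:
  assumes c: "pcol (s ''n'' 0) A (col s)" and ab: "a < 3" "b < 3"
    and xy: "okname x" "okname y" "s x 0 < s ''n'' 0" "s y 0 < s ''n'' 0"
    and free: "s (cn a) (s x 0) = s x 0" "s (cn b) (s y 0) = s y 0"
    and side: "s x 0 \<in> A \<longleftrightarrow> s y 0 \<notin> A" and new: "(s x 0, s y 0) \<notin> cedges (col s)"
  shows "pcol (s ''n'' 0) A (col (run (ins1 x y (a, b)) s))"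
    "cedges (col (run (ins1 x y (a, b)) s)) = cedges (col s) \<union> {(s x 0, s y 0), (s y 0, s x 0)}"
proof -
  define N where "N = s ''n'' 0"
  define r where "r = run (if a = b then Nop else kswap a b (3 - a - b) y) s"
  have rf: "r z = s z" if "okname z \<or> z = ''n''" for z
    using that by (auto simp: r_def okname_def intro!: run_frame)
  have fr: "col s a (s x 0) = s x 0" "col s b (s y 0) = s y 0" using free xy by (auto simp: col_def)
  have r: "pcol N A (col r) \<and> cedges (col r) = cedges (col s) \<and> col r a (s x 0) = s x 0 \<and> col r a (s y 0) = s y 0"
  proof (cases "a = b")
    case True
    then show ?thesis using c fr by (simp add: r_def N_def)
  next
    case False
    define d where "d = 3 - a - b"
    have "a = 0 \<or> a = 1 \<or> a = 2" "b = 0 \<or> b = 1 \<or> b = 2" using ab by auto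
    then have d: "d < 3" "d \<noteq> a" "d \<noteq> b" "{..<3} = {a, b, d}" using False by (auto simp: d_def)
    let ?K = "(crel N (col s) (col s d))\<^sup>* `` {s y 0}"
    have e: "col r = kempe (col s) a b ?K"
      using kswap_correct[OF c ab False d(1) xy(2,4)] False by (simp add: r_def d_def N_def)
    have cl: "col s a v \<in> ?K \<and> col s b v \<in> ?K" if "v \<in> ?K" for v
      using kempe_component_closed[OF c d(1) _ _ xy(4) that[unfolded N_def]] ab d by (auto simp: N_def)
    have x: "s x 0 \<notin> ?K"
      using kempe_component_avoids[OF c ab d(1-3) fr(1) side fr(2) d(4)] by (simp add: N_def)
    show ?thesis
      using kempe_correct[OF c ab False cl] x fr unfolding e by (auto simp: kempe_def N_def)
  qed
  have uv: "s x 0 \<noteq> s y 0" using side by auto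
  have rx: "r x = s x" "r y = s y" "r ''n'' = s ''n''" using rf xy by auto
  have "run (ins1 x y (a, b)) s = r(cn a := (r (cn a))(s x 0 := s y 0, s y 0 := s x 0))"
    using xy(1,2) by (simp add: ins1_def r_def[symmetric] rx okname_def)
  then have e: "col (run (ins1 x y (a, b)) s) = (col r)(a := (col r a)(s x 0 := s y 0, s y 0 := s x 0))"
    using xy(3,4) by (auto simp: col_def fun_eq_iff rx)
  have new': "(s x 0, s y 0) \<notin> cedges (col r)" using r new by simp
  show "pcol (s ''n'' 0) A (col (run (ins1 x y (a, b)) s))"
    "cedges (col (run (ins1 x y (a, b)) s)) = cedges (col s) \<union> {(s x 0, s y 0), (s y 0, s x 0)}"
    unfolding e using add_edge[of N A "col r" a "s x 0" "s y 0"] r new' ab xy(3,4) side by (auto simp: N_def)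
qed

lemma ins_correct:
  assumes c: "pcol (s ''n'' 0) A (col s)"
    and xy: "okname x" "okname y" "s x 0 < s ''n'' 0" "s y 0 < s ''n'' 0"
    and side: "s x 0 \<in> A \<longleftrightarrow> s y 0 \<notin> A" and new: "(s x 0, s y 0) \<notin> cedges (col s)"
    and deg: "card (cedges (col s) `` {s x 0}) < 3" "card (cedges (col s) `` {s y 0}) < 3"
  shows "pcol (s ''n'' 0) A (col (run (ins x y) s))"
    "cedges (col (run (ins x y) s)) = cedges (col s) \<union> {(s x 0, s y 0), (s y 0, s x 0)}"
proof -
  obtain a b where ab: "a < 3" "b < 3" "col s a (s x 0) = s x 0" "col s b (s y 0) = s y 0"
    using free_colour[OF c] deg by metis
  then have fr: "s (cn a) (s x 0) = s x 0" "s (cn b) (s y 0) = s y 0" using xy by (auto simp: col_def)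
  have *: "\<exists>a b. a < 3 \<and> b < 3 \<and> s (cn a) (s x 0) = s x 0 \<and> s (cn b) (s y 0) = s y 0 \<and>
      run (ins_list x y es) s = run (ins1 x y (a, b)) s"
    if "(a, b) \<in> set es" "\<forall>(a, b)\<in>set es. a < 3 \<and> b < 3" for es
    using that
  proof (induction es)
    case (Cons e es)
    show ?case
    proof (cases "s (cn (fst e)) (s x 0) = s x 0 \<and> s (cn (snd e)) (s y 0) = s y 0")
      case True
      then show ?thesis using Cons.prems by (intro exI[of _ "fst e"] exI[of _ "snd e"]) auto
    next
      case False
      then have "(a, b) \<in> set es" using Cons.prems fr by auto
      moreover have "run (ins_list x y (e # es)) s = run (ins_list x y es) s" using False by auto
      ultimately show ?thesis using Cons by auto
    qed
  qed simp
  let ?es = "[(0,0), (0,1), (0,2), (1,0), (1,1), (1,2), (2,0), (2,1), (2,2)] :: (nat \<times> nat) list"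
  have "a \<in> {0, 1, 2}" "b \<in> {0, 1, 2}" using ab by auto
  then have "(a, b) \<in> set ?es" by auto
  then obtain a' b' where "a' < 3" "b' < 3" "s (cn a') (s x 0) = s x 0" "s (cn b') (s y 0) = s y 0"
    "run (ins x y) s = run (ins1 x y (a', b')) s"
    using *[of ?es] unfolding ins_def by auto
  then show "pcol (s ''n'' 0) A (col (run (ins x y) s))"
    "cedges (col (run (ins x y) s)) = cedges (col s) \<union> {(s x 0, s y 0), (s y 0, s x 0)}"
    using ins1_correct[OF c _ _ xy _ _ side new] by metis+
qed

definition iso1 :: "string \<Rightarrow> nat \<Rightarrow> prog" where
  "iso1 x k = Set ''t'' (Cell (cn k) (val x)) ;; Asg (cn k) (val ''t'') (val ''t'') ;; Asg (cn k) (val x) (val x)"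

definition iso :: "string \<Rightarrow> prog" where
  "iso x = iso1 x 0 ;; iso1 x 1 ;; iso1 x 2"

definition del1 :: "string \<Rightarrow> string \<Rightarrow> nat \<Rightarrow> prog" where
  "del1 x y k = Ite (Eq (Cell (cn k) (val x)) (val y)) (Asg (cn k) (val x) (val x) ;; Asg (cn k) (val y) (val y)) Nop"

definition del :: "string \<Rightarrow> string \<Rightarrow> prog" where
  "del x y = del1 x y 0 ;; del1 x y 1 ;; del1 x y 2"

lemma wr_iso [simp]: "wr (iso x) = {''t'', cn 0, cn 1, cn 2}" and ok_iso [simp]: "ok (iso x)"
  by (auto simp: iso_def iso1_def)

lemma wr_del [simp]: "wr (del x y) = {cn 0, cn 1, cn 2}" and ok_del [simp]: "ok (del x y)"
  by (auto simp: del_def del1_def)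

lemma less3: "k < 3 \<longleftrightarrow> k = 0 \<or> k = 1 \<or> k = (2::nat)"
  by auto

lemma pcol_remove:
  assumes c: "pcol N A c" and S: "\<And>k v. k < 3 \<Longrightarrow> c' k v = (if v \<in> S k then v else c k v)"
    and cl: "\<And>k v. k < 3 \<Longrightarrow> v \<in> S k \<Longrightarrow> c k v \<in> S k"
  shows "pcol N A c'" "cedges c' = {(u, v). \<exists>k<3. c k u = v \<and> u \<noteq> v \<and> u \<notin> S k}"
proof -
  note D = pcolD[OF c]
  have out: "c k v \<notin> S k" if "k < 3" "v \<notin> S k" for k v using that cl D(1) by metis
  show "pcol N A c'"
    unfolding pcol_def
  proof (intro conjI allI impI)
    fix k v assume k: "k < (3::nat)"
    show "c' k (c' k v) = v" using out[OF k] D(1)[OF k] by (auto simp: S[OF k])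
    show "c' k v = v" if "N \<le> v" using that D(2)[OF k] by (auto simp: S[OF k])
    show "c' k v \<in> A \<longleftrightarrow> v \<notin> A" if "c' k v \<noteq> v" using that D(3)[OF k] by (auto simp: S[OF k] split: if_splits)
  next
    fix j k v assume jk: "j < (3::nat)" "k < (3::nat)" "j \<noteq> k" "c' j v = c' k v"
    then show "c' k v = v" using D(4)[of j k v] D(4)[of k j v] by (auto simp: S split: if_splits)
  qed
  show "cedges c' = {(u, v). \<exists>k<3. c k u = v \<and> u \<noteq> v \<and> u \<notin> S k}"
    unfolding set_eq_iff split_paired_All cedges_iff by (auto simp: S split: if_splits)
qed

lemma iso_correct:
  assumes c: "pcol (s ''n'' 0) A (col s)" and x: "okname x" "s x 0 < s ''n'' 0"
  shows "pcol (s ''n'' 0) A (col (run (iso x) s))"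
    "cedges (col (run (iso x) s)) = {(u, v) \<in> cedges (col s). u \<noteq> s x 0 \<and> v \<noteq> s x 0}"
proof -
  let ?x = "s x 0"
  have xn: "x \<noteq> ''t''" "\<And>k. x \<noteq> cn k" "\<And>k. cn k \<noteq> x" using x(1) by (auto simp: okname_def)
  have e: "run (iso x) s (cn k) = (s (cn k))(s (cn k) ?x := s (cn k) ?x, ?x := ?x)" if "k < 3" for k
    using that unfolding less3 by (auto simp: iso_def iso1_def xn)
  have S: "col (run (iso x) s) k v = (if v \<in> {?x, col s k ?x} then v else col s k v)" if "k < 3" for k v
    using x(2) by (auto simp: col_def e[OF that])
  have cl: "col s k v \<in> {?x, col s k ?x}" if "k < 3" "v \<in> {?x, col s k ?x}" for k v
    using that pcolD(1)[OF c] by auto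
  show "pcol (s ''n'' 0) A (col (run (iso x) s))" by (rule pcol_remove(1)[OF c S cl])
  have P: "cedges (col (run (iso x) s)) = {(u, v). \<exists>k<3. col s k u = v \<and> u \<noteq> v \<and> u \<notin> {?x, col s k ?x}}"
    by (rule pcol_remove(2)[OF c S cl])
  show "cedges (col (run (iso x) s)) = {(u, v) \<in> cedges (col s). u \<noteq> s x 0 \<and> v \<noteq> s x 0}"
  proof -
    have "u = col s k ?x \<longleftrightarrow> col s k u = ?x" if "k < 3" for u k using pcolD(1)[OF c that] by metis
    then show ?thesis unfolding P set_eq_iff split_paired_All mem_Collect_eq prod.case cedges_iff by auto
  qed
qed

lemma del_correct:
  assumes c: "pcol (s ''n'' 0) A (col s)" and x: "okname x" "s x 0 < s ''n'' 0" and y: "okname y" "s y 0 < s ''n'' 0"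
    and xy: "s x 0 \<noteq> s y 0"
  shows "pcol (s ''n'' 0) A (col (run (del x y) s))"
    "cedges (col (run (del x y) s)) = cedges (col s) - {(s x 0, s y 0), (s y 0, s x 0)}"
proof -
  let ?x = "s x 0" and ?y = "s y 0"
  define S where "S k = (if col s k ?x = ?y then {?x, ?y} else {})" for k
  have xn: "\<And>k. x \<noteq> cn k" "\<And>k. cn k \<noteq> x" "\<And>k. y \<noteq> cn k" "\<And>k. cn k \<noteq> y" using x(1) y(1) by (auto simp: okname_def)
  have e: "run (del x y) s (cn k) = (if s (cn k) ?x = ?y then (s (cn k))(?x := ?x, ?y := ?y) else s (cn k))" if "k < 3" for k
    using that unfolding less3 by (auto simp: del_def del1_def xn)
  have S: "col (run (del x y) s) k v = (if v \<in> S k then v else col s k v)" if "k < 3" for k v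
    using x(2) y(2) by (auto simp: col_def e[OF that] S_def)
  have cl: "col s k v \<in> S k" if "k < 3" "v \<in> S k" for k v
    using that(2) pcolD(1)[OF c that(1), of ?x] by (auto simp: S_def split: if_splits)
  show "pcol (s ''n'' 0) A (col (run (del x y) s))" by (rule pcol_remove(1)[OF c S cl])
  have P: "cedges (col (run (del x y) s)) = {(u, v). \<exists>k<3. col s k u = v \<and> u \<noteq> v \<and> u \<notin> S k}"
    by (rule pcol_remove(2)[OF c S cl])
  have "(\<exists>k<3. col s k u = v \<and> u \<noteq> v \<and> u \<notin> S k) \<longleftrightarrow>
      (\<exists>k<3. col s k u = v \<and> u \<noteq> v) \<and> (u, v) \<noteq> (?x, ?y) \<and> (u, v) \<noteq> (?y, ?x)" for u v
  proof
    assume "\<exists>k<3. col s k u = v \<and> u \<noteq> v \<and> u \<notin> S k"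
    then obtain k where k: "k < 3" "col s k u = v" "u \<noteq> v" "u \<notin> S k" by blast
    moreover have "(u, v) \<noteq> (?x, ?y)" using k by (auto simp: S_def)
    moreover have "(u, v) \<noteq> (?y, ?x)" using k pcolD(1)[OF c k(1), of ?y] by (auto simp: S_def)
    ultimately show "(\<exists>k<3. col s k u = v \<and> u \<noteq> v) \<and> (u, v) \<noteq> (?x, ?y) \<and> (u, v) \<noteq> (?y, ?x)" by blast
  next
    assume "(\<exists>k<3. col s k u = v \<and> u \<noteq> v) \<and> (u, v) \<noteq> (?x, ?y) \<and> (u, v) \<noteq> (?y, ?x)"
    then obtain k where k: "k < 3" "col s k u = v" "u \<noteq> v" "(u, v) \<noteq> (?x, ?y)" "(u, v) \<noteq> (?y, ?x)" by blast
    then have "u \<notin> S k" using pcolD(1)[OF c k(1), of ?x] by (auto simp: S_def)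
    then show "\<exists>k<3. col s k u = v \<and> u \<noteq> v \<and> u \<notin> S k" using k by blast
  qed
  then show "cedges (col (run (del x y) s)) = cedges (col s) - {(s x 0, s y 0), (s y 0, s x 0)}"
    unfolding P set_eq_iff split_paired_All mem_Collect_eq prod.case Diff_iff cedges_iff by simp
qed

section \<open>Exhaustive search for improvements\<close>

text \<open>\<open>Q\<close> is the property that \<open>p\<close> finds nothing to improve; it depends on the core of the state and on
  the current values of the enclosing loop variables.\<close>

definition scan :: "(state \<Rightarrow> bool) \<Rightarrow> (state \<Rightarrow> 'b) \<Rightarrow> ('b \<Rightarrow> nat) \<Rightarrow> ('b \<Rightarrow> (string \<Rightarrow> nat) \<Rightarrow> bool) \<Rightarrow> prog \<Rightarrow> bool" where
  "scan Inv core \<mu> Q p \<longleftrightarrow> ok p \<and> (\<forall>r. Inv r \<longrightarrow> Inv (run p r) \<and>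
     (if Q (core r) (\<lambda>y. r y 0) then core (run p r) = core r else \<mu> (core (run p r)) < \<mu> (core r)))"

text \<open>Until the first improvement all rounds test the original core. From then on the measure
  is strictly below its initial value and cannot rise again, so it does not matter which core the
  later rounds test.\<close>

lemma scan_For:
  assumes p: "scan Inv core \<mu> Q p" and x: "x \<noteq> ''n''" "x \<notin> wr p"
    and N: "\<forall>r. Inv r \<longrightarrow> r ''n'' 0 = N"
    and ins: "\<And>r f. Inv (r(x := f)) = Inv r" "\<And>r f. core (r(x := f)) = core r"
    and dep: "\<And>c f g. (\<And>y. y \<notin> wr p \<Longrightarrow> f y = g y) \<Longrightarrow> Q c f = Q c g"
  shows "scan Inv core \<mu> (\<lambda>c f. \<forall>v<N. Q c (f(x := v))) (For 1 x p)"
proof -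
  have okp: "ok p" using p by (simp add: scan_def)
  then have ok: "ok (For 1 x p)" using x by simp
  have "Inv (run (For 1 x p) s) \<and>
      (if \<forall>v<N. Q (core s) ((\<lambda>y. s y 0)(x := v)) then core (run (For 1 x p) s) = core s
       else \<mu> (core (run (For 1 x p) s)) < \<mu> (core s))" if s: "Inv s" for s
  proof -
    let ?Q = "\<lambda>v. Q (core s) ((\<lambda>y. s y 0)(x := v))"
    let ?I = "\<lambda>i r. Inv r \<and> (if \<forall>v<i. ?Q v then core r = core s else \<mu> (core r) < \<mu> (core s))"
    have "?I (1 * N) (run (For 1 x p) s)"
    proof (rule run_For[where I = ?I])
      show "ok (For 1 x p)" by (rule ok)
      show "s ''n'' 0 = N" by (rule N[rule_format, OF s])
      show "?I 0 (s(x := (s x)(0 := 0)))" using s ins by simp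
      fix i r assume r: "r x 0 = i" "\<And>y. y \<notin> wr p \<Longrightarrow> y \<noteq> x \<Longrightarrow> r y = s y" "?I i r"
      define q where "q = run p r"
      have q: "Inv q \<and> (if Q (core r) (\<lambda>y. r y 0) then core q = core r else \<mu> (core q) < \<mu> (core r))"
        using p r(3) unfolding scan_def q_def by blast
      have Qi: "Q (core s) (\<lambda>y. r y 0) = ?Q i" by (rule dep) (use r(1,2) in auto)
      have all: "(\<forall>v<Suc i. ?Q v) \<longleftrightarrow> (\<forall>v<i. ?Q v) \<and> ?Q i" by (auto simp: less_Suc_eq)
      have "Inv q \<and> (if \<forall>v<Suc i. ?Q v then core q = core s else \<mu> (core q) < \<mu> (core s))"
      proof (cases "\<forall>v<i. ?Q v")
        case True
        then have "core r = core s" using r(3) by simp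
        then show ?thesis using q Qi True unfolding all by metis
      next
        case False
        then have "\<mu> (core r) < \<mu> (core s)" using r(3) by meson
        moreover have "\<mu> (core q) \<le> \<mu> (core r)" using q by (metis less_imp_le order_refl)
        ultimately show ?thesis using q False unfolding all by auto
      qed
      then show "?I (Suc i) ((run p r)(x := (run p r x)(0 := Suc i)))"
        unfolding q_def[symmetric] ins .
    qed
    then show ?thesis unfolding nat_mult_1 .
  qed
  then show ?thesis using ok unfolding scan_def by blast
qed

lemma scan_Sq:
  assumes p: "scan Inv core \<mu> Q p" and q: "scan Inv core \<mu> Q' q"
    and dep: "\<And>c f g. Q' c f = Q' c g"
  shows "scan Inv core \<mu> (\<lambda>c f. Q c f \<and> Q' c f) (p ;; q)"
proof -
  have "Inv (run q (run p r)) \<and> (if Q (core r) (\<lambda>y. r y 0) \<and> Q' (core r) (\<lambda>y. r y 0) then core (run q (run p r)) = core r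
      else \<mu> (core (run q (run p r))) < \<mu> (core r))" if r: "Inv r" for r
  proof -
    define s where "s = run p r"
    have s: "Inv s \<and> (if Q (core r) (\<lambda>y. r y 0) then core s = core r else \<mu> (core s) < \<mu> (core r))"
      using p r unfolding scan_def s_def by blast
    then have t: "Inv (run q s) \<and> (if Q' (core s) (\<lambda>y. s y 0) then core (run q s) = core s else \<mu> (core (run q s)) < \<mu> (core s))"
      using q unfolding scan_def by blast
    have d: "Q' (core s) (\<lambda>y. s y 0) = Q' (core s) (\<lambda>y. r y 0)" by (rule dep)
    show ?thesis
    proof (cases "Q (core r) (\<lambda>y. r y 0)")
      case True
      then show ?thesis using s t d unfolding s_def[symmetric] by auto
    next
      case False
      have "\<mu> (core (run q s)) \<le> \<mu> (core s)" using t by (metis less_imp_le order_refl)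
      then show ?thesis using False s t unfolding s_def[symmetric] by auto
    qed
  qed
  then show ?thesis using p q unfolding scan_def by simp
qed

text \<open>A pass that finds an improvement lowers the measure, and a core without improvements is
  left unchanged by all later passes. More passes than the initial measure therefore end in such a
  core.\<close>

lemma scan_repeat:
  assumes p: "scan Inv core \<mu> Q p" and x: "x \<noteq> ''n''" "x \<notin> wr p"
    and s: "Inv s" and N: "\<forall>r. Inv r \<longrightarrow> r ''n'' 0 = N"
    and ins: "\<And>r f. Inv (r(x := f)) = Inv r" "\<And>r f. core (r(x := f)) = core r"
    and dep: "\<And>c f g. Q c f = Q c g" and bound: "\<mu> (core s) < k * N"
  shows "Inv (run (For k x p) s)" "Q (core (run (For k x p) s)) f"
proof -
  have okp: "ok p" using p by (simp add: scan_def)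
  then have ok: "ok (For k x p)" using x by simp
  let ?I = "\<lambda>i r. Inv r \<and> (Q (core r) f \<or> \<mu> (core r) + i \<le> \<mu> (core s))"
  have "?I (k * N) (run (For k x p) s)"
  proof (rule run_For[where I = ?I])
    show "ok (For k x p)" by (rule ok)
    show "s ''n'' 0 = N" by (rule N[rule_format, OF s])
    show "?I 0 (s(x := (s x)(0 := 0)))" using s ins by simp
    fix i r assume r: "?I i r"
    define q where "q = run p r"
    have "Inv q \<and> (if Q (core r) (\<lambda>y. r y 0) then core q = core r else \<mu> (core q) < \<mu> (core r))"
      using p r unfolding scan_def q_def by blast
    moreover have "Q (core r) (\<lambda>y. r y 0) = Q (core r) f" by (rule dep)
    ultimately have "Inv q \<and> (Q (core q) f \<or> \<mu> (core q) + Suc i \<le> \<mu> (core s))"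
      using r by (cases "Q (core r) f") auto
    then show "?I (Suc i) ((run p r)(x := (run p r x)(0 := Suc i)))"
      unfolding q_def[symmetric] ins .
  qed
  then show "Inv (run (For k x p) s)" "Q (core (run (For k x p) s)) f" using bound by auto
qed

section \<open>Reading the graph\<close>

definition ready :: "nat \<Rightarrow> nat set \<Rightarrow> state \<Rightarrow> nat rel \<Rightarrow> bool" where
  "ready N A s E \<longleftrightarrow> s ''n'' 0 = N \<and> pcol N A (col s) \<and> cedges (col s) = E"

definition subcubic :: "nat \<Rightarrow> nat set \<Rightarrow> nat rel \<Rightarrow> bool" where
  "subcubic N A E \<longleftrightarrow> E \<subseteq> {..<N} \<times> {..<N} \<and> sym E \<and> (\<forall>(u, v)\<in>E. u \<in> A \<longleftrightarrow> v \<notin> A) \<and> (\<forall>v. card (E `` {v}) \<le> 3)"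

lemma subcubic_cubic_bip:
  assumes "cubic_bip A E" "E \<subseteq> {..<N} \<times> {..<N}"
  shows "subcubic N A E"
proof -
  have "card (E `` {v}) \<le> 3" for v
  proof (cases "v \<in> Domain E")
    case False
    then have "E `` {v} = {}" by auto
    then show ?thesis by simp
  qed (use assms in \<open>auto simp: cubic_bip_def\<close>)
  then show ?thesis using assms by (auto simp: subcubic_def cubic_bip_def)
qed

lemma ready_cong:
  assumes "s' ''n'' = s ''n''" "\<And>k. k < 3 \<Longrightarrow> s' (cn k) = s (cn k)"
  shows "ready N A s' E = ready N A s E"
proof -
  have e: "col s' k = col s k" if "k < 3" for k using that assms by (auto simp: col_def)
  have "pcol N A (col s') = pcol N A (col s)" unfolding pcol_def using e by (simp cong: conj_cong)
  moreover have "cedges (col s') = cedges (col s)" unfolding cedges_def using e by force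
  ultimately show ?thesis using assms by (simp add: ready_def)
qed

text \<open>\<open>F\<close> is the graph under construction. It contains the new edge on top of
  \<open>E\<close>, so both ends have degree at most 2 in \<open>E\<close> and hence a free
  colour.\<close>

lemma ins_ready:
  assumes s: "ready N A s E" and xy: "okname x" "okname y" "x \<noteq> y"
    and F: "subcubic N A F" "E \<subseteq> F" "(s x 0, s y 0) \<in> F" "(s x 0, s y 0) \<notin> E"
  shows "ready N A (run (ins x y) s) (E \<union> {(s x 0, s y 0), (s y 0, s x 0)})"
proof -
  have c: "pcol (s ''n'' 0) A (col s)" and N: "s ''n'' 0 = N" and E: "cedges (col s) = E" using s by (auto simp: ready_def)
  have fin: "finite F" using F(1) unfolding subcubic_def by (meson finite_SigmaI finite_lessThan finite_subset)
  have "(s y 0, s x 0) \<in> F" using F(1,3) unfolding subcubic_def by (meson symD)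
  have "(s y 0, s x 0) \<notin> E" using F(4) E sym_cedges[OF c] by (meson symD)
  have lt: "card (E `` {u}) < 3" if "(u, v) \<in> F" "(u, v) \<notin> E" for u v
  proof -
    have "E `` {u} \<subset> F `` {u}" using that F(2) by auto
    then have "card (E `` {u}) < card (F `` {u})" using fin by (simp add: psubset_card_mono finite_Image)
    then show ?thesis using F(1) unfolding subcubic_def by (meson less_le_trans)
  qed
  have b: "s x 0 < s ''n'' 0" "s y 0 < s ''n'' 0" and sd: "s x 0 \<in> A \<longleftrightarrow> s y 0 \<notin> A"
    using F(1,3) N unfolding subcubic_def by auto
  note I = ins_correct[OF c xy(1,2) b sd, unfolded E, OF F(4) lt[OF F(3,4)] lt[OF \<open>(s y 0, s x 0) \<in> F\<close> \<open>(s y 0, s x 0) \<notin> E\<close>]]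
  show ?thesis unfolding ready_def using I N by simp
qed

definition init_prog :: prog where
  "init_prog = For 1 ''w'' (Asg (cn 0) (val ''w'') (val ''w'') ;; Asg (cn 1) (val ''w'') (val ''w'') ;; Asg (cn 2) (val ''w'') (val ''w''))"

text \<open>Loops have a multiple of \<open>n\<close> rounds, so the number of edges appears as a
  guard within \<open>3 * n\<close> rounds.\<close>

definition build :: prog where
  "build = For 3 ''e'' (Ite (Less (val ''e'') (val ''m''))
     (Set ''x'' (Cell ''u'' (val ''e'')) ;; Set ''y'' (Cell ''v'' (val ''e'')) ;; ins ''x'' ''y'') Nop)"

lemma wr_init [simp]: "wr init_prog = {''w'', cn 0, cn 1, cn 2}" and ok_init [simp]: "ok init_prog"
  by (auto simp: init_prog_def)

lemma ok_build [simp]: "ok build"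
  by (auto simp: build_def)

lemma init_correct: "ready (s ''n'' 0) A (run init_prog s) {}"
proof -
  have "\<forall>v < 1 * s ''n'' 0. \<forall>k<3. run init_prog s (cn k) v = v"
    unfolding init_prog_def
    by (rule run_For[where I = "\<lambda>i r. \<forall>v < i. \<forall>k<3. r (cn k) v = v"]) (auto simp: less_Suc_eq less3)
  then have e: "col (run init_prog s) k v = v" if "k < 3" for k v using that by (simp add: col_def)
  have "cedges (col (run init_prog s)) = {}" unfolding cedges_def using e by auto
  moreover have "pcol (s ''n'' 0) A (col (run init_prog s))" unfolding pcol_def using e by simp
  ultimately show ?thesis by (simp add: ready_def)
qed

lemma oknames [simp]: "okname ''x''" "okname ''y''" "okname ''a''" "okname ''b''" "okname ''d''" "okname ''e''"
  "okname ''p''" "okname ''q''"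
  by (auto simp: okname_def)

lemma build_correct:
  assumes s: "ready N A s {}" and m: "s ''m'' 0 = length es" "length es \<le> 3 * N"
    and uv: "\<And>i. i < length es \<Longrightarrow> (s ''u'' i, s ''v'' i) = es ! i"
    and F: "subcubic N A (set es \<union> (set es)\<inverse>)" and dist: "distinct (map (\<lambda>(u, v). {u, v}) es)"
  shows "ready N A (run build s) (set es \<union> (set es)\<inverse>)"
proof -
  let ?p = "Ite (Less (val ''e'') (val ''m'')) (Set ''x'' (Cell ''u'' (val ''e'')) ;; Set ''y'' (Cell ''v'' (val ''e'')) ;; ins ''x'' ''y'') Nop"
  let ?E = "\<lambda>i. set (take i es) \<union> (set (take i es))\<inverse>"
  have "ready N A (run build s) (?E (3 * N))"
    unfolding build_def
  proof (rule run_For[where I = "\<lambda>i r. ready N A r (?E i)"])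
    show "ok (For 3 ''e'' ?p)" by simp
    show "s ''n'' 0 = N" using s by (simp add: ready_def)
    show "ready N A (s(''e'' := (s ''e'')(0 := 0))) (?E 0)" using s by (subst ready_cong[of _ s]) auto
    fix i r assume r: "r ''e'' 0 = i" "\<And>y. y \<notin> wr ?p \<Longrightarrow> y \<noteq> ''e'' \<Longrightarrow> r y = s y" "ready N A r (?E i)"
    have f: "r ''m'' = s ''m''" "r ''u'' = s ''u''" "r ''v'' = s ''v''" by (auto intro!: r(2))
    have "ready N A (run ?p r) (?E (Suc i))"
    proof (cases "i < length es")
      case False
      then have "run ?p r = r" using r(1) f m by simp
      then show ?thesis using r(3) False by simp
    next
      case True
      obtain u v where e: "es ! i = (u, v)" by (cases "es ! i")
      define q where "q = r(''x'' := (r ''x'')(0 := u), ''y'' := (r ''y'')(0 := v))"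
      have "run ?p r = run (ins ''x'' ''y'') q" using True r(1) f m uv[OF True] e by (simp add: q_def)
      moreover have "ready N A (run (ins ''x'' ''y'') q) (?E i \<union> {(q ''x'' 0, q ''y'' 0), (q ''y'' 0, q ''x'' 0)})"
      proof (rule ins_ready[OF _ _ _ _ F])
        show "ready N A q (?E i)" using r(3) by (subst ready_cong[of _ r]) (auto simp: q_def)
        show "?E i \<subseteq> set es \<union> (set es)\<inverse>" using set_take_subset[of i es] by blast
        show "(q ''x'' 0, q ''y'' 0) \<in> set es \<union> (set es)\<inverse>" using True e by (auto simp: q_def in_set_conv_nth)
        have "{u, v} \<noteq> {u', v'}" if uv': "(u', v') \<in> set (take i es)" for u' v'
        proof -
          obtain j where j: "j < i" "es ! j = (u', v')" using uv' True by (auto simp: in_set_conv_nth)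
          then have "map (\<lambda>(u, v). {u, v}) es ! j \<noteq> map (\<lambda>(u, v). {u, v}) es ! i"
            using nth_eq_iff_index_eq[OF dist, of j i] j(1) True by simp
          then show ?thesis using j e True by auto
        qed
        then show "(q ''x'' 0, q ''y'' 0) \<notin> ?E i" by (auto simp: q_def)
      qed auto
      moreover have "?E (Suc i) = ?E i \<union> {(u, v), (v, u)}" using True e by (auto simp: take_Suc_conv_app_nth)
      ultimately show ?thesis by (simp add: q_def)
    qed
    then show "ready N A ((run ?p r)(''e'' := (run ?p r ''e'')(0 := Suc i))) (?E (Suc i))"
      by (subst ready_cong[of _ "run ?p r"]) auto
  qed
  then show ?thesis using m by simp
qed

section \<open>Contraction phase\<close>

definition adjb :: "string \<Rightarrow> string \<Rightarrow> bexp" where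
  "adjb x y = And (Not (Eq (val x) (val y)))
     (Not (And (Not (Eq (Cell (cn 0) (val x)) (val y)))
       (And (Not (Eq (Cell (cn 1) (val x)) (val y))) (Not (Eq (Cell (cn 2) (val x)) (val y))))))"

lemma bval_adjb: "s x 0 < s ''n'' 0 \<Longrightarrow> bval (adjb x y) s \<longleftrightarrow> (s x 0, s y 0) \<in> cedges (col s)"
  by (auto simp: adjb_def cedges_iff less3 col_def)

definition ands :: "bexp list \<Rightarrow> bexp" where
  "ands bs = foldr And bs (Eq (Const 0) (Const 0))"

lemma bval_ands [simp]: "bval (ands bs) s \<longleftrightarrow> (\<forall>b\<in>set bs. bval b s)"
  by (induction bs) (auto simp: ands_def)

text \<open>The comparisons with \<open>n\<close> make the test meaningful for arbitrary values of
  the loop variables, since \<open>scan\<close> quantifies over all states satisfying the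
  invariant.\<close>

definition square_test :: bexp where
  "square_test = ands (map (\<lambda>x. Less (val x) (val ''n'')) [''a'', ''b'', ''d'', ''e'', ''p'', ''q''] @
     [adjb ''a'' ''b'', adjb ''b'' ''d'', adjb ''d'' ''e'', adjb ''e'' ''a'',
      Not (Eq (val ''a'') (val ''d'')), Not (Eq (val ''b'') (val ''e'')),
      adjb ''d'' ''p'', Not (Eq (val ''p'') (val ''b'')), Not (Eq (val ''p'') (val ''e'')), Not (adjb ''a'' ''p''),
      adjb ''e'' ''q'', Not (Eq (val ''q'') (val ''a'')), Not (Eq (val ''q'') (val ''d'')), Not (adjb ''b'' ''q'')])"

definition no_bad :: "nat \<Rightarrow> nat rel \<Rightarrow> (string \<Rightarrow> nat) \<Rightarrow> bool" where
  "no_bad N E f \<longleftrightarrow> \<not> ((\<forall>x\<in>{''a'', ''b'', ''d'', ''e'', ''p'', ''q''}. f x < N) \<and>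
     bad_square E (f ''a'') (f ''b'') (f ''d'') (f ''e'') (f ''p'') (f ''q''))"

lemma bval_square_test: "bval square_test s \<longleftrightarrow> \<not> no_bad (s ''n'' 0) (cedges (col s)) (\<lambda>y. s y 0)"
  unfolding square_test_def no_bad_def bad_square_def bval_ands
  by (auto simp: bval_adjb)

definition push :: prog where
  "push = Asg ''A'' (val ''k'') (val ''a'') ;; Asg ''B'' (val ''k'') (val ''b'') ;; Asg ''D'' (val ''k'') (val ''d'') ;;
     Asg ''E'' (val ''k'') (val ''e'') ;; Asg ''P'' (val ''k'') (val ''p'') ;; Asg ''Q'' (val ''k'') (val ''q'') ;;
     Set ''k'' (Plus (val ''k'') (Const 1))"

definition ctr :: prog where
  "ctr = push ;; iso ''d'' ;; iso ''e'' ;; ins ''a'' ''p'' ;; ins ''b'' ''q''"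

definition stk :: "state \<Rightarrow> (nat \<times> nat \<times> nat \<times> nat \<times> nat \<times> nat) list" where
  "stk s = map (\<lambda>i. (s ''A'' i, s ''B'' i, s ''D'' i, s ''E'' i, s ''P'' i, s ''Q'' i)) (rev [0..<s ''k'' 0])"

text \<open>The undo record: a stack of contractions leading from \<open>G\<close> to the current
  graph, the latest first.\<close>

fun hist :: "'a set \<Rightarrow> 'a rel \<Rightarrow> ('a \<times> 'a \<times> 'a \<times> 'a \<times> 'a \<times> 'a) list \<Rightarrow> 'a rel \<Rightarrow> bool" where
  "hist A G [] E' \<longleftrightarrow> E' = G"
| "hist A G ((x1, x2, x3, x4, p, q) # ts) E' \<longleftrightarrow>
     (\<exists>E. square A E x1 x2 x3 x4 p q \<and> E' = contract E x1 x2 x3 x4 p q \<and> hist A G ts E)"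

definition contr_inv :: "nat \<Rightarrow> nat set \<Rightarrow> nat rel \<Rightarrow> state \<Rightarrow> bool" where
  "contr_inv N A G r \<longleftrightarrow> ready N A r (cedges (col r)) \<and> cubic_bip A (cedges (col r)) \<and> hist A G (stk r) (cedges (col r))"

lemma contr_inv_upd:
  assumes "x \<notin> {''n'', ''k'', ''A'', ''B'', ''D'', ''E'', ''P'', ''Q''}" "\<And>k. x \<noteq> cn k"
  shows "contr_inv N A G (r(x := f)) = contr_inv N A G r" "col (r(x := f)) = col r"
proof -
  show e: "col (r(x := f)) = col r" using assms by (auto simp: col_def fun_eq_iff)
  have "stk (r(x := f)) = stk r" using assms by (auto simp: stk_def)
  moreover have "ready N A (r(x := f)) (cedges (col r)) = ready N A r (cedges (col r))"
    using assms by (intro ready_cong) auto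
  ultimately show "contr_inv N A G (r(x := f)) = contr_inv N A G r" using e by (simp add: contr_inv_def)
qed

lemma card_Domain_contract:
  assumes "square A E x1 x2 x3 x4 p q"
  shows "card (Domain E) = card (Domain (contract E x1 x2 x3 x4 p q)) + 2"
proof -
  interpret square A E x1 x2 x3 x4 p q by fact
  have "card {x3, x4} = 2" using distinct6 by simp
  moreover have "{x3, x4} \<subseteq> Domain E" using edges by auto
  moreover have "finite (Domain E)" using finE by (simp add: finite_Domain)
  ultimately show ?thesis unfolding Domain' using card_Diff_subset[of "{x3, x4}" "Domain E"]
      card_mono[of "Domain E" "{x3, x4}"] by simp
qed

lemma ctr_correct:
  assumes r: "contr_inv N A G r" and t: "\<not> no_bad N (cedges (col r)) (\<lambda>y. r y 0)"
  shows "contr_inv N A G (run ctr r)"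
    "card (Domain (cedges (col (run ctr r)))) < card (Domain (cedges (col r)))"
proof -
  define E where "E = cedges (col r)"
  define x1 x2 x3 x4 p q where xs: "x1 = r ''a'' 0" "x2 = r ''b'' 0" "x3 = r ''d'' 0" "x4 = r ''e'' 0" "p = r ''p'' 0" "q = r ''q'' 0"
  have b: "x1 < N" "x2 < N" "x3 < N" "x4 < N" "p < N" "q < N" and bad: "bad_square E x1 x2 x3 x4 p q"
    using t by (auto simp: no_bad_def E_def xs)
  have rd: "ready N A r E" and cub: "cubic_bip A E" and hi: "hist A G (stk r) E"
    using r by (auto simp: contr_inv_def E_def)
  interpret square A E x1 x2 x3 x4 p q using cub bad by (simp add: square_def)
  define s1 where "s1 = run push r"
  have s1f: "s1 y = r y" if "y \<notin> {''A'', ''B'', ''D'', ''E'', ''P'', ''Q'', ''k''}" for y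
    using that by (simp add: s1_def push_def)
  have st: "stk s1 = (x1, x2, x3, x4, p, q) # stk r"
    by (auto simp: s1_def push_def stk_def xs)
  have r1: "ready N A s1 E" using rd by (subst ready_cong[of _ r]) (auto simp: s1f)
  have N: "s1 ''n'' 0 = N" using r1 by (simp add: ready_def)
  define s2 where "s2 = run (iso ''d'') s1"
  have f2: "s2 y = s1 y" if "y \<notin> {''t'', cn 0, cn 1, cn 2}" for y using that by (simp add: s2_def run_frame)
  have r2: "ready N A s2 {(u, v) \<in> E. u \<noteq> x3 \<and> v \<noteq> x3}"
    using iso_correct[of s1 A "''d''"] r1 b by (simp add: ready_def s2_def s1f xs)
  define s3 where "s3 = run (iso ''e'') s2"
  have f3: "s3 y = s2 y" if "y \<notin> {''t'', cn 0, cn 1, cn 2}" for y using that by (simp add: s3_def run_frame)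
  have r3: "ready N A s3 {(u, v) \<in> E. u \<notin> {x3, x4} \<and> v \<notin> {x3, x4}}"
  proof -
    have "{(u, v) \<in> {(u, v) \<in> E. u \<noteq> x3 \<and> v \<noteq> x3}. u \<noteq> x4 \<and> v \<noteq> x4} = {(u, v) \<in> E. u \<notin> {x3, x4} \<and> v \<notin> {x3, x4}}" by auto
    then show ?thesis using iso_correct[of s2 A "''e''"] r2 b by (simp add: ready_def s3_def s1f f2 xs)
  qed
  have EN: "E \<subseteq> {..<N} \<times> {..<N}" using rd cedges_bound by (auto simp: ready_def)
  have E'N: "E' \<subseteq> {..<N} \<times> {..<N}" using EN b by (auto simp: E'_iff)
  \<comment> \<open>The contracted graph is the target of both insertions; its degrees show that the
    deletions have made room for the new edges.\<close>
  have sub: "subcubic N A E'" by (rule subcubic_cubic_bip[OF cubic_contract E'N])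
  let ?E3 = "{(u, v) \<in> E. u \<notin> {x3, x4} \<and> v \<notin> {x3, x4}}"
  have v3: "s3 ''a'' 0 = x1" "s3 ''p'' 0 = p" "s3 ''b'' 0 = x2" "s3 ''q'' 0 = q" by (auto simp: f3 f2 s1f xs)
  define s4 where "s4 = run (ins ''a'' ''p'') s3"
  have f4: "s4 y = s3 y" if "y \<notin> {''i'', ''h'', ''j'', ''l'', ''z'', ''t'', cn 0, cn 1, cn 2}" for y
    using that by (simp add: s4_def run_frame)
  have r4: "ready N A s4 (?E3 \<union> {(x1, p), (p, x1)})"
    using ins_ready[OF r3 _ _ _ sub, of "''a''" "''p''"] nonedges by (auto simp: s4_def v3 contract_def)
  have v4: "s4 ''b'' 0 = x2" "s4 ''q'' 0 = q" by (auto simp: f4 v3)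
  define s5 where "s5 = run (ins ''b'' ''q'') s4"
  have f5: "s5 y = s4 y" if "y \<notin> {''i'', ''h'', ''j'', ''l'', ''z'', ''t'', cn 0, cn 1, cn 2}" for y
    using that by (simp add: s5_def run_frame)
  have n2: "(x2, q) \<notin> ?E3 \<union> {(x1, p), (p, x1)}" using nonedges distinct6 by auto
  have "ready N A s5 (?E3 \<union> {(x1, p), (p, x1)} \<union> {(x2, q), (q, x2)})"
    using ins_ready[OF r4 _ _ _ sub, of "''b''" "''q''"] n2 by (auto simp: s5_def v4 contract_def)
  moreover have "?E3 \<union> {(x1, p), (p, x1)} \<union> {(x2, q), (q, x2)} = E'" by (auto simp: contract_def)
  ultimately have r5: "ready N A s5 E'" by simp
  have run: "run ctr r = s5" by (simp add: ctr_def s1_def s2_def s3_def s4_def s5_def)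
  have ce: "cedges (col s5) = E'" using r5 by (simp add: ready_def)
  have "stk s5 = stk s1" by (simp add: stk_def f5 f4 f3 f2)
  then have "hist A G (stk s5) E'" using st hi square_axioms by auto
  then show "contr_inv N A G (run ctr r)" unfolding contr_inv_def run ce using r5 cubic_contract by simp
  show "card (Domain (cedges (col (run ctr r)))) < card (Domain (cedges (col r)))"
    unfolding run ce E_def[symmetric] using card_Domain_contract[OF square_axioms] by simp
qed

definition contr_pass :: prog where
  "contr_pass = For 1 ''a'' (For 1 ''b'' (For 1 ''d'' (For 1 ''e'' (For 1 ''p'' (For 1 ''q'' (Ite square_test ctr Nop))))))"

text \<open>Each contraction removes two vertices, so the number of vertices, at most
  \<open>n\<close>, is a measure for \<open>scan_repeat\<close>; \<open>2 * n\<close> passes are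
  strictly more.\<close>

definition contr_phase :: prog where
  "contr_phase = Set ''k'' (Const 0) ;; For 2 ''f'' contr_pass"

lemma wr_ctr: "wr ctr = {''A'', ''B'', ''D'', ''E'', ''P'', ''Q'', ''k'', ''i'', ''h'', ''j'', ''l'', ''z'', ''t'', cn 0, cn 1, cn 2}"
  and ok_ctr [simp]: "ok ctr"
  by (auto simp: ctr_def push_def)

lemma ok_contr_phase [simp]: "ok contr_phase"
  by (simp add: contr_phase_def contr_pass_def wr_ctr)

lemma contr_phase_correct:
  assumes s: "ready N A s G" and G: "cubic_bip A G" and N: "0 < N"
  defines "r \<equiv> run contr_phase s"
  shows "contr_inv N A G r" "\<And>x1 x2 x3 x4 p q. \<not> bad_square (cedges (col r)) x1 x2 x3 x4 p q"
proof -
  let ?core = "\<lambda>r. cedges (col r)" and ?mu = "\<lambda>E. card (Domain E)"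
  let ?S = "scan (contr_inv N A G) ?core ?mu"
  have n: "\<forall>r. contr_inv N A G r \<longrightarrow> r ''n'' 0 = N" by (simp add: contr_inv_def ready_def)
  have base: "?S (\<lambda>E f. no_bad N E f) (Ite square_test ctr Nop)"
  proof -
    have "contr_inv N A G (run (Ite square_test ctr Nop) r) \<and>
        (if no_bad N (?core r) (\<lambda>y. r y 0) then ?core (run (Ite square_test ctr Nop) r) = ?core r
         else ?mu (?core (run (Ite square_test ctr Nop) r)) < ?mu (?core r))" if r: "contr_inv N A G r" for r
      using ctr_correct[OF r] r n[rule_format, OF r] bval_square_test[of r]
      by (cases "no_bad N (?core r) (\<lambda>y. r y 0)") simp_all
    moreover have "ok (Ite square_test ctr Nop)" by simp
    ultimately show ?thesis unfolding scan_def by blast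
  qed
  note up = contr_inv_upd
  have 1: "?S (\<lambda>E f. \<forall>v<N. no_bad N E (f(''q'' := v))) (For 1 ''q'' (Ite square_test ctr Nop))"
    by (rule scan_For[OF base _ _ n]) (auto simp: up wr_ctr no_bad_def)
  have 2: "?S (\<lambda>E f. \<forall>v5<N. \<forall>v<N. no_bad N E (f(''p'' := v5, ''q'' := v)))
      (For 1 ''p'' (For 1 ''q'' (Ite square_test ctr Nop)))"
    by (rule scan_For[OF 1 _ _ n]) (auto simp: up wr_ctr no_bad_def)
  have 3: "?S (\<lambda>E f. \<forall>v4<N. \<forall>v5<N. \<forall>v<N. no_bad N E (f(''e'' := v4, ''p'' := v5, ''q'' := v)))
      (For 1 ''e'' (For 1 ''p'' (For 1 ''q'' (Ite square_test ctr Nop))))"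
    by (rule scan_For[OF 2 _ _ n]) (auto simp: up wr_ctr no_bad_def)
  have 4: "?S (\<lambda>E f. \<forall>v3<N. \<forall>v4<N. \<forall>v5<N. \<forall>v<N. no_bad N E (f(''d'' := v3, ''e'' := v4, ''p'' := v5, ''q'' := v)))
      (For 1 ''d'' (For 1 ''e'' (For 1 ''p'' (For 1 ''q'' (Ite square_test ctr Nop)))))"
    by (rule scan_For[OF 3 _ _ n]) (auto simp: up wr_ctr no_bad_def)
  have 5: "?S (\<lambda>E f. \<forall>v2<N. \<forall>v3<N. \<forall>v4<N. \<forall>v5<N. \<forall>v<N. no_bad N E (f(''b'' := v2, ''d'' := v3, ''e'' := v4, ''p'' := v5, ''q'' := v)))
      (For 1 ''b'' (For 1 ''d'' (For 1 ''e'' (For 1 ''p'' (For 1 ''q'' (Ite square_test ctr Nop))))))"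
    by (rule scan_For[OF 4 _ _ n]) (auto simp: up wr_ctr no_bad_def)
  let ?NB = "\<lambda>E. \<forall>v1<N. \<forall>v2<N. \<forall>v3<N. \<forall>v4<N. \<forall>v5<N. \<forall>v<N. \<not> bad_square E v1 v2 v3 v4 v5 v"
  have 6: "?S (\<lambda>E f. \<forall>v1<N. \<forall>v2<N. \<forall>v3<N. \<forall>v4<N. \<forall>v5<N. \<forall>v<N.
      no_bad N E (f(''a'' := v1, ''b'' := v2, ''d'' := v3, ''e'' := v4, ''p'' := v5, ''q'' := v))) contr_pass"
    unfolding contr_pass_def by (rule scan_For[OF 5 _ _ n]) (auto simp: up wr_ctr no_bad_def)
  have "(\<forall>v1<N. \<forall>v2<N. \<forall>v3<N. \<forall>v4<N. \<forall>v5<N. \<forall>v<N.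
      no_bad N E (f(''a'' := v1, ''b'' := v2, ''d'' := v3, ''e'' := v4, ''p'' := v5, ''q'' := v))) = ?NB E"
    for E and f :: "string \<Rightarrow> nat"
    by (simp add: no_bad_def)
  with 6 have 7: "?S (\<lambda>E f. ?NB E) contr_pass" by (simp only:)
  let ?s = "run (Set ''k'' (Const 0)) s"
  have i: "contr_inv N A G ?s"
  proof -
    have "ready N A ?s G" using s by (subst ready_cong[of _ s]) auto
    then show ?thesis using G by (simp add: contr_inv_def ready_def stk_def)
  qed
  have bnd: "card (Domain (cedges (col ?s))) < 2 * N"
  proof -
    have "cedges (col ?s) \<subseteq> {..<N} \<times> {..<N}" using i cedges_bound by (auto simp: contr_inv_def ready_def)
    then have "Domain (cedges (col ?s)) \<subseteq> {..<N}" by auto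
    then have "card (Domain (cedges (col ?s))) \<le> N" using card_mono[of "{..<N}"] by simp
    then show ?thesis using N by simp
  qed
  have w: "''f'' \<notin> wr contr_pass" by (simp add: contr_pass_def wr_ctr)
  have run: "r = run (For 2 ''f'' contr_pass) ?s" by (simp add: r_def contr_phase_def)
  have nf: "''f'' \<noteq> ''n''" by simp
  have ins: "contr_inv N A G (r(''f'' := f)) = contr_inv N A G r" "cedges (col (r(''f'' := f))) = cedges (col r)" for r f
    by (simp_all add: up)
  note rep = scan_repeat[where Inv = "contr_inv N A G" and core = ?core and \<mu> = ?mu and Q = "\<lambda>E f. ?NB E"
      and p = contr_pass and x = "''f''" and k = 2 and N = N and s = ?s, OF 7 nf w i n ins refl bnd]
  show inv: "contr_inv N A G r"
    unfolding run by (rule rep(1))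
  have Q: "?NB (cedges (col r))"
    unfolding run by (rule rep(2))
  show "\<not> bad_square (cedges (col r)) x1 x2 x3 x4 p q" for x1 x2 x3 x4 p q
  proof
    assume bad: "bad_square (cedges (col r)) x1 x2 x3 x4 p q"
    have EN: "cedges (col r) \<subseteq> {..<N} \<times> {..<N}" using inv cedges_bound by (auto simp: contr_inv_def ready_def)
    then have b: "x1 < N" "x2 < N" "x3 < N" "x4 < N" "p < N" "q < N" using bad unfolding bad_square_def by blast+
    show False using Q[rule_format, OF b] bad by contradiction
  qed
qed

section \<open>Local search\<close>

lemma count_factor:
  assumes s: "ready N A s E" and h: "\<And>v. v \<in> Domain E \<Longrightarrow> s ''h'' (s ''h'' v) = v"
  shows "run count s ''z'' 0 = card (comps {..<N} (factor E (s ''h'')))"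
proof -
  have N: "s ''n'' 0 = N" and c: "pcol N A (col s)" and E: "cedges (col s) = E" using s by (auto simp: ready_def)
  have R: "crel (s ''n'' 0) (\<lambda>k. s (cn k)) (s ''h'') = crel N (col s) (s ''h'')"
    unfolding crel_def N by (auto simp: col_def N)
  have sym: "sym (crel N (col s) (s ''h''))" by (rule sym_crel[OF c]) (use h E in auto)
  have b: "s (cn k) v < s ''n'' 0" if "k < 3" "v < s ''n'' 0" for k v
    using pcolD(5)[OF c that(1), of v] that(2) N by (simp add: col_def)
  have "run count s ''z'' 0 = card (comps {..<N} (crel N (col s) (s ''h'')))"
    using count_correct(1)[of s] sym b R N by simp
  then show ?thesis using rtrancl_crel[OF c, of "s ''h''"] E by (simp add: comps_def)
qed

lemma factor_cong:
  assumes "\<And>v. v \<in> Domain E \<Longrightarrow> h v = h' v"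
  shows "factor E h = factor E h'"
proof -
  have "h u = h' u" if "(u, v) \<in> E" for u v using assms[of u] that by auto
  then show ?thesis by (auto simp: factor_def)
qed

lemma setmate_count:
  assumes s: "ready N A s E" and d: "d < 3"
  shows "run (setmate d ;; count) s ''z'' 0 = card (comps {..<N} (factor E (col s d)))"
proof -
  define r where "r = run (setmate d) s"
  have N: "s ''n'' 0 = N" and c: "pcol N A (col s)" and E: "cedges (col s) = E" using s by (auto simp: ready_def)
  have rd: "ready N A r E" using s by (subst ready_cong[of _ s]) (auto simp: r_def run_frame)
  have EN: "v < N" if "v \<in> Domain E" for v using that cedges_bound[OF c] E by auto
  have h: "r ''h'' v = col s d v" if "v < N" for v using setmate_correct that N by (simp add: r_def col_def)
  have "run count r ''z'' 0 = card (comps {..<N} (factor E (r ''h'')))"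
  proof (rule count_factor[OF rd])
    fix v assume v: "v \<in> Domain E"
    have "col s d v < N" using pcolD(5)[OF c d EN[OF v]] .
    then show "r ''h'' (r ''h'' v) = v" using h EN[OF v] pcolD(1)[OF c d] by simp
  qed
  also have "factor E (r ''h'') = factor E (col s d)" by (rule factor_cong) (use h EN in auto)
  finally show ?thesis by (simp add: r_def)
qed

text \<open>The objective of the local search. Counting over \<open>{..<N}\<close> adds the same
  number of isolated vertices to each of the three summands.\<close>

definition fcount :: "nat \<Rightarrow> (nat \<Rightarrow> nat \<Rightarrow> nat) \<Rightarrow> nat" where
  "fcount N c = card (comps {..<N} (factor (cedges c) (c 0))) + card (comps {..<N} (factor (cedges c) (c 1))) +
     card (comps {..<N} (factor (cedges c) (c 2)))"

definition tot1 :: "nat \<Rightarrow> prog" where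
  "tot1 d = (setmate d ;; count) ;; Set ''g'' (Plus (val ''g'') (val ''z''))"

definition total :: prog where
  "total = Set ''g'' (Const 0) ;; tot1 0 ;; tot1 1 ;; tot1 2"

lemma wr_tot1 [simp]: "wr (tot1 d) = {''i'', ''h'', ''j'', ''l'', ''z'', ''g''}" and ok_tot1 [simp]: "ok (tot1 d)"
  by (auto simp: tot1_def)

lemma wr_total [simp]: "wr total = {''i'', ''h'', ''j'', ''l'', ''z'', ''g''}" and ok_total [simp]: "ok total"
  by (auto simp: total_def)

lemma col_frame:
  assumes "\<And>k. cn k \<notin> wr p" "ok p"
  shows "col (run p s) = col s"
  using assms by (auto simp: col_def fun_eq_iff run_frame)

lemma ready_frame:
  assumes "\<And>k. cn k \<notin> wr p" "ok p"
  shows "ready N A (run p s) E = ready N A s E"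
  using assms by (intro ready_cong) (auto simp: run_frame)

lemma tot1_correct:
  assumes s: "ready N A s E" and d: "d < 3"
  shows "run (tot1 d) s ''g'' 0 = s ''g'' 0 + card (comps {..<N} (factor E (col s d)))"
proof -
  have "run (setmate d ;; count) s ''g'' = s ''g''" by (rule run_frame) simp
  then show ?thesis using setmate_count[OF assms] by (simp add: tot1_def)
qed

lemma total_correct:
  assumes s: "ready N A s E"
  shows "run total s ''g'' 0 = fcount N (col s)"
proof -
  define s1 where "s1 = run (Set ''g'' (Const 0)) s"
  define s2 where "s2 = run (tot1 0) s1"
  define s3 where "s3 = run (tot1 1) s2"
  have r1: "ready N A s1 E" "col s1 = col s" unfolding s1_def using s by (auto simp: ready_frame col_frame simp del: run.simps)
  have r2: "ready N A s2 E" "col s2 = col s" unfolding s2_def using r1 by (auto simp: ready_frame col_frame)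
  have r3: "ready N A s3 E" "col s3 = col s" unfolding s3_def using r2 by (auto simp: ready_frame col_frame)
  have "run total s = run (tot1 2) s3" by (simp add: total_def s1_def s2_def s3_def)
  moreover have "s1 ''g'' 0 = 0" by (simp add: s1_def)
  moreover have "cedges (col s) = E" using s by (simp add: ready_def)
  ultimately show ?thesis
    using tot1_correct[OF r1(1), of 0] tot1_correct[OF r2(1), of 1] tot1_correct[OF r3(1), of 2] r1 r2 r3
    by (simp add: fcount_def s2_def[symmetric] s3_def[symmetric] del: One_nat_def)
qed

abbreviation kcomp :: "nat \<Rightarrow> (nat \<Rightarrow> nat \<Rightarrow> nat) \<Rightarrow> nat \<Rightarrow> nat \<Rightarrow> nat set" where
  "kcomp N c d v \<equiv> (crel N c (c d))\<^sup>* `` {v}"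

lemma kempe_kempe: "a \<noteq> b \<Longrightarrow> kempe (kempe c a b K) a b K = c"
  by (auto simp: kempe_def fun_eq_iff)

text \<open>The chain of a vertex is the same before and after the swap, so performing the swap
  again undoes it. \<open>try_swap\<close> restores the colouring in this way after an attempt
  without gain.\<close>

lemma crel_kempe:
  assumes "a < 3" "b < 3" "a \<noteq> b" "d \<noteq> a" "d \<noteq> b"
  shows "crel N (kempe c a b K) (kempe c a b K d) = crel N c (c d)"
proof -
  have "(\<exists>k<3. w = kempe c a b K k v) \<longleftrightarrow> (\<exists>k<3. w = c k v)" for v w
  proof
    assume "\<exists>k<3. w = kempe c a b K k v"
    then show "\<exists>k<3. w = c k v" using assms by (auto simp: kempe_def split: if_splits)
  next
    assume "\<exists>k<3. w = c k v"
    then obtain k where k: "k < 3" "w = c k v" by blast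
    show "\<exists>k<3. w = kempe c a b K k v"
      by (rule exI[of _ "if v \<in> K then if k = a then b else if k = b then a else k else k"])
        (use k assms in \<open>auto simp: kempe_def\<close>)
  qed
  moreover have "kempe c a b K d = c d" using assms by (auto simp: kempe_def fun_eq_iff)
  ultimately show ?thesis by (simp add: crel_def)
qed

definition try_swap :: "nat \<Rightarrow> nat \<Rightarrow> nat \<Rightarrow> prog" where
  "try_swap a b d = Ite (Less (val ''x'') (val ''n''))
     (kswap a b d ''x'' ;; total ;; Ite (Less (val ''g'') (val ''G'')) (Set ''G'' (val ''g'')) (kswap a b d ''x'')) Nop"

definition search_inv :: "nat \<Rightarrow> nat set \<Rightarrow> nat rel \<Rightarrow> state \<Rightarrow> bool" where
  "search_inv N A E r \<longleftrightarrow> ready N A r E \<and> r ''G'' 0 = fcount N (col r)"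

definition no_gain :: "nat \<Rightarrow> nat \<Rightarrow> nat \<Rightarrow> nat \<Rightarrow> (nat \<Rightarrow> nat \<Rightarrow> nat) \<Rightarrow> nat \<Rightarrow> bool" where
  "no_gain N a b d c v \<longleftrightarrow> (v < N \<longrightarrow> fcount N c \<le> fcount N (kempe c a b (kcomp N c d v)))"

lemma wr_try_swap: "wr (try_swap a b d) = {''i'', ''h'', ''j'', ''l'', ''z'', ''t'', ''g'', ''G'', cn a, cn b}"
  and ok_try_swap [simp]: "ok (try_swap a b d)"
  by (auto simp: try_swap_def)

lemma kswap_ready:
  assumes s: "ready N A s E" and ab: "a < 3" "b < 3" "a \<noteq> b" and d: "d < 3" "d \<noteq> a" "d \<noteq> b" and x: "s ''x'' 0 < N"
  shows "ready N A (run (kswap a b d ''x'') s) E"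
    "col (run (kswap a b d ''x'') s) = kempe (col s) a b (kcomp N (col s) d (s ''x'' 0))"
proof -
  have N: "s ''n'' 0 = N" and c: "pcol N A (col s)" and E: "cedges (col s) = E" using s by (auto simp: ready_def)
  show e: "col (run (kswap a b d ''x'') s) = kempe (col s) a b (kcomp N (col s) d (s ''x'' 0))"
    using kswap_correct[of s A a b d "''x''"] c ab d x N by simp
  have cl: "col s a v \<in> kcomp N (col s) d (s ''x'' 0) \<and> col s b v \<in> kcomp N (col s) d (s ''x'' 0)"
    if "v \<in> kcomp N (col s) d (s ''x'' 0)" for v
    using kempe_component_closed[OF c d(1) _ _ x that] ab d by auto
  show "ready N A (run (kswap a b d ''x'') s) E"
    using kempe_correct[OF c ab cl] N E unfolding ready_def e by simp
qed

lemma scan_try_swap: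
  assumes ab: "a < 3" "b < 3" "a \<noteq> b" and d: "d < 3" "d \<noteq> a" "d \<noteq> b"
  shows "scan (search_inv N A E) col (fcount N) (\<lambda>c f. no_gain N a b d c (f ''x'')) (try_swap a b d)"
proof -
  let ?p = "try_swap a b d"
  have "search_inv N A E (run ?p s) \<and> (if no_gain N a b d (col s) (s ''x'' 0) then col (run ?p s) = col s
      else fcount N (col (run ?p s)) < fcount N (col s))" if s: "search_inv N A E s" for s
  proof -
    have rd: "ready N A s E" and G: "s ''G'' 0 = fcount N (col s)" using s by (auto simp: search_inv_def)
    have N: "s ''n'' 0 = N" using rd by (simp add: ready_def)
    show ?thesis
    proof (cases "s ''x'' 0 < N")
      case False
      then show ?thesis using s N by (simp add: try_swap_def no_gain_def)
    next
      case x: True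
      let ?K = "kcomp N (col s) d (s ''x'' 0)"
      define s1 where "s1 = run (kswap a b d ''x'') s"
      define s2 where "s2 = run total s1"
      have r1: "ready N A s1 E" "col s1 = kempe (col s) a b ?K" using kswap_ready[OF rd ab d x] by (auto simp: s1_def)
      have r2: "ready N A s2 E" "col s2 = col s1" unfolding s2_def using r1 by (auto simp: ready_frame col_frame)
      have g: "s2 ''g'' 0 = fcount N (col s1)" unfolding s2_def by (rule total_correct[OF r1(1)])
      have f: "s2 ''x'' = s ''x''" "s2 ''G'' = s ''G''" by (simp_all add: s2_def s1_def run_frame)
      have run: "run ?p s = (if s2 ''g'' 0 < s2 ''G'' 0 then run (Set ''G'' (val ''g'')) s2 else run (kswap a b d ''x'') s2)"
        using x N by (simp add: try_swap_def s1_def s2_def)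
      show ?thesis
      proof (cases "s2 ''g'' 0 < s2 ''G'' 0")
        case True
        define s3 where "s3 = run (Set ''G'' (val ''g'')) s2"
        have "ready N A s3 E" "col s3 = col s2" unfolding s3_def using r2 by (auto simp: ready_frame col_frame simp del: run.simps)
        moreover have "s3 ''G'' 0 = s2 ''g'' 0" by (simp add: s3_def)
        moreover have "run ?p s = s3" using run True by (simp add: s3_def)
        moreover have "\<not> no_gain N a b d (col s) (s ''x'' 0)" using True g f G r1 x by (simp add: no_gain_def)
        ultimately show ?thesis using g r2 True f G by (simp add: search_inv_def)
      next
        case False
        have x2: "s2 ''x'' 0 < N" using x f by simp
        have k2: "kcomp N (col s2) d (s2 ''x'' 0) = ?K"
          using crel_kempe[OF ab d(2,3), of N "col s" ?K] r1 r2 f by simp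
        have "col (run (kswap a b d ''x'') s2) = col s"
          using kswap_ready(2)[OF r2(1) ab d x2] k2 r1 r2 kempe_kempe[OF ab(3)] by simp
        moreover have "ready N A (run (kswap a b d ''x'') s2) E" by (rule kswap_ready(1)[OF r2(1) ab d x2])
        moreover have "run (kswap a b d ''x'') s2 ''G'' = s ''G''" using f by (simp add: run_frame)
        moreover have "no_gain N a b d (col s) (s ''x'' 0)" using False g f G r1 x by (simp add: no_gain_def)
        ultimately show ?thesis using run False G by (simp add: search_inv_def)
      qed
    qed
  qed
  then show ?thesis unfolding scan_def by simp
qed

definition search_pass :: prog where
  "search_pass = For 1 ''x'' (try_swap 0 1 2) ;; For 1 ''x'' (try_swap 0 2 1) ;; For 1 ''x'' (try_swap 1 2 0)"

text \<open>The objective is at most \<open>3 * n\<close> initially, so \<open>4 * n\<close> passes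
  are enough to reach a local optimum.\<close>

definition search :: prog where
  "search = (total ;; Set ''G'' (val ''g'')) ;; For 4 ''y'' search_pass"

lemma wr_search: "wr search = {''i'', ''h'', ''j'', ''l'', ''z'', ''t'', ''g'', ''G'', ''x'', ''y'', cn 0, cn 1, cn 2}"
  and ok_search [simp]: "ok search"
  by (auto simp: search_def search_pass_def wr_try_swap)

lemma search_inv_upd:
  assumes "x \<notin> {''n'', ''G''}" "\<And>k. x \<noteq> cn k"
  shows "search_inv N A E (r(x := f)) = search_inv N A E r" "col (r(x := f)) = col r"
proof -
  show e: "col (r(x := f)) = col r" using assms by (auto simp: col_def fun_eq_iff)
  have "ready N A (r(x := f)) E = ready N A r E" using assms by (intro ready_cong) auto
  then show "search_inv N A E (r(x := f)) = search_inv N A E r" using e assms by (auto simp: search_inv_def)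
qed

lemma card_comps_le: "finite V \<Longrightarrow> card (comps V R) \<le> card V"
  unfolding comps_def by (rule card_image_le)

lemma search_correct:
  assumes s: "ready N A s E" and N: "0 < N"
  defines "r \<equiv> run search s"
  shows "ready N A r E"
    "\<And>v. v < N \<Longrightarrow> fcount N (col r) \<le> fcount N (kempe (col r) 0 1 (kcomp N (col r) 2 v))"
    "\<And>v. v < N \<Longrightarrow> fcount N (col r) \<le> fcount N (kempe (col r) 0 2 (kcomp N (col r) 1 v))"
    "\<And>v. v < N \<Longrightarrow> fcount N (col r) \<le> fcount N (kempe (col r) 1 2 (kcomp N (col r) 0 v))"
proof -
  let ?S = "scan (search_inv N A E) col (fcount N)"
  have n: "\<forall>r. search_inv N A E r \<longrightarrow> r ''n'' 0 = N" by (simp add: search_inv_def ready_def)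
  have loop: "?S (\<lambda>c f. \<forall>v<N. no_gain N a b d c v) (For 1 ''x'' (try_swap a b d))"
    if ab: "a < 3" "b < 3" "a \<noteq> b" and d: "d < 3" "d \<noteq> a" "d \<noteq> b" for a b d
  proof -
    have "?S (\<lambda>c f. \<forall>v<N. no_gain N a b d c ((f(''x'' := v)) ''x'')) (For 1 ''x'' (try_swap a b d))"
      by (rule scan_For[where Q = "\<lambda>c f. no_gain N a b d c (f ''x'')", OF scan_try_swap[OF ab d] _ _ n])
        (auto simp: search_inv_upd wr_try_swap)
    then show ?thesis by simp
  qed
  let ?Q = "\<lambda>c. (\<forall>v<N. no_gain N 0 1 2 c v) \<and> (\<forall>v<N. no_gain N 0 2 1 c v) \<and> (\<forall>v<N. no_gain N 1 2 0 c v)"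
  have pass: "?S (\<lambda>c f. ?Q c) search_pass"
    unfolding search_pass_def by (rule scan_Sq[OF loop scan_Sq[OF loop loop]]) auto
  define s1 where "s1 = run (total ;; Set ''G'' (val ''g'')) s"
  have i: "search_inv N A E s1"
  proof -
    have "ready N A s1 E" "col s1 = col s" unfolding s1_def using s by (auto simp: ready_frame col_frame simp del: run.simps)
    moreover have "s1 ''G'' 0 = fcount N (col s)" using total_correct[OF s] by (simp add: s1_def)
    ultimately show ?thesis by (simp add: search_inv_def)
  qed
  have "card (comps {..<N} R) \<le> N" for R using card_comps_le[of "{..<N}" R] by simp
  then have "fcount N (col s1) \<le> N + N + N" unfolding fcount_def by (intro add_mono)
  then have bnd: "fcount N (col s1) < 4 * N" using N by simp
  have w: "''y'' \<notin> wr search_pass" "''y'' \<noteq> ''n''" by (simp_all add: search_pass_def wr_try_swap)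
  have ins: "search_inv N A E (r(''y'' := f)) = search_inv N A E r" "col (r(''y'' := f)) = col r" for r f
    by (simp_all add: search_inv_upd)
  note rep = scan_repeat[where Inv = "search_inv N A E" and core = col and \<mu> = "fcount N" and Q = "\<lambda>c f. ?Q c"
      and p = search_pass and x = "''y''" and k = 4 and N = N and s = s1, OF pass w(2,1) i n ins refl bnd]
  have run: "r = run (For 4 ''y'' search_pass) s1" by (simp add: r_def search_def s1_def)
  show "ready N A r E" unfolding run using rep(1) by (simp add: search_inv_def)
  have Q: "?Q (col r)" unfolding run by (rule rep(2))
  show "\<And>v. v < N \<Longrightarrow> fcount N (col r) \<le> fcount N (kempe (col r) 0 1 (kcomp N (col r) 2 v))"
    "\<And>v. v < N \<Longrightarrow> fcount N (col r) \<le> fcount N (kempe (col r) 0 2 (kcomp N (col r) 1 v))"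
    "\<And>v. v < N \<Longrightarrow> fcount N (col r) \<le> fcount N (kempe (col r) 1 2 (kcomp N (col r) 0 v))"
    using Q by (auto simp: no_gain_def)
qed

section \<open>Local optima have few cycles\<close>

text \<open>A missing colour would leave only two possible neighbours.\<close>

lemma cubic_all_colours:
  assumes c: "pcol N A c" and cub: "cubic_bip A (cedges c)" and v: "v \<in> Domain (cedges c)" and k: "k < 3"
  shows "c k v \<noteq> v"
proof
  assume e: "c k v = v"
  have "cedges c `` {v} \<subseteq> (\<lambda>j. c j v) ` ({..<3} - {k})"
  proof
    fix w assume "w \<in> cedges c `` {v}"
    then obtain j where "j < 3" "c j v = w" "v \<noteq> w" by (auto simp: cedges_iff)
    then show "w \<in> (\<lambda>j. c j v) ` ({..<3} - {k})" using e by auto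
  qed
  then have "card (cedges c `` {v}) \<le> card ((\<lambda>j. c j v) ` ({..<3} - {k}))" by (intro card_mono) auto
  also have "\<dots> \<le> card ({..<3::nat} - {k})" by (rule card_image_le) simp
  also have "\<dots> = 2" using k by simp
  finally show False using cub v by (simp add: cubic_bip_def)
qed

lemma factor_bic:
  assumes c: "pcol N A c" and cub: "cubic_bip A (cedges c)" and abd: "{..<3} = {a, b, d}" "distinct [a, b, d]"
  shows "factor (cedges c) (c d) = bic (Domain (cedges c)) (c a) (c b)"
proof -
  have abd': "a < 3" "b < 3" "d < 3" using abd(1) by auto
  have "(u, v) \<in> factor (cedges c) (c d) \<longleftrightarrow> (u, v) \<in> bic (Domain (cedges c)) (c a) (c b)" for u v
  proof
    assume "(u, v) \<in> factor (cedges c) (c d)"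
    then have uv: "(u, v) \<in> cedges c" "v \<noteq> c d u" by (auto simp: factor_def)
    then obtain k where "k < 3" "c k u = v" by (auto simp: cedges_iff)
    then have "k \<in> {a, b, d}" "c k u = v" using abd(1) by auto
    then show "(u, v) \<in> bic (Domain (cedges c)) (c a) (c b)" using uv by (auto simp: bic_def)
  next
    assume "(u, v) \<in> bic (Domain (cedges c)) (c a) (c b)"
    then have u: "u \<in> Domain (cedges c)" and v: "v = c a u \<or> v = c b u" by (auto simp: bic_def)
    note A = cubic_all_colours[OF c cub u]
    have "(u, v) \<in> cedges c" using v A abd' by (auto simp: cedges_iff) metis+
    moreover have "c a u \<noteq> c d u" "c b u \<noteq> c d u" using pcolD(4)[OF c, of _ d u] A abd' abd(2) by auto
    ultimately show "(u, v) \<in> factor (cedges c) (c d)" using v by (auto simp: factor_def)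
  qed
  then show ?thesis by auto
qed

lemma tricoloured_pcol:
  assumes c: "pcol N A c" and cub: "cubic_bip A (cedges c)"
  shows "tricoloured (Domain (cedges c)) A (c 0) (c 1) (c 2)"
    "tricoloured.edges (Domain (cedges c)) (c 0) (c 1) (c 2) = cedges c"
proof -
  let ?V = "Domain (cedges c)"
  note D = pcolD[OF c] and A = cubic_all_colours[OF c cub]
  have cl: "c k v \<in> ?V" if "v \<in> ?V" "k < 3" for k v
  proof -
    have "(v, c k v) \<in> cedges c" using A[OF that] that(2) cedges_iff by metis
    then show ?thesis using sym_cedges[OF c] by (meson Domain.DomainI symD)
  qed
  show t: "tricoloured ?V A (c 0) (c 1) (c 2)"
  proof
    show "finite ?V" using finite_cedges[OF c] by (simp add: finite_Domain)
    fix v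
    show "c 0 (c 0 v) = v" "c 1 (c 1 v) = v" "c 2 (c 2 v) = v" using D(1) by simp_all
    assume v: "v \<in> ?V"
    show "c 0 v \<in> ?V" "c 1 v \<in> ?V" "c 2 v \<in> ?V" using cl[OF v] by simp_all
    show "c 0 v \<noteq> c 1 v" "c 0 v \<noteq> c 2 v" "c 1 v \<noteq> c 2 v"
      using D(4)[of 0 1 v] D(4)[of 0 2 v] D(4)[of 1 2 v] A[OF v] by auto
    show "c 0 v \<in> A \<longleftrightarrow> v \<notin> A" "c 1 v \<in> A \<longleftrightarrow> v \<notin> A" "c 2 v \<in> A \<longleftrightarrow> v \<notin> A"
      using D(3)[of _ v] A[OF v] by simp_all
  qed
  have "(u, v) \<in> tricoloured.edges ?V (c 0) (c 1) (c 2) \<longleftrightarrow> (u, v) \<in> cedges c" for u v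
  proof
    assume "(u, v) \<in> tricoloured.edges ?V (c 0) (c 1) (c 2)"
    then have u: "u \<in> ?V" "v = c 0 u \<or> v = c 1 u \<or> v = c 2 u" unfolding tricoloured.edges_def[OF t] by auto
    then obtain k where "k < 3" "v = c k u" by (metis less3)
    then show "(u, v) \<in> cedges c" using A[OF u(1)] cedges_iff by metis
  next
    assume uv: "(u, v) \<in> cedges c"
    then obtain k where "k < 3" "c k u = v" by (auto simp: cedges_iff)
    then show "(u, v) \<in> tricoloured.edges ?V (c 0) (c 1) (c 2)"
      unfolding tricoloured.edges_def[OF t] less3 using uv by auto
  qed
  then show "tricoloured.edges ?V (c 0) (c 1) (c 2) = cedges c" by auto
qed

lemma fcount_bic:
  assumes c: "pcol N A c" and cub: "cubic_bip A (cedges c)"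
  defines "V \<equiv> Domain (cedges c)"
  shows "fcount N c = card (comps V (bic V (c 0) (c 1))) + card (comps V (bic V (c 0) (c 2))) +
    card (comps V (bic V (c 1) (c 2))) + 3 * card ({..<N} - V)"
proof -
  have V: "V \<subseteq> {..<N}" using cedges_bound[OF c] by (auto simp: V_def)
  note t = tricoloured_pcol(1)[OF c cub, folded V_def]
  note sub = tricoloured.sub_ab[OF t] tricoloured.sub_ac[OF t] tricoloured.sub_bc[OF t]
  have e: "{..<3} = {1, 2, 0::nat}" "{..<3} = {0, 2, 1::nat}" "{..<3} = {0, 1, 2::nat}" by auto
  have f: "factor (cedges c) (c 0) = bic V (c 1) (c 2)" "factor (cedges c) (c 1) = bic V (c 0) (c 2)"
    "factor (cedges c) (c 2) = bic V (c 0) (c 1)"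
    unfolding V_def using factor_bic[OF c cub e(1)] factor_bic[OF c cub e(2)] factor_bic[OF c cub e(3)] by auto
  show ?thesis unfolding fcount_def f
    using card_comps_superset[OF _ V sub(1)] card_comps_superset[OF _ V sub(2)] card_comps_superset[OF _ V sub(3)] by simp
qed

lemma bic_swapf: "bic V (swapf K a b) (swapf K b a) = bic V a b"
  by (auto simp: bic_def swapf_def)

text \<open>The maximum with 7 accounts for graphs that contraction has made too small for
  discharging, such as \<open>K_3,3\<close>: on fewer than eight vertices a bicoloured factor is a
  single cycle. From eight vertices on, one of the three factors is at most average.\<close>

theorem local_optimum_few_cycles:
  assumes c: "pcol N A c" and cub: "cubic_bip A (cedges c)"
    and nb: "\<And>x1 x2 x3 x4 p q. \<not> bad_square (cedges c) x1 x2 x3 x4 p q"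
    and opt: "\<And>v. v < N \<Longrightarrow> fcount N c \<le> fcount N (kempe c 0 1 (kcomp N c 2 v))"
      "\<And>v. v < N \<Longrightarrow> fcount N c \<le> fcount N (kempe c 0 2 (kcomp N c 1 v))"
      "\<And>v. v < N \<Longrightarrow> fcount N c \<le> fcount N (kempe c 1 2 (kcomp N c 0 v))"
  defines "V \<equiv> Domain (cedges c)"
  shows "\<exists>d<3. 7 * card (comps V (factor (cedges c) (c d))) \<le> max 7 (card V)"
proof -
  note t = tricoloured_pcol[OF c cub, folded V_def]
  have VN: "V \<subseteq> {..<N}" using cedges_bound[OF c] by (auto simp: V_def)
  have e: "{..<3} = {1, 2, 0::nat}" "{..<3} = {0, 2, 1::nat}" "{..<3} = {0, 1, 2::nat}" by auto
  have f: "factor (cedges c) (c 0) = bic V (c 1) (c 2)" "factor (cedges c) (c 1) = bic V (c 0) (c 2)"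
    "factor (cedges c) (c 2) = bic V (c 0) (c 1)"
    unfolding V_def using factor_bic[OF c cub e(1)] factor_bic[OF c cub e(2)] factor_bic[OF c cub e(3)] by auto
  show ?thesis
  proof (cases "card V \<ge> 8")
    case False
    interpret T: tricoloured V A "c 0" "c 1" "c 2" by (rule t(1))
    have "real (card (comps V (bic V (c 0) (c 2)))) = (\<Sum>v\<in>V. 1 / real (card (T.comp_ac v)))"
      by (rule card_comps_eq_sum[OF T.fin T.sym_ac T.sub_ac])
    \<comment> \<open>Every class has at least four vertices and \<open>V\<close> fewer than eight,
      so the number of classes is below 2.\<close>
    also have "\<dots> \<le> (\<Sum>v\<in>V. 1 / 4)"
    proof (rule sum_mono)
      fix v assume "v \<in> V"
      then show "1 / real (card (T.comp_ac v)) \<le> 1 / 4" using T.card_comp_ge_4 by (intro frac_le) auto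
    qed
    also have "\<dots> < 2" using False by simp
    finally have "card (comps V (factor (cedges c) (c 1))) \<le> 1" unfolding f by simp
    then show ?thesis by (intro exI[of _ 1]) auto
  next
    case True
    have con: "S = V" if S: "S \<subseteq> V" "S \<noteq> {}" "\<And>v. v \<in> S \<Longrightarrow> c 0 v \<in> S \<and> c 1 v \<in> S \<and> c 2 v \<in> S" for S
    proof
      obtain s where s: "s \<in> S" using S(2) by auto
      show "V \<subseteq> S"
      proof
        fix v assume "v \<in> V"
        then have "(s, v) \<in> (cedges c)\<^sup>*" using cub s S(1) unfolding cubic_bip_def V_def by blast
        then show "v \<in> S"
        proof (rule rtrancl_closed)
          fix x y assume x: "x \<in> S" "(x, y) \<in> cedges c"
          then obtain k where "k < 3" "c k x = y" by (auto simp: cedges_iff)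
          then show "y \<in> S" using S(3)[OF x(1)] unfolding less3 by auto
        qed (rule s)
      qed
    qed (rule S(1))
    have sq: "squareless V A (c 0) (c 1) (c 2)"
    proof (intro squareless.intro t(1) squareless_axioms.intro)
      show "\<not> bad_square (tricoloured.edges V (c 0) (c 1) (c 2)) x1 x2 x3 x4 p q" for x1 x2 x3 x4 p q
        unfolding t(2) by (rule nb)
    qed (rule con, assumption+, rule True)
    \<comment> \<open>The number of cycles in the swapped colour pair and the offset for isolated
      vertices agree before and after the swap, so they cancel from the inequality between values of
      \<open>fcount\<close>.\<close>
    have kop: "kempe_optimal V (c a) (c b) (c d)"
      if op: "\<And>v. v < N \<Longrightarrow> fcount N c \<le> fcount N (kempe c a b (kcomp N c d v))"
        and abd: "(a, b, d) \<in> {(0, 1, 2), (0, 2, 1), (1, 2, 0)}" for a b d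
      unfolding kempe_optimal_def
    proof
      fix v assume v: "v \<in> V"
      let ?K = "(bic V (c a) (c b))\<^sup>* `` {v}"
      have s: "{..<3} = {a, b, d}" "distinct [a, b, d]" "a < 3" "b < 3" "d < 3" "a \<noteq> b" "a \<noteq> d" "b \<noteq> d" using abd by auto
      have K: "kcomp N c d v = ?K"
        unfolding rtrancl_crel[OF c] factor_bic[OF c cub s(1,2)] V_def ..
      have vN: "v < N" using v VN by auto
      let ?c = "kempe c a b ?K"
      have cl: "c a u \<in> ?K \<and> c b u \<in> ?K" if "u \<in> ?K" for u
        using kempe_component_closed[OF c s(5) _ _ vN] that s unfolding K by blast
      have kc1: "pcol N A ?c" by (rule kempe_correct(1)[OF c s(3,4,6) cl])
      have kc2: "cedges ?c = cedges c" by (rule kempe_correct(2)[OF c s(3,4,6) cl])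
      have cub': "cubic_bip A (cedges ?c)" unfolding kc2 by (rule cub)
      have fc: "fcount N ?c = card (comps V (bic V (?c 0) (?c 1))) + card (comps V (bic V (?c 0) (?c 2))) +
          card (comps V (bic V (?c 1) (?c 2))) + 3 * card ({..<N} - V)"
        using fcount_bic[OF kc1 cub'] unfolding kc2 V_def[symmetric] .
      have fc0: "fcount N c = card (comps V (bic V (c 0) (c 1))) + card (comps V (bic V (c 0) (c 2))) +
          card (comps V (bic V (c 1) (c 2))) + 3 * card ({..<N} - V)"
        using fcount_bic[OF c cub] unfolding V_def .
      have ab: "?c a = swapf ?K (c a) (c b)" "?c b = swapf ?K (c b) (c a)" "?c d = c d"
        using s by (auto simp: kempe_def swapf_def fun_eq_iff)
      have cm: "bic V (c b) (c a) = bic V (c a) (c b)" "bic V x y = bic V y x" for x y by (rule bic_commute)+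
      have "fcount N c \<le> fcount N ?c" using op[OF vN] unfolding K .
      then show "card (comps V (bic V (c a) (c d))) + card (comps V (bic V (c b) (c d))) \<le>
          card (comps V (bic V (swapf ?K (c a) (c b)) (c d))) + card (comps V (bic V (swapf ?K (c b) (c a)) (c d)))"
        unfolding fc fc0 ab[symmetric]
        using abd ab bic_swapf[of V ?K "c a" "c b"] bic_commute[of V "c d" "?c a"] bic_commute[of V "c d" "?c b"]
          bic_commute[of V "c d" "c a"] bic_commute[of V "c d" "c b"]
        by (elim insertE) auto
    qed
    have "7 * (card (comps V (bic V (c 0) (c 1))) + card (comps V (bic V (c 0) (c 2))) + card (comps V (bic V (c 1) (c 2)))) \<le> 3 * card V"
      by (rule squareless.kempe_optimal_bound[OF sq kop kop kop]) (use opt in auto)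
    \<comment> \<open>The least of three numbers is at most their average.\<close>
    moreover have "7 * x \<le> v \<or> 7 * y \<le> v \<or> 7 * z \<le> v" if "7 * (x + y + z) \<le> 3 * v" for x y z v :: nat
      using that by (cases "7 * x \<le> v"; cases "7 * y \<le> v") auto
    ultimately have "7 * card (comps V (bic V (c 0) (c 1))) \<le> card V \<or> 7 * card (comps V (bic V (c 0) (c 2))) \<le> card V \<or>
        7 * card (comps V (bic V (c 1) (c 2))) \<le> card V" by blast
    then have "\<exists>d\<in>{2, 1, 0}. 7 * card (comps V (factor (cedges c) (c d))) \<le> card V" using f by auto
    then obtain d where d: "d \<in> {2, 1, 0}" "7 * card (comps V (factor (cedges c) (c d))) \<le> card V" by blast
    moreover have "d < 3" using d(1) by auto
    ultimately show ?thesis by (intro exI[of _ d]) auto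
  qed
qed

section \<open>Choosing the best colour class\<close>

definition setH :: "nat \<Rightarrow> prog" where
  "setH d = For 1 ''w'' (Asg ''H'' (val ''w'') (Cell (cn d) (val ''w'')))"

text \<open>That some colour class is good is only an existence statement, so the cycles of all
  three complements are counted and a minimal one is taken.\<close>

definition pick :: prog where
  "pick = ((setmate 0 ;; count) ;; Set ''r'' (val ''z'')) ;; ((setmate 1 ;; count) ;; Set ''s'' (val ''z'')) ;;
     (setmate 2 ;; count) ;;
     Ite (And (Not (Less (val ''s'') (val ''r''))) (Not (Less (val ''z'') (val ''r'')))) (setH 0)
       (Ite (Not (Less (val ''z'') (val ''s''))) (setH 1) (setH 2))"

lemma wr_setH [simp]: "wr (setH d) = {''w'', ''H''}" and ok_setH [simp]: "ok (setH d)"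
  by (auto simp: setH_def)

lemma wr_pick: "wr pick = {''i'', ''h'', ''j'', ''l'', ''z'', ''r'', ''s'', ''w'', ''H''}" and ok_pick [simp]: "ok pick"
  by (auto simp: pick_def)

lemma setH_correct:
  assumes "v < s ''n'' 0"
  shows "run (setH d) s ''H'' v = s (cn d) v"
proof -
  have "\<forall>v < 1 * s ''n'' 0. run (setH d) s ''H'' v = s (cn d) v"
    unfolding setH_def
  proof (rule run_For[where I = "\<lambda>i r. \<forall>v < i. r ''H'' v = s (cn d) v"])
    fix i r assume r: "r ''w'' 0 = i" "\<forall>v<i. r ''H'' v = s (cn d) v"
      "\<And>y. y \<notin> wr (Asg ''H'' (val ''w'') (Cell (cn d) (val ''w''))) \<Longrightarrow> y \<noteq> ''w'' \<Longrightarrow> r y = s y"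
    have "r (cn d) = s (cn d)" by (rule r(3)) auto
    then show "\<forall>v<Suc i. ((run (Asg ''H'' (val ''w'') (Cell (cn d) (val ''w''))) r)(''w'' := (run (Asg ''H'' (val ''w'') (Cell (cn d) (val ''w''))) r ''w'')(0 := Suc i))) ''H'' v = s (cn d) v"
      using r(1,2) by (auto simp: less_Suc_eq)
  qed auto
  then show ?thesis using assms by simp
qed

lemma pick_correct:
  assumes s: "ready N A s E"
  shows "\<exists>d<3. (\<forall>v<N. run pick s ''H'' v = col s d v) \<and>
    (\<forall>k<3. card (comps {..<N} (factor E (col s d))) \<le> card (comps {..<N} (factor E (col s k))))"
proof -
  let ?f = "\<lambda>k. card (comps {..<N} (factor E (col s k)))"
  define s1 where "s1 = run ((setmate 0 ;; count) ;; Set ''r'' (val ''z'')) s"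
  define s2 where "s2 = run ((setmate 1 ;; count) ;; Set ''s'' (val ''z'')) s1"
  define s3 where "s3 = run (setmate 2 ;; count) s2"
  have r1: "ready N A s1 E" "col s1 = col s" unfolding s1_def using s by (auto simp: ready_frame col_frame simp del: run.simps)
  have r2: "ready N A s2 E" "col s2 = col s" unfolding s2_def using r1 by (auto simp: ready_frame col_frame simp del: run.simps)
  have r3: "ready N A s3 E" "col s3 = col s" unfolding s3_def using r2 by (auto simp: ready_frame col_frame simp del: run.simps)
  have "s1 ''r'' 0 = ?f 0" using setmate_count[OF s, of 0] by (simp add: s1_def)
  moreover have "s3 ''r'' = s1 ''r''" unfolding s3_def s2_def by (subst run_frame, simp)+ simp
  ultimately have zr: "s3 ''r'' 0 = ?f 0" by simp
  have "s2 ''s'' 0 = ?f 1" using setmate_count[OF r1(1), of 1] r1(2) by (simp add: s2_def)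
  moreover have "s3 ''s'' = s2 ''s''" unfolding s3_def by (rule run_frame) simp
  ultimately have zs: "s3 ''s'' 0 = ?f 1" by simp
  have zz: "s3 ''z'' 0 = ?f 2" using setmate_count[OF r2(1), of 2] r2(2) by (simp add: s3_def)
  have N: "s3 ''n'' 0 = N" using r3 by (simp add: ready_def)
  define d :: nat where "d = (if ?f 0 \<le> ?f 1 \<and> ?f 0 \<le> ?f 2 then 0 else if ?f 1 \<le> ?f 2 then 1 else 2)"
  let ?ite = "Ite (And (Not (Less (val ''s'') (val ''r''))) (Not (Less (val ''z'') (val ''r'')))) (setH 0)
       (Ite (Not (Less (val ''z'') (val ''s''))) (setH 1) (setH 2))"
  have "run pick s = run ?ite s3" by (simp only: pick_def run.simps(3) s1_def s2_def s3_def)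
  also have "\<dots> = run (setH d) s3" using zr zs zz by (auto simp: d_def simp del: One_nat_def)
  finally have run: "run pick s = run (setH d) s3" .
  have "run pick s ''H'' v = col s d v" if "v < N" for v
    using setH_correct[of v s3 d] that N r3(2) unfolding run by (metis col_def)
  moreover have "d < 3" by (simp add: d_def)
  moreover have "?f d \<le> ?f k" if "k < 3" for k using that unfolding less3 by (auto simp: d_def)
  ultimately show ?thesis by blast
qed

section \<open>Expansion phase\<close>

text \<open>The array \<open>H\<close> holds the current perfect matching; \<open>h\<close> is scratch space of the recolouring.\<close>

definition pop :: prog where
  "pop = Set ''k'' (Minus (val ''k'') (Const 1)) ;; Set ''a'' (Cell ''A'' (val ''k'')) ;; Set ''b'' (Cell ''B'' (val ''k'')) ;;
     Set ''d'' (Cell ''D'' (val ''k'')) ;; Set ''e'' (Cell ''E'' (val ''k'')) ;; Set ''p'' (Cell ''P'' (val ''k'')) ;;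
     Set ''q'' (Cell ''Q'' (val ''k''))"

text \<open>The two edges added by the contraction go first. After that every intermediate graph is
  a subgraph of the expanded one, as the insertions require.\<close>

definition restore :: prog where
  "restore = del ''a'' ''p'' ;; del ''b'' ''q'' ;; ins ''d'' ''b'' ;; ins ''d'' ''e'' ;; ins ''d'' ''p'' ;; ins ''e'' ''a'' ;; ins ''e'' ''q''"

definition count_mate :: prog where
  "count_mate = For 1 ''w'' (Asg ''h'' (val ''w'') (Cell ''H'' (val ''w''))) ;; count"

definition mate_12 :: prog where
  "mate_12 = Asg ''H'' (val ''a'') (val ''b'') ;; Asg ''H'' (val ''b'') (val ''a'') ;; Asg ''H'' (val ''d'') (val ''e'') ;; Asg ''H'' (val ''e'') (val ''d'')"

definition mate_14 :: prog where
  "mate_14 = Asg ''H'' (val ''a'') (val ''e'') ;; Asg ''H'' (val ''e'') (val ''a'') ;; Asg ''H'' (val ''b'') (val ''d'') ;; Asg ''H'' (val ''d'') (val ''b'')"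

text \<open>How the outer paths pair the corners is not traced; both completions are counted and the
  better one is kept, which \<open>expand_square\<close> shows to be good enough.\<close>

definition mate_square :: prog where
  "mate_square = (mate_12 ;; count_mate ;; Set ''g'' (val ''z'')) ;; (mate_14 ;; count_mate) ;; Ite (Less (val ''g'') (val ''z'')) mate_12 Nop"

text \<open>\<open>x\<close> and \<open>y\<close> take the roles of \<open>w\<close> and
  \<open>g\<close> in \<open>expand_path\<close>.\<close>

definition mate_path :: prog where
  "mate_path =
     Ite (Eq (Cell ''H'' (val ''a'')) (val ''p'')) (Asg ''H'' (val ''d'') (val ''p'') ;; Asg ''H'' (val ''p'') (val ''d'') ;; Set ''x'' (val ''a'')) (Set ''x'' (val ''d'')) ;;
     Ite (Eq (Cell ''H'' (val ''b'')) (val ''q'')) (Asg ''H'' (val ''e'') (val ''q'') ;; Asg ''H'' (val ''q'') (val ''e'') ;; Set ''y'' (val ''b'')) (Set ''y'' (val ''e'')) ;;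
     Asg ''H'' (val ''x'') (val ''y'') ;; Asg ''H'' (val ''y'') (val ''x'')"

definition mate :: prog where
  "mate = Ite (Eq (Cell ''H'' (val ''a'')) (val ''b'')) mate_square mate_path"

definition expand1 :: prog where
  "expand1 = Ite (Less (Const 0) (val ''k'')) (pop ;; restore ;; mate) Nop"

text \<open>The stack holds at most \<open>n\<close> squares, so \<open>n\<close> guarded rounds
  empty it.\<close>

definition expand :: prog where
  "expand = For 1 ''f'' expand1"

lemma wr_pop [simp]: "wr pop = {''k'', ''a'', ''b'', ''d'', ''e'', ''p'', ''q''}" and ok_pop [simp]: "ok pop"
  by (auto simp: pop_def)

lemma wr_restore [simp]: "wr restore = {''i'', ''h'', ''j'', ''l'', ''z'', ''t'', cn 0, cn 1, cn 2}" and ok_restore [simp]: "ok restore"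
  by (auto simp: restore_def)

lemma wr_count_mate [simp]: "wr count_mate = {''w'', ''h'', ''i'', ''j'', ''l'', ''z''}" and ok_count_mate [simp]: "ok count_mate"
  by (auto simp: count_mate_def)

lemma wr_mates [simp]: "wr mate_12 = {''H''}" "wr mate_14 = {''H''}" "ok mate_12" "ok mate_14"
  by (auto simp: mate_12_def mate_14_def)

lemma wr_mate [simp]: "wr mate = {''H'', ''w'', ''h'', ''i'', ''j'', ''l'', ''z'', ''g'', ''x'', ''y''}" and ok_mate [simp]: "ok mate"
  by (auto simp: mate_def mate_square_def mate_path_def)

lemma ok_expand1 [simp]: "ok expand1" and ok_expand [simp]: "ok expand"
  by (auto simp: expand1_def expand_def)

lemma count_mate_correct:
  assumes s: "ready N A s E" and p: "perfect E (s ''H'')"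
  shows "run count_mate s ''z'' 0 = card (comps {..<N} (factor E (s ''H'')))"
proof -
  let ?p = "For 1 ''w'' (Asg ''h'' (val ''w'') (Cell ''H'' (val ''w'')))"
  define r where "r = run ?p s"
  have N: "s ''n'' 0 = N" and c: "pcol N A (col s)" and E: "cedges (col s) = E" using s by (auto simp: ready_def)
  have rd: "ready N A r E" unfolding r_def using s by (subst ready_frame) auto
  have EN: "v < N" if "v \<in> Domain E" for v using that cedges_bound[OF c] E by auto
  have "\<forall>v < 1 * N. run ?p s ''h'' v = s ''H'' v"
  proof (rule run_For[where I = "\<lambda>i r. \<forall>v < i. r ''h'' v = s ''H'' v"])
    show "s ''n'' 0 = N" by (rule N)
    fix i r assume r: "r ''w'' 0 = i" "\<forall>v<i. r ''h'' v = s ''H'' v"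
      "\<And>y. y \<notin> wr (Asg ''h'' (val ''w'') (Cell ''H'' (val ''w''))) \<Longrightarrow> y \<noteq> ''w'' \<Longrightarrow> r y = s y"
    have "r ''H'' = s ''H''" by (rule r(3)) auto
    then show "\<forall>v<Suc i. ((run (Asg ''h'' (val ''w'') (Cell ''H'' (val ''w''))) r)(''w'' := (run (Asg ''h'' (val ''w'') (Cell ''H'' (val ''w''))) r ''w'')(0 := Suc i))) ''h'' v = s ''H'' v"
      using r(1,2) by (auto simp: less_Suc_eq)
  qed auto
  then have h: "r ''h'' v = s ''H'' v" if "v < N" for v using that by (simp add: r_def)
  have "run count r ''z'' 0 = card (comps {..<N} (factor E (r ''h'')))"
  proof (rule count_factor[OF rd])
    fix v assume v: "v \<in> Domain E"
    have sym: "sym E" using sym_cedges[OF c] E by simp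
    have "(v, s ''H'' v) \<in> E" "s ''H'' (s ''H'' v) = v" using p v by (auto simp: perfect_def)
    moreover from this(1) have "s ''H'' v \<in> Domain E" using sym by (meson Domain.DomainI symD)
    ultimately show "r ''h'' (r ''h'' v) = v" using h EN v by simp
  qed
  also have "factor E (r ''h'') = factor E (s ''H'')" by (rule factor_cong) (use h EN in auto)
  finally show ?thesis by (simp add: r_def count_mate_def)
qed

lemma restore_correct:
  assumes sq: "square A E x1 x2 x3 x4 p q" and s: "ready N A s (contract E x1 x2 x3 x4 p q)"
    and EN: "E \<subseteq> {..<N} \<times> {..<N}"
    and v: "s ''a'' 0 = x1" "s ''b'' 0 = x2" "s ''d'' 0 = x3" "s ''e'' 0 = x4" "s ''p'' 0 = p" "s ''q'' 0 = q"
  shows "ready N A (run restore s) E"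
proof -
  interpret square A E x1 x2 x3 x4 p q by (rule sq)
  have b: "x1 < N" "x2 < N" "x3 < N" "x4 < N" "p < N" "q < N" using edges EN by auto
  have sub: "subcubic N A E" by (rule subcubic_cubic_bip[OF cubic EN])
  let ?E0 = "{(u, v) \<in> E. u \<notin> {x3, x4} \<and> v \<notin> {x3, x4}}"
  define s1 where "s1 = run (del ''a'' ''p'') s"
  have f1: "s1 y = s y" if "y \<notin> {cn 0, cn 1, cn 2}" for y using that by (simp add: s1_def run_frame)
  have r1: "ready N A s1 (E' - {(x1, p), (p, x1)})"
    using del_correct[of s A "''a''" "''p''"] s b distinct6 by (simp add: ready_def s1_def v)
  define s2 where "s2 = run (del ''b'' ''q'') s1"
  have f2: "s2 y = s y" if "y \<notin> {cn 0, cn 1, cn 2}" for y using that by (simp add: s2_def run_frame f1)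
  have "ready N A s2 (E' - {(x1, p), (p, x1)} - {(x2, q), (q, x2)})"
    using del_correct[of s1 A "''b''" "''q''"] r1 b distinct6 by (simp add: ready_def s2_def v f1)
  moreover have "E' - {(x1, p), (p, x1)} - {(x2, q), (q, x2)} = ?E0"
    using nonedges by (auto simp: contract_def)
  ultimately have r2: "ready N A s2 ?E0" by simp
  let ?F = "{''i'', ''h'', ''j'', ''l'', ''z'', ''t'', cn 0, cn 1, cn 2}"
  have step: "ready N A (run (ins x y) r) (F \<union> {(r x 0, r y 0), (r y 0, r x 0)}) \<and>
      (\<forall>z. z \<notin> ?F \<longrightarrow> run (ins x y) r z = r z)"
    if "ready N A r F" "okname x" "okname y" "x \<noteq> y" "F \<subseteq> E" "(r x 0, r y 0) \<in> E" "(r x 0, r y 0) \<notin> F" for r F x y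
    using ins_ready[OF that(1-4) sub that(5-7)] by (auto simp: run_frame)
  have e2: "?E0 \<subseteq> E" "(x3, x2) \<notin> ?E0" by auto
  define s3 where "s3 = run (ins ''d'' ''b'') s2"
  have r3: "ready N A s3 (?E0 \<union> {(x3, x2), (x2, x3)})" "\<forall>z. z \<notin> ?F \<longrightarrow> s3 z = s z"
    using step[OF r2, of "''d''" "''b''"] e2 edges by (simp_all add: f2 v s3_def)
  define s4 where "s4 = run (ins ''d'' ''e'') s3"
  have "(x3, x4) \<notin> ?E0 \<union> {(x3, x2), (x2, x3)}" "?E0 \<union> {(x3, x2), (x2, x3)} \<subseteq> E" using distinct6 edges by auto
  then have r4: "ready N A s4 (?E0 \<union> {(x3, x2), (x2, x3)} \<union> {(x3, x4), (x4, x3)})" "\<forall>z. z \<notin> ?F \<longrightarrow> s4 z = s z"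
    using step[OF r3(1), of "''d''" "''e''"] edges r3(2) by (simp_all add: v s4_def)
  define s5 where "s5 = run (ins ''d'' ''p'') s4"
  have "(x3, p) \<notin> ?E0 \<union> {(x3, x2), (x2, x3)} \<union> {(x3, x4), (x4, x3)}" "?E0 \<union> {(x3, x2), (x2, x3)} \<union> {(x3, x4), (x4, x3)} \<subseteq> E"
    using distinct6 edges by auto
  then have r5: "ready N A s5 (?E0 \<union> {(x3, x2), (x2, x3)} \<union> {(x3, x4), (x4, x3)} \<union> {(x3, p), (p, x3)})" "\<forall>z. z \<notin> ?F \<longrightarrow> s5 z = s z"
    using step[OF r4(1), of "''d''" "''p''"] edges r4(2) by (simp_all add: v s5_def)
  define s6 where "s6 = run (ins ''e'' ''a'') s5"
  have "(x4, x1) \<notin> ?E0 \<union> {(x3, x2), (x2, x3)} \<union> {(x3, x4), (x4, x3)} \<union> {(x3, p), (p, x3)}"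
    "?E0 \<union> {(x3, x2), (x2, x3)} \<union> {(x3, x4), (x4, x3)} \<union> {(x3, p), (p, x3)} \<subseteq> E"
    using distinct6 edges by auto
  then have r6: "ready N A s6 (?E0 \<union> {(x3, x2), (x2, x3)} \<union> {(x3, x4), (x4, x3)} \<union> {(x3, p), (p, x3)} \<union> {(x4, x1), (x1, x4)})"
    "\<forall>z. z \<notin> ?F \<longrightarrow> s6 z = s z"
    using step[OF r5(1), of "''e''" "''a''"] edges r5(2) by (simp_all add: v s6_def)
  define s7 where "s7 = run (ins ''e'' ''q'') s6"
  have "(x4, q) \<notin> ?E0 \<union> {(x3, x2), (x2, x3)} \<union> {(x3, x4), (x4, x3)} \<union> {(x3, p), (p, x3)} \<union> {(x4, x1), (x1, x4)}"
    "?E0 \<union> {(x3, x2), (x2, x3)} \<union> {(x3, x4), (x4, x3)} \<union> {(x3, p), (p, x3)} \<union> {(x4, x1), (x1, x4)} \<subseteq> E"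
    using distinct6 edges by auto
  then have r7: "ready N A s7 (?E0 \<union> {(x3, x2), (x2, x3)} \<union> {(x3, x4), (x4, x3)} \<union> {(x3, p), (p, x3)} \<union> {(x4, x1), (x1, x4)} \<union> {(x4, q), (q, x4)})"
    using step[OF r6(1), of "''e''" "''q''"] edges r6(2) by (simp add: v s7_def)
  have "?E0 \<union> {(x3, x2), (x2, x3)} \<union> {(x3, x4), (x4, x3)} \<union> {(x3, p), (p, x3)} \<union> {(x4, x1), (x1, x4)} \<union> {(x4, q), (q, x4)} = E"
  proof
    show "?E0 \<union> {(x3, x2), (x2, x3)} \<union> {(x3, x4), (x4, x3)} \<union> {(x3, p), (p, x3)} \<union> {(x4, x1), (x1, x4)} \<union> {(x4, q), (q, x4)} \<subseteq> E"
      using edges by auto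
    show "E \<subseteq> ?E0 \<union> {(x3, x2), (x2, x3)} \<union> {(x3, x4), (x4, x3)} \<union> {(x3, p), (p, x3)} \<union> {(x4, x1), (x1, x4)} \<union> {(x4, q), (q, x4)}"
    proof (rule subrelI)
      fix u w assume uw: "(u, w) \<in> E"
      consider "u = x3" | "u = x4" | "w = x3" | "w = x4" | "u \<notin> {x3, x4} \<and> w \<notin> {x3, x4}" by blast
      then show "(u, w) \<in> ?E0 \<union> {(x3, x2), (x2, x3)} \<union> {(x3, x4), (x4, x3)} \<union> {(x3, p), (p, x3)} \<union> {(x4, x1), (x1, x4)} \<union> {(x4, q), (q, x4)}"
        by cases (use uw from3[of w] from4[of w] to3[of u] to4[of u] in auto)
    qed
  qed
  then show ?thesis using r7 by (simp add: restore_def s1_def s2_def s3_def s4_def s5_def s6_def s7_def)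
qed

lemma mate_correct:
  assumes sq: "square A E x1 x2 x3 x4 p q" and s: "ready N A s E"
    and h: "perfect (contract E x1 x2 x3 x4 p q) (s ''H'')"
    and v: "s ''a'' 0 = x1" "s ''b'' 0 = x2" "s ''d'' 0 = x3" "s ''e'' 0 = x4" "s ''p'' 0 = p" "s ''q'' 0 = q"
  shows "perfect E (run mate s ''H'')"
    "card (comps (Domain E) (factor E (run mate s ''H''))) \<le>
      card (comps (Domain (contract E x1 x2 x3 x4 p q)) (factor (contract E x1 x2 x3 x4 p q) (s ''H'')))"
proof -
  interpret square A E x1 x2 x3 x4 p q by (rule sq)
  let ?B = "card (comps (Domain E') (factor E' (s ''H'')))"
  let ?f = "\<lambda>h. card (comps (Domain E) (factor E h))"
  have "perfect E (run mate s ''H'') \<and> ?f (run mate s ''H'') \<le> ?B"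
  proof (cases "s ''H'' x1 = x2")
    case False
    have "run mate s ''H'' = expand_path (s ''H'')"
      using False v distinct6 by (auto simp: mate_def mate_path_def expand_path_def Let_def)
    then show ?thesis using expand_path[OF h False] by simp
  next
    case True
    note ex = expand_square[OF h True]
    have DN: "Domain E \<subseteq> {..<N}" using s cedges_bound by (auto simp: ready_def)
    \<comment> \<open>Both counts include the same number of isolated vertices, so the test on
      \<open>g\<close> and \<open>z\<close> compares the true numbers of cycles.\<close>
    have cnt: "card (comps {..<N} (factor E k)) = ?f k + card ({..<N} - Domain E)" if "perfect E k" for k
    proof (rule card_comps_superset[OF _ DN])
      show "factor E k \<subseteq> Domain E \<times> Domain E" using E_sym by (auto simp: factor_def)
    qed simp
    define s1 where "s1 = run mate_12 s"
    have f1: "s1 y = s y" if "y \<noteq> ''H''" for y using that by (simp add: s1_def run_frame)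
    have h1: "s1 ''H'' = expand_12 (s ''H'')" using v by (simp add: s1_def mate_12_def expand_12_def)
    have r1: "ready N A s1 E" unfolding s1_def using s by (subst ready_frame) auto
    define s2 where "s2 = run (Set ''g'' (val ''z'')) (run count_mate s1)"
    have z1: "s2 ''g'' 0 = ?f (expand_12 (s ''H'')) + card ({..<N} - Domain E)"
      using count_mate_correct[OF r1] ex(1) cnt[OF ex(1)] by (simp add: s2_def h1)
    have f2: "s2 y = s1 y" if "y \<notin> {''w'', ''h'', ''i'', ''j'', ''l'', ''z'', ''g''}" for y using that by (simp add: s2_def run_frame)
    have r2: "ready N A s2 E" using r1 by (subst ready_cong[of _ s1]) (auto simp: f2)
    define s3 where "s3 = run mate_14 s2"
    have f3: "s3 y = s2 y" if "y \<noteq> ''H''" for y using that by (simp add: s3_def run_frame)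
    have v2: "s2 ''a'' 0 = x1" "s2 ''b'' 0 = x2" "s2 ''d'' 0 = x3" "s2 ''e'' 0 = x4" using v by (simp_all add: f2 f1)
    \<comment> \<open>Both completions set the same four entries, so the second overwrites the first
      without a reset.\<close>
    have h3: "s3 ''H'' = expand_14 (s ''H'')"
      using v2 h1 distinct6 by (auto simp: s3_def mate_14_def f2 expand_14_def expand_12_def fun_eq_iff)
    have r3: "ready N A s3 E" unfolding s3_def using r2 by (subst ready_frame) auto
    define s4 where "s4 = run count_mate s3"
    have f4: "s4 y = s3 y" if "y \<notin> {''w'', ''h'', ''i'', ''j'', ''l'', ''z''}" for y using that by (simp add: s4_def run_frame)
    have z2: "s4 ''z'' 0 = ?f (expand_14 (s ''H'')) + card ({..<N} - Domain E)"
      using count_mate_correct[OF r3] ex(2) cnt[OF ex(2)] by (simp add: s4_def h3)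
    have h4: "s4 ''H'' = expand_14 (s ''H'')" by (simp add: f4 h3)
    have v4: "s4 ''a'' 0 = x1" "s4 ''b'' 0 = x2" "s4 ''d'' 0 = x3" "s4 ''e'' 0 = x4" using v2 by (simp_all add: f4 f3)
    have g4: "s4 ''g'' 0 = s2 ''g'' 0" by (simp add: f4 f3)
    have "run mate s = run (Ite (Less (val ''g'') (val ''z'')) mate_12 Nop) s4"
      using True v by (simp add: mate_def mate_square_def s1_def s2_def s3_def s4_def)
    moreover have "run mate_12 s4 ''H'' = expand_12 (s ''H'')"
      using v4 h4 distinct6 by (auto simp: mate_12_def expand_14_def expand_12_def fun_eq_iff)
    ultimately have "run mate s ''H'' = (if s2 ''g'' 0 < s4 ''z'' 0 then expand_12 (s ''H'') else expand_14 (s ''H''))"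
      using h4 g4 by simp
    then show ?thesis using ex z1 z2 by auto
  qed
  then show "perfect E (run mate s ''H'')" "?f (run mate s ''H'') \<le> ?B" by auto
qed

lemma stk_pop:
  assumes "0 < s ''k'' 0"
  shows "stk s = (run pop s ''a'' 0, run pop s ''b'' 0, run pop s ''d'' 0, run pop s ''e'' 0, run pop s ''p'' 0, run pop s ''q'' 0) # stk (run pop s)"
proof -
  obtain m where m: "s ''k'' 0 = Suc m" using assms by (cases "s ''k'' 0") auto
  show ?thesis unfolding stk_def by (simp add: pop_def m)
qed

definition expand_inv :: "nat \<Rightarrow> nat set \<Rightarrow> nat rel \<Rightarrow> nat \<Rightarrow> state \<Rightarrow> bool" where
  "expand_inv N A G B r \<longleftrightarrow> (\<exists>E. ready N A r E \<and> hist A G (stk r) E \<and> perfect E (r ''H'') \<and>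
     card (comps (Domain E) (factor E (r ''H''))) \<le> B)"

lemma expand_inv_cong:
  assumes "\<And>y. y \<in> {''n'', ''k'', ''A'', ''B'', ''D'', ''E'', ''P'', ''Q'', ''H'', cn 0, cn 1, cn 2} \<Longrightarrow> r y = s y"
  shows "expand_inv N A G B r = expand_inv N A G B s"
proof -
  have "stk r = stk s" using assms by (simp add: stk_def)
  moreover have "ready N A r E = ready N A s E" for E
    using assms by (intro ready_cong) (auto simp: less3)
  moreover have "r ''H'' = s ''H''" using assms by simp
  ultimately show ?thesis by (simp add: expand_inv_def)
qed

text \<open>Each recorded contraction has removed two vertices, which bounds the height of the stack
  and keeps all intermediate graphs within the vertices of \<open>G\<close>.\<close>

lemma hist_Domain:
  "hist A G ts E \<Longrightarrow> finite G \<Longrightarrow> Domain E \<subseteq> Domain G \<and> card (Domain G) = card (Domain E) + 2 * length ts"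
proof (induction ts arbitrary: E)
  case (Cons t ts)
  obtain x1 x2 x3 x4 p q where t: "t = (x1, x2, x3, x4, p, q)" by (cases t)
  obtain F where F: "square A F x1 x2 x3 x4 p q" "E = contract F x1 x2 x3 x4 p q" "hist A G ts F"
    using Cons.prems t by auto
  have "Domain E \<subseteq> Domain F" unfolding F(2) square.Domain'[OF F(1)] by auto
  then show ?case using Cons.IH[OF F(3) Cons.prems(2)] card_Domain_contract[OF F(1)] F(2) by auto
qed simp

lemma expand1_correct:
  assumes s: "expand_inv N A G B s" and k: "0 < s ''k'' 0" and G: "G \<subseteq> {..<N} \<times> {..<N}"
  shows "expand_inv N A G B (run expand1 s)" "run expand1 s ''k'' 0 = s ''k'' 0 - 1"
proof -
  define s1 where "s1 = run pop s"
  define x1 x2 x3 x4 p q where xs: "x1 = s1 ''a'' 0" "x2 = s1 ''b'' 0" "x3 = s1 ''d'' 0" "x4 = s1 ''e'' 0" "p = s1 ''p'' 0" "q = s1 ''q'' 0"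
  obtain E' where E': "ready N A s E'" "hist A G (stk s) E'" "perfect E' (s ''H'')"
    "card (comps (Domain E') (factor E' (s ''H''))) \<le> B" using s by (auto simp: expand_inv_def)
  have "stk s = (x1, x2, x3, x4, p, q) # stk s1" unfolding xs s1_def using stk_pop[of s] k by simp
  then obtain E where E: "square A E x1 x2 x3 x4 p q" "E' = contract E x1 x2 x3 x4 p q" "hist A G (stk s1) E"
    using E'(2) by auto
  interpret square A E x1 x2 x3 x4 p q by (rule E(1))
  have f1: "s1 y = s y" if "y \<notin> {''k'', ''a'', ''b'', ''d'', ''e'', ''p'', ''q''}" for y using that by (simp add: s1_def run_frame)
  have r1: "ready N A s1 (contract E x1 x2 x3 x4 p q)" unfolding s1_def using E'(1) E(2) by (subst ready_frame) auto
  have finG: "finite G" using G by (rule finite_subset) auto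
  have "Domain E \<subseteq> {..<N}" using hist_Domain[OF E(3) finG] G by auto
  then have EN: "E \<subseteq> {..<N} \<times> {..<N}" using E_sym by auto
  define s2 where "s2 = run restore s1"
  have f2: "s2 y = s1 y" if "y \<notin> {''i'', ''h'', ''j'', ''l'', ''z'', ''t'', cn 0, cn 1, cn 2}" for y
    using that by (simp add: s2_def run_frame)
  have r2: "ready N A s2 E" unfolding s2_def by (rule restore_correct[OF E(1) r1 EN]) (simp_all add: xs)
  have v2: "s2 ''a'' 0 = x1" "s2 ''b'' 0 = x2" "s2 ''d'' 0 = x3" "s2 ''e'' 0 = x4" "s2 ''p'' 0 = p" "s2 ''q'' 0 = q"
    by (simp_all add: f2 xs)
  have h2: "s2 ''H'' = s ''H''" by (simp add: f1 f2)
  define s3 where "s3 = run mate s2"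
  have f3: "s3 y = s2 y" if "y \<notin> {''H'', ''w'', ''h'', ''i'', ''j'', ''l'', ''z'', ''g'', ''x'', ''y''}" for y
    using that by (simp add: s3_def run_frame)
  have r3: "ready N A s3 E" unfolding s3_def using r2 by (subst ready_frame) auto
  have m: "perfect E (s3 ''H'')" "card (comps (Domain E) (factor E (s3 ''H''))) \<le> B"
    using mate_correct[OF E(1) r2 _ v2] E'(3,4) E(2) unfolding h2 s3_def by auto
  have "stk s3 = stk s1" by (simp add: stk_def f3 f2)
  then have "expand_inv N A G B s3" using r3 E(3) m by (auto simp: expand_inv_def)
  moreover have run: "run expand1 s = s3" using k by (simp add: expand1_def s1_def s2_def s3_def)
  ultimately show "expand_inv N A G B (run expand1 s)" by simp
  have "s1 ''k'' 0 = s ''k'' 0 - 1" by (simp add: s1_def pop_def)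
  then show "run expand1 s ''k'' 0 = s ''k'' 0 - 1" unfolding run by (simp add: f3 f2)
qed

lemma expand_correct:
  assumes s: "expand_inv N A G B s" and k: "s ''k'' 0 \<le> N" and G: "G \<subseteq> {..<N} \<times> {..<N}"
  defines "r \<equiv> run expand s"
  shows "ready N A r G" "perfect G (r ''H'')" "card (comps (Domain G) (factor G (r ''H''))) \<le> B"
proof -
  have N: "s ''n'' 0 = N" using s by (auto simp: expand_inv_def ready_def)
  have "expand_inv N A G B (run expand s) \<and> run expand s ''k'' 0 = s ''k'' 0 - 1 * N"
    unfolding expand_def
  proof (rule run_For[where I = "\<lambda>i r. expand_inv N A G B r \<and> r ''k'' 0 = s ''k'' 0 - i"])
    show "ok (For 1 ''f'' expand1)" using ok_expand by (simp only: expand_def)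
    show "s ''n'' 0 = N" by (rule N)
    show "expand_inv N A G B (s(''f'' := (s ''f'')(0 := 0))) \<and> (s(''f'' := (s ''f'')(0 := 0))) ''k'' 0 = s ''k'' 0 - 0"
      using s by (subst expand_inv_cong[of _ s]) auto
    fix i r assume r: "expand_inv N A G B r \<and> r ''k'' 0 = s ''k'' 0 - i"
    have "expand_inv N A G B (run expand1 r) \<and> run expand1 r ''k'' 0 = s ''k'' 0 - Suc i"
    proof (cases "0 < r ''k'' 0")
      case True
      then show ?thesis using expand1_correct[of N A G B r] r G by simp
    next
      case False
      then show ?thesis using r by (simp add: expand1_def)
    qed
    then show "expand_inv N A G B ((run expand1 r)(''f'' := (run expand1 r ''f'')(0 := Suc i))) \<and>
        ((run expand1 r)(''f'' := (run expand1 r ''f'')(0 := Suc i))) ''k'' 0 = s ''k'' 0 - Suc i"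
      by (subst expand_inv_cong[of _ "run expand1 r"]) auto
  qed
  then have "expand_inv N A G B r" "stk r = []" using k by (auto simp: r_def stk_def)
  then show "ready N A r G" "perfect G (r ''H'')" "card (comps (Domain G) (factor G (r ''H''))) \<le> B"
    by (auto simp: expand_inv_def)
qed

section \<open>Output\<close>

text \<open>\<open>w < t\<close> emits each edge from its smaller end only and skips missing
  colours, whose entry is \<open>w\<close> itself. The input arrays may be overwritten because the
  graph is held in the colour arrays.\<close>

definition out1 :: "nat \<Rightarrow> prog" where
  "out1 k = Set ''t'' (Cell (cn k) (val ''w'')) ;;
     Ite (And (Less (val ''w'') (val ''t'')) (Not (Eq (val ''t'') (Cell ''H'' (val ''w'')))))
       (Asg ''u'' (val ''m'') (val ''w'') ;; Asg ''v'' (val ''m'') (val ''t'') ;; Set ''m'' (Plus (val ''m'') (Const 1))) Nop"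

definition emit :: prog where
  "emit = Set ''m'' (Const 0) ;; For 1 ''w'' (out1 0 ;; out1 1 ;; out1 2)"

lemma wr_out1 [simp]: "wr (out1 k) = {''t'', ''u'', ''v'', ''m''}" and ok_out1 [simp]: "ok (out1 k)"
  by (auto simp: out1_def)

lemma ok_emit [simp]: "ok emit"
  by (simp add: emit_def)

definition elist :: "state \<Rightarrow> (nat \<times> nat) list" where
  "elist s = map (\<lambda>i. (s ''u'' i, s ''v'' i)) [0..<s ''m'' 0]"

lemma elist_out1:
  "elist (run (out1 k) s) = elist s @
     (let w = s ''w'' 0; t = s (cn k) w in if w < t \<and> t \<noteq> s ''H'' w then [(w, t)] else [])"
  by (auto simp: elist_def out1_def Let_def)

lemma emit_correct:
  assumes s: "ready N A s E"
  shows "set (elist (run emit s)) = {(x, y) \<in> factor E (s ''H''). x < y}" "distinct (elist (run emit s))"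
proof -
  have N: "s ''n'' 0 = N" and c: "pcol N A (col s)" and E: "cedges (col s) = E" using s by (auto simp: ready_def)
  let ?F = "factor E (s ''H'')"
  let ?b = "out1 0 ;; out1 1 ;; out1 2"
  let ?s = "run (Set ''m'' (Const 0)) s"
  let ?I = "\<lambda>i r. set (elist r) = {(x, y) \<in> ?F. x < y \<and> x < i} \<and> distinct (elist r)"
  have "?I (1 * N) (run (For 1 ''w'' ?b) ?s)"
  proof (rule run_For[where I = ?I])
    show "?s ''n'' 0 = N" using N by simp
    show "?I 0 (?s(''w'' := (?s ''w'')(0 := 0)))" by (simp add: elist_def)
    fix i r assume r: "i < 1 * N" "r ''w'' 0 = i" "\<And>y. y \<notin> wr ?b \<Longrightarrow> y \<noteq> ''w'' \<Longrightarrow> r y = ?s y" "?I i r"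
    have f: "r (cn k) = s (cn k)" "r ''H'' = s ''H''" for k using r(3)[of "cn k"] r(3)[of "''H''"] by simp_all
    have i: "i < N" using r(1) by simp
    define e where "e k = (if i < col s k i \<and> col s k i \<noteq> s ''H'' i then [(i, col s k i)] else [])" for k
    have fr: "run (out1 j) q y = q y" if "y \<notin> {''t'', ''u'', ''v'', ''m''}" for j q y using that by (simp add: run_frame)
    have el: "elist (run ?b r) = elist r @ e 0 @ e 1 @ e 2"
      using i N r(2) by (simp add: elist_out1 fr f Let_def e_def col_def)
    have set3: "set (e 0 @ e 1 @ e 2) = {(x, y) \<in> ?F. x < y \<and> x = i}"
    proof -
      have i1: "(x, y) \<in> set (e 0 @ e 1 @ e 2) \<longleftrightarrow> x = i \<and> i < y \<and> y \<noteq> s ''H'' i \<and> (\<exists>k<3. col s k i = y)" for x y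
        unfolding less3 by (auto simp: e_def)
      have i2: "(x, y) \<in> {(x, y) \<in> ?F. x < y \<and> x = i} \<longleftrightarrow> x = i \<and> i < y \<and> y \<noteq> s ''H'' i \<and> (\<exists>k<3. col s k i = y)" for x y
        by (auto simp: factor_def E[symmetric] cedges_iff)
      show ?thesis
      proof (rule set_eqI)
        fix z :: "nat \<times> nat"
        obtain x y where z: "z = (x, y)" by (cases z)
        show "z \<in> set (e 0 @ e 1 @ e 2) \<longleftrightarrow> z \<in> {(x, y) \<in> ?F. x < y \<and> x = i}"
          unfolding z i1 i2 ..
      qed
    qed
    have dist3: "distinct (e 0 @ e 1 @ e 2)"
      using pcolD(4)[OF c, of 0 1 i] pcolD(4)[OF c, of 0 2 i] pcolD(4)[OF c, of 1 2 i] by (auto simp: e_def)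
    have "?I (Suc i) (run ?b r)"
    proof
      show "set (elist (run ?b r)) = {(x, y) \<in> ?F. x < y \<and> x < Suc i}"
        unfolding el set_append[of "elist r"] set3 using r(4) by (auto simp: less_Suc_eq)
      have "set (elist r) \<inter> set (e 0 @ e 1 @ e 2) = {}" unfolding set3 using r(4) by auto
      then show "distinct (elist (run ?b r))" unfolding el distinct_append[of "elist r"] using r(4) dist3 by blast
    qed
    then show "?I (Suc i) ((run ?b r)(''w'' := (run ?b r ''w'')(0 := Suc i)))" by (simp add: elist_def)
  qed auto
  then have I: "set (elist (run emit s)) = {(x, y) \<in> ?F. x < y \<and> x < N}" "distinct (elist (run emit s))"
    by (simp_all add: emit_def)
  have "x < N" if "(x, y) \<in> ?F" for x y using that cedges_bound[OF c] E by (auto simp: factor_def)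
  then show "set (elist (run emit s)) = {(x, y) \<in> ?F. x < y}" using I(1) by auto
  show "distinct (elist (run emit s))" by (rule I(2))
qed

section \<open>Cycles of a 2-factor\<close>

lemma out_degree_with_proj: "out_degree (with_proj G) v = card (parcs G `` {v})"
proof -
  have "out_arcs (with_proj G) v = Pair v ` (parcs G `` {v})" by (auto simp: out_arcs_def)
  then show ?thesis by (simp add: out_degree_def card_image inj_on_def)
qed

lemma pcas_nth:
  assumes "pcas u p v"
  shows "Suc i < length p \<Longrightarrow> fst (p ! Suc i) = snd (p ! i)"
    "p \<noteq> [] \<Longrightarrow> fst (p ! 0) = u" "p \<noteq> [] \<Longrightarrow> snd (p ! (length p - 1)) = v"
proof -
  have "(\<forall>i. Suc i < length p \<longrightarrow> fst (p ! Suc i) = snd (p ! i)) \<and>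
      (p \<noteq> [] \<longrightarrow> fst (p ! 0) = u \<and> snd (p ! (length p - 1)) = v)"
    using assms
  proof (induction p arbitrary: u)
    case (Cons e p)
    then have "pcas (snd e) p v" by simp
    note IH = Cons.IH[OF this]
    have "fst ((e # p) ! Suc i) = snd ((e # p) ! i)" if "Suc i < length (e # p)" for i
      using that IH by (cases i) auto
    moreover have "snd ((e # p) ! (length (e # p) - 1)) = v"
      using IH Cons.prems by (cases p) auto
    ultimately show ?case using Cons.prems by simp
  qed simp
  then show "Suc i < length p \<Longrightarrow> fst (p ! Suc i) = snd (p ! i)"
    "p \<noteq> [] \<Longrightarrow> fst (p ! 0) = u" "p \<noteq> [] \<Longrightarrow> snd (p ! (length p - 1)) = v" by blast+
qed

lemma pawalk_verts_eq: "pcas u p v \<Longrightarrow> pawalk_verts u p = u # map snd p"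
  by (induction p arbitrary: u) auto

text \<open>With degree 2 everywhere, the edges by which the cycle enters and leaves a vertex are
  all the edges there. Its vertices are thus closed under adjacency and fill a class, which
  determines the edge set of the cycle.\<close>

lemma cycle_edges_eq_component:
  assumes p: "pre_digraph.cycle (with_proj H) p" and len: "3 \<le> length p"
    and sym: "sym (parcs H)" and reg: "\<And>v. v \<in> pverts H \<Longrightarrow> card (parcs H `` {v}) = 2"
    and fin: "finite (parcs H)" and sub: "parcs H \<subseteq> pverts H \<times> pverts H"
  shows "\<exists>u\<in>pverts H. set p \<union> (set p)\<inverse> = {(x, y) \<in> parcs H. x \<in> (parcs H)\<^sup>* `` {u}}"
proof -
  obtain u where u: "u \<in> pverts H" "set p \<subseteq> parcs H" "pcas u p u" "distinct (tl (pawalk_verts u p))" "p \<noteq> []"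
    using p unfolding pre_digraph.cycle_def pre_digraph.awalk_def cas_with_proj_eq awalk_verts_with_proj_eq by auto
  define m where "m = length p"
  have m: "3 \<le> m" using len by (simp add: m_def)
  have ds: "distinct (map snd p)" using u(4) by (simp add: pawalk_verts_eq[OF u(3)])
  have nx: "fst (p ! Suc i) = snd (p ! i)" if "Suc i < m" for i using pcas_nth(1)[OF u(3)] that by (simp add: m_def)
  have f0: "fst (p ! 0) = u" and l0: "snd (p ! (m - 1)) = u" using pcas_nth(2,3)[OF u(3)] u(5) by (auto simp: m_def)
  have inj: "snd (p ! i) = snd (p ! j) \<Longrightarrow> i < m \<Longrightarrow> j < m \<Longrightarrow> i = j" for i j
    using nth_eq_iff_index_eq[OF ds, of i j] by (simp add: m_def)
  let ?S = "set p \<union> (set p)\<inverse>"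
  define W where "W = snd ` set p"
  have SH: "?S \<subseteq> parcs H" using u(2) sym by (auto dest: symD)
  have mem: "(fst (p ! i), snd (p ! i)) \<in> set p" if "i < m" for i using that by (simp add: m_def)
  have full: "parcs H `` {w} \<subseteq> ?S `` {w}" if w: "w \<in> W" for w
  proof -
    obtain i where i: "i < m" "w = snd (p ! i)" using w by (auto simp: W_def in_set_conv_nth m_def)
    \<comment> \<open>\<open>j\<close> and \<open>i'\<close> are the cyclic successor and
      predecessor of position \<open>i\<close>; they differ because the length is at least 3, so
      \<open>w\<close> has two different neighbours on the cycle.\<close>
    define j where "j = (if Suc i < m then Suc i else 0)"
    define i' where "i' = (if i = 0 then m - 1 else i - 1)"
    have j: "j < m" "i' < m" "j \<noteq> i'" using i m by (auto simp: j_def i'_def)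
    have wj: "fst (p ! j) = w"
    proof (cases "Suc i < m")
      case False
      then have "i = m - 1" using i by simp
      then show ?thesis using False f0 l0 i by (simp add: j_def)
    qed (use nx i in \<open>simp add: j_def\<close>)
    have wi: "fst (p ! i) = snd (p ! i')"
    proof (cases i)
      case (Suc k)
      then show ?thesis using nx[of k] i by (simp add: i'_def)
    qed (use f0 l0 in \<open>simp add: i'_def\<close>)
    have a: "snd (p ! j) \<in> ?S `` {w}" using mem[OF j(1)] wj by auto
    have b: "snd (p ! i') \<in> ?S `` {w}" using mem[OF i(1)] i(2) wi by auto
    have ne: "snd (p ! j) \<noteq> snd (p ! i')" using inj j by blast
    have "{snd (p ! j), snd (p ! i')} \<subseteq> parcs H `` {w}" using a b SH by blast
    moreover have "w \<in> pverts H" using a SH sub by auto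
    moreover have "finite (parcs H `` {w})" using fin by (simp add: finite_Image)
    ultimately have eq: "{snd (p ! j), snd (p ! i')} = parcs H `` {w}"
      using reg ne by (intro card_subset_eq) auto
    show ?thesis unfolding eq[symmetric] using a b by blast
  qed
  have fW: "fst e \<in> W" if e: "e \<in> set p" for e
  proof -
    obtain i where i: "i < m" "e = p ! i" using e by (auto simp: in_set_conv_nth m_def)
    show ?thesis
    proof (cases i)
      case 0
      then have "fst e = snd (p ! (m - 1))" using i f0 l0 by simp
      then show ?thesis using m by (auto simp: W_def m_def)
    next
      case (Suc k)
      then have "fst e = snd (p ! k)" using nx[of k] i by simp
      then show ?thesis using i Suc by (auto simp: W_def m_def)
    qed
  qed
  have SW: "x \<in> W \<and> y \<in> W" if "(x, y) \<in> ?S" for x y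
    using that fW by (force simp: W_def)
  have uW: "u \<in> W" using l0 m by (force simp: W_def m_def)
  have "(parcs H)\<^sup>* `` {u} = W"
  proof
    show "(parcs H)\<^sup>* `` {u} \<subseteq> W"
    proof
      fix x assume "x \<in> (parcs H)\<^sup>* `` {u}"
      then have "(u, x) \<in> (parcs H)\<^sup>*" by simp
      then show "x \<in> W"
      proof (rule rtrancl_closed)
        show "u \<in> W" by (rule uW)
        show "y \<in> W" if "x \<in> W" "(x, y) \<in> parcs H" for x y using full[OF that(1)] that(2) SW by blast
      qed
    qed
    show "W \<subseteq> (parcs H)\<^sup>* `` {u}"
    proof
      have *: "(u, snd (p ! i)) \<in> (parcs H)\<^sup>*" if "i < m" for i
        using that
      proof (induction i)
        case 0
        then show ?case using mem[of 0] f0 u(2) by auto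
      next
        case (Suc i)
        then have "(snd (p ! i), snd (p ! Suc i)) \<in> parcs H" using mem[of "Suc i"] nx[of i] u(2) by auto
        then show ?case using Suc by (auto intro: rtrancl_into_rtrancl)
      qed
      fix w assume "w \<in> W"
      then obtain e where "e \<in> set p" "w = snd e" by (auto simp: W_def)
      then obtain i where "i < m" "w = snd (p ! i)" by (metis in_set_conv_nth m_def)
      then show "w \<in> (parcs H)\<^sup>* `` {u}" using * by simp
    qed
  qed
  moreover have "?S = {(x, y) \<in> parcs H. x \<in> W}" using SH SW full by blast
  ultimately show ?thesis using u(1) by auto
qed

lemma card_cycles_le:
  assumes "sym (parcs H)" "\<And>v. v \<in> pverts H \<Longrightarrow> card (parcs H `` {v}) = 2"
    and "finite (pverts H)" "parcs H \<subseteq> pverts H \<times> pverts H"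
  shows "card (cycles H) \<le> card (comps (pverts H) (parcs H))"
proof -
  have fin: "finite (parcs H)" using assms(3,4) by (meson finite_SigmaI finite_subset)
  have "cycles H \<subseteq> (\<lambda>K. {(x, y) \<in> parcs H. x \<in> K}) ` comps (pverts H) (parcs H)"
  proof
    fix C assume "C \<in> cycles H"
    then obtain p where p: "C = set p \<union> (set p)\<inverse>" "pre_digraph.cycle (with_proj H) p" "3 \<le> length p"
      by (auto simp: cycles_def)
    then obtain u where "u \<in> pverts H" "C = {(x, y) \<in> parcs H. x \<in> (parcs H)\<^sup>* `` {u}}"
      using cycle_edges_eq_component[OF p(2,3) assms(1,2) fin assms(4)] by auto
    then show "C \<in> (\<lambda>K. {(x, y) \<in> parcs H. x \<in> K}) ` comps (pverts H) (parcs H)"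
      unfolding comps_def by blast
  qed
  then show ?thesis using surj_card_le[OF finite_comps[OF assms(3)]] by blast
qed

section \<open>The algorithm\<close>

definition two_factor_prog :: prog where
  "two_factor_prog = init_prog ;; build ;; contr_phase ;; search ;; pick ;; expand ;; emit"

lemma ok_two_factor_prog: "ok two_factor_prog"
  by (simp add: two_factor_prog_def)

lemma two_factor_prog_correct:
  assumes s: "s ''n'' 0 = N" "s ''m'' 0 = length es" "\<And>i. i < length es \<Longrightarrow> (s ''u'' i, s ''v'' i) = es ! i"
    and es: "length es \<le> 3 * N" "distinct (map (\<lambda>(u, v). {u, v}) es)"
    and G: "G = set es \<union> (set es)\<inverse>" "G \<subseteq> {..<N} \<times> {..<N}" "cubic_bip A G" and N: "7 \<le> N"
  defines "r \<equiv> run two_factor_prog s"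
  obtains h where "perfect G h" "7 * card (comps (Domain G) (factor G h)) \<le> N"
    "set (elist r) = {(x, y) \<in> factor G h. x < y}" "distinct (elist r)"
proof -
  define s1 where "s1 = run init_prog s"
  define s2 where "s2 = run build s1"
  define s3 where "s3 = run contr_phase s2"
  define s4 where "s4 = run search s3"
  define s5 where "s5 = run pick s4"
  define s6 where "s6 = run expand s5"
  have r: "r = run emit s6"
    by (simp add: r_def two_factor_prog_def s1_def s2_def s3_def s4_def s5_def s6_def)
  have r1: "ready N A s1 {}" unfolding s1_def using init_correct[of s A] s(1) by simp
  have f1: "s1 ''m'' = s ''m''" "s1 ''u'' = s ''u''" "s1 ''v'' = s ''v''" by (simp_all add: s1_def run_frame)
  have sub: "subcubic N A G" by (rule subcubic_cubic_bip[OF G(3,2)])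
  have r2: "ready N A s2 G"
    unfolding s2_def G(1) by (rule build_correct[OF r1]) (use s es f1 sub G(1) in auto)
  have N0: "0 < N" using N by simp
  define E where "E = cedges (col s3)"
  have c3: "contr_inv N A G s3" and nb: "\<And>x1 x2 x3 x4 p q. \<not> bad_square E x1 x2 x3 x4 p q"
    using contr_phase_correct[OF r2 G(3) N0] by (auto simp: s3_def E_def)
  have r3: "ready N A s3 E" and cub: "cubic_bip A E" and hi: "hist A G (stk s3) E"
    using c3 by (auto simp: contr_inv_def E_def)
  note S = search_correct[OF r3 N0, folded s4_def]
  have r4: "ready N A s4 E" by (rule S(1))
  have c4: "pcol N A (col s4)" and E4: "cedges (col s4) = E" using r4 by (auto simp: ready_def)
  let ?V = "Domain E"
  have VN: "?V \<subseteq> {..<N}" using cedges_bound[OF c4] E4 by auto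
  obtain d where d: "d < 3" "7 * card (comps ?V (factor E (col s4 d))) \<le> max 7 (card ?V)"
    using local_optimum_few_cycles[OF c4 _ _ S(2-4)] cub nb unfolding E4 by blast
  obtain d' where d': "d' < 3" "\<forall>v<N. s5 ''H'' v = col s4 d' v"
    "\<forall>k<3. card (comps {..<N} (factor E (col s4 d'))) \<le> card (comps {..<N} (factor E (col s4 k)))"
    using pick_correct[OF r4] unfolding s5_def by blast
  have "sym E" using sym_cedges[OF c4] E4 by simp
  then have Dsym: "y \<in> ?V" if "(x, y) \<in> E" for x y using that by (meson Domain.DomainI symD)
  have sup: "card (comps {..<N} (factor E h)) = card (comps ?V (factor E h)) + card ({..<N} - ?V)" for h
    by (rule card_comps_superset[OF _ VN]) (use Dsym in \<open>auto simp: factor_def\<close>)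
  have "card (comps ?V (factor E (col s4 d'))) \<le> card (comps ?V (factor E (col s4 d)))"
    using d'(3) d(1) sup by auto
  moreover have "card ?V \<le> N" using card_mono[OF _ VN] by simp
  \<comment> \<open>The bound for small contracted graphs is 7, and \<open>N\<close> is at least
    7.\<close>
  ultimately have b5: "7 * card (comps ?V (factor E (col s4 d'))) \<le> N" using d(2) N by linarith
  have H5: "s5 ''H'' v = col s4 d' v" if "v \<in> ?V" for v using d'(2) VN that by auto
  have fac: "factor E (s5 ''H'') = factor E (col s4 d')" by (rule factor_cong) (use H5 in auto)
  have perf: "perfect E (s5 ''H'')"
    unfolding perfect_def
  proof
    fix v assume v: "v \<in> ?V"
    have "col s4 d' v \<noteq> v" using cubic_all_colours[OF c4 _ _ d'(1), of v] cub v E4 by simp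
    then have e: "(v, col s4 d' v) \<in> E" using d'(1) E4 by (metis cedges_iff)
    then have "col s4 d' v \<in> ?V" by (rule Dsym)
    then show "(v, s5 ''H'' v) \<in> E \<and> s5 ''H'' (s5 ''H'' v) = v" using H5 v e pcolD(1)[OF c4 d'(1)] by simp
  qed
  have r5: "ready N A s5 E" unfolding s5_def using r4 by (subst ready_frame) (auto simp: wr_pick)
  have f5: "s5 y = s3 y" if "y \<in> {''k'', ''A'', ''B'', ''D'', ''E'', ''P'', ''Q''}" for y
    using that unfolding s5_def s4_def by (auto simp: run_frame wr_pick wr_search)
  have "stk s5 = stk s3" by (simp add: stk_def f5)
  then have x5: "expand_inv N A G (N div 7) s5"
    unfolding expand_inv_def using r5 hi perf b5 fac by (intro exI[of _ E]) auto
  have finG: "finite G" using G(2) by (rule finite_subset) auto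
  have "s3 ''k'' 0 \<le> N"
  proof -
    have "2 * length (stk s3) \<le> card (Domain G)" using hist_Domain[OF hi finG] by simp
    also have "\<dots> \<le> card {..<N}" by (rule card_mono) (use G(2) in auto)
    finally show ?thesis by (simp add: stk_def)
  qed
  then have k5: "s5 ''k'' 0 \<le> N" by (simp add: f5)
  note X = expand_correct[OF x5 k5 G(2), folded s6_def]
  note O = emit_correct[OF X(1), folded r]
  have "7 * card (comps (Domain G) (factor G (s6 ''H''))) \<le> N" using X(3) by simp
  then show ?thesis using that X(2) O by blast
qed

theorem theorem13:
  shows "\<exists>c. poly_time_computes c
    (\<lambda>G. pair_graph G \<and> Digraph_Component.connected (with_proj G) \<and> regular 3 G \<and> bipartite G \<and>
         card (pverts G) > 6)
    (\<lambda>G H. two_factor H G \<and> real (card (cycles H)) \<le> real (card (pverts G)) / 7)"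
proof (rule exI[of _ "compile two_factor_prog"], unfold poly_time_computes_def,
    rule exI[of _ "cost two_factor_prog"], intro allI impI)
  fix G :: "nat pair_pre_digraph" and L
  assume "(pair_graph G \<and> Digraph_Component.connected (with_proj G) \<and> regular 3 G \<and> bipartite G \<and> card (pverts G) > 6) \<and> represents L G"
  then have pg: "pair_graph G" and con: "Digraph_Component.connected (with_proj G)" and reg: "regular 3 G"
    and bi: "bipartite G" and big: "card (pverts G) > 6" and rep: "represents L G" by auto
  obtain N es where L: "L = (N, es)" by (cases L)
  have V: "pverts G = {..<N}" and Ges: "parcs G = set es \<union> (set es)\<inverse>" and dist: "distinct (map (\<lambda>(u, v). {u, v}) es)"
    using rep by (auto simp: represents_def L)
  have N: "7 \<le> N" using big V by simp
  interpret pair_graph G by (rule pg)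
  let ?E = "parcs G"
  have EN: "?E \<subseteq> {..<N} \<times> {..<N}" using in_arcsD1 in_arcsD2 V by auto
  have finE: "finite ?E" by (rule pair_finite_arcs)
  have symE: "sym ?E" using Ges by (auto simp: sym_def)
  obtain A B where AB: "pverts G = A \<union> B" "A \<inter> B = {}" "?E \<subseteq> A \<times> B \<union> B \<times> A" using bi by (auto simp: bipartite_def)
  have deg: "card (?E `` {v}) = 3" if "v < N" for v
    using reg that V by (simp add: regular_def out_degree_with_proj)
  have Dom: "Domain ?E = {..<N}"
  proof
    show "Domain ?E \<subseteq> {..<N}" using EN by auto
    show "{..<N} \<subseteq> Domain ?E"
    proof
      fix v assume "v \<in> {..<N}"
      then have "?E `` {v} \<noteq> {}" using deg[of v] by auto
      then show "v \<in> Domain ?E" by auto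
    qed
  qed
  have reach: "(u, v) \<in> ?E\<^sup>*" if uv: "u < N" "v < N" for u v
  proof -
    \<comment> \<open>Connectedness refers to the symmetric closure, which adds no arcs here because
      the graph is already symmetric.\<close>
    let ?M = "mk_symmetric (with_proj G)"
    have M: "pverts ?M = {..<N}" "parcs ?M = ?E" using V symE by (auto simp: mk_symmetric_def dest: symD)
    have "u \<rightarrow>\<^sup>*\<^bsub>with_proj ?M\<^esub> v" using con uv M(1)
      unfolding Digraph_Component.connected_def strongly_connected_def by simp
    then have "(u, v) \<in> rtrancl_on {..<N} ?E" unfolding reachable_def using M by simp
    then show ?thesis by (induction rule: rtrancl_on_induct) (auto intro: rtrancl_into_rtrancl)
  qed
  have cub: "cubic_bip A ?E"
    unfolding cubic_bip_def
  proof (intro conjI ballI)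
    show "case e of (u, v) \<Rightarrow> u \<in> A \<longleftrightarrow> v \<notin> A" if "e \<in> ?E" for e
      using that AB(2,3) by (cases e) blast
  qed (use finE symE deg reach Dom in auto)
  \<comment> \<open>The listed edges are distinct arcs, of which a cubic graph has
    \<open>3 * N\<close>; this is the number of rounds of \<open>build\<close>.\<close>
  have len: "length es \<le> 3 * N"
  proof -
    have "distinct es" using dist by (simp add: distinct_map)
    then have "length es = card (set es)" by (simp add: distinct_card)
    also have "\<dots> \<le> card ?E" by (rule card_mono[OF finE]) (simp add: Ges)
    also have "?E = (SIGMA v:{..<N}. ?E `` {v})" using EN by auto
    also have "card \<dots> = (\<Sum>v<N. card (?E `` {v}))" using finE by (simp add: card_SigmaI finite_Image)
    also have "\<dots> = 3 * N" using deg by simp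
    finally show ?thesis .
  qed
  define s where "s = input_state L"
  have s: "s ''n'' 0 = N" "s ''m'' 0 = length es" "\<And>i. i < length es \<Longrightarrow> (s ''u'' i, s ''v'' i) = es ! i"
    by (simp_all add: s_def input_state_def L)
  define r where "r = run two_factor_prog s"
  obtain h where h: "perfect ?E h" "7 * card (comps (Domain ?E) (factor ?E h)) \<le> N"
    "set (elist r) = {(x, y) \<in> factor ?E h. x < y}" "distinct (elist r)"
    using two_factor_prog_correct[OF s len dist Ges EN cub N] unfolding r_def by blast
  define F where "F = factor ?E h"
  define H where "H = \<lparr>pverts = {..<N}, parcs = F\<rparr>"
  have H: "pverts H = {..<N}" "parcs H = F" by (simp_all add: H_def)
  have symF: "sym F" unfolding F_def by (rule sym_factor[OF symE h(1)])
  have FE: "F \<subseteq> ?E" by (auto simp: F_def factor_def)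
  have irr: "u \<noteq> v" if "(u, v) \<in> ?E" for u v using pair_no_loops[OF that] by simp
  obtain t where t: "t \<le> poly (cost two_factor_prog) (s ''n'' 0)" "exec (compile two_factor_prog) s t r"
    using exec_compile[OF ok_two_factor_prog, of s] unfolding r_def by blast
  have rn: "r ''n'' 0 = N" unfolding r_def using s(1) ok_two_factor_prog by simp
  have "output_of r = (N, elist r)" by (simp add: output_of_def elist_def rn)
  have "represents (output_of r) H"
  proof -
    have "F = set (elist r) \<union> (set (elist r))\<inverse>"
    proof
      show "F \<subseteq> set (elist r) \<union> (set (elist r))\<inverse>"
      proof (rule subrelI)
        fix x y assume xy: "(x, y) \<in> F"
        then have "(y, x) \<in> F" "x \<noteq> y" using symF FE irr by (auto dest: symD)
        then show "(x, y) \<in> set (elist r) \<union> (set (elist r))\<inverse>"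
          using xy unfolding h(3) F_def[symmetric] by (cases "x < y") auto
      qed
      show "set (elist r) \<union> (set (elist r))\<inverse> \<subseteq> F"
        using symF unfolding h(3) F_def[symmetric] by (auto dest: symD)
    qed
    moreover have "distinct (map (\<lambda>(u, v). {u, v}) (elist r))"
      unfolding distinct_map
    proof (intro conjI h(4) inj_onI)
      fix e f assume "e \<in> set (elist r)" "f \<in> set (elist r)" "(case e of (u, v) \<Rightarrow> {u, v}) = (case f of (u, v) \<Rightarrow> {u, v})"
      then show "e = f" unfolding h(3) by (cases e; cases f) (auto simp: doubleton_eq_iff)
    qed
    ultimately show ?thesis unfolding represents_def \<open>output_of r = (N, elist r)\<close> H by simp
  qed
  have degF: "card (F `` {v}) = 2" if v: "v < N" for v
  proof -
    have "F `` {v} = ?E `` {v} - {h v}" by (auto simp: F_def factor_def)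
    moreover have "h v \<in> ?E `` {v}" using h(1) v Dom by (auto simp: perfect_def)
    ultimately show ?thesis using deg[OF v] finE by (simp add: card_Diff_singleton finite_Image)
  qed
  have FN: "F \<subseteq> {..<N} \<times> {..<N}" using FE EN by blast
  have pgH: "pair_graph H"
  proof
    show "finite (parcs H)" unfolding H using finE FE by (rule rev_finite_subset)
    show "symmetric (with_proj H)" unfolding symmetric_def using symF H by simp
  qed (use FN FE irr H in auto)
  have "two_factor H G"
    unfolding two_factor_def
  proof (intro conjI pgH)
    interpret HH: pair_graph H by (rule pgH)
    show "spanning (with_proj H) (with_proj G)"
      unfolding spanning_def subgraph_def compatible_def
      using V H FE HH.wf_digraph_axioms wf_digraph_axioms by simp
    show "regular 2 H" unfolding regular_def out_degree_with_proj H using degF by simp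
  qed
  moreover have "real (card (cycles H)) \<le> real (card (pverts G)) / 7"
  proof -
    have "card (cycles H) \<le> card (comps {..<N} F)"
      using card_cycles_le[of H] symF degF FN unfolding H by simp
    then have "7 * card (cycles H) \<le> N" using h(2) unfolding Dom F_def by linarith
    then have "7 * real (card (cycles H)) \<le> real N" by (metis of_nat_le_iff of_nat_mult of_nat_numeral)
    then show ?thesis using V by simp
  qed
  moreover have "t \<le> poly (cost two_factor_prog) (card (pverts G))" using t(1) s(1) V by simp
  ultimately show "\<exists>t s H. exec (compile two_factor_prog) (input_state L) t s \<and>
      t \<le> poly (cost two_factor_prog) (card (pverts G)) \<and> represents (output_of s) H \<and>
      two_factor H G \<and> real (card (cycles H)) \<le> real (card (pverts G)) / 7"
    using t(2) \<open>represents (output_of r) H\<close> unfolding s_def by blast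
qed

end
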